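(* Let $N\ge 4$, let $\mu_1,\dots,\mu_N\in\mathbf{C}$ be distinct, and let $X=Q\cap Q_1\subset\mathrm{P}^{N-1}$, where $Q=\{\sum_{i=1}^N x_i^2=0\}$ and $Q_1=\{q_1=0\}$ with $q_1=\sum_{i=1}^N\mu_ix_i^2$. For $1\le i\le N$ let $$\Delta_i=\sum_{j\ne i}\frac{(x_i\partial_j-x_j\partial_i)^2}{\mu_i-\mu_j},$$ regarded as a second-order differential operator on local sections of $\mathcal{O}(k)$ over $Q$. If $k=-(N-4)/2$, then $\Delta_i$ maps local sections of $\mathcal{O}(k)$ divisible by $q_1$ to local sections divisible by $q_1$, and hence induces a well-defined holomorphic differential operator on local sections of $\mathcal{O}(k)$ over $X$. Moreover $K_X\cong\mathcal{O}(-(N-4))=\mathcal{O}(2k)$, so that $\mathcal{O}(k)$ is a square root of the canonical bundle of $X$, and the operators commute: $[\Delta_i,\Delta_j]=0$ for all $i,j$.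
   Context: Here $\partial_i=\partial/\partial x_i$, and $(x_i\partial_j-x_j\partial_i)^2$ denotes the composition of the vector field $X_{ij}=x_i\partial_j-x_j\partial_i$ with itself as a differential operator. The $X_{ij}$ are the standard generators of $\mathfrak{so}(N)$ and are tangent to the cone $\sum_i x_i^2=0$, so they act on functions on that cone. Local sections of $\mathcal{O}(k)$ over $Q$ (respectively $X$) are regarded as local holomorphic functions $f(x)$ on the cone over $Q$ (respectively $X$) minus the origin which are homogeneous of degree $k$, i.e. satisfy $\sum_j x_j\partial_jf=kf$; when $N$ is odd, $k$ is a half-integer and $\mathcal{O}(k)$ and the phrase "square root" are understood in this local sense. $K_X$ denotes the canonical bundle of $X$. A local section of $\mathcal{O}(k)$ over $Q$ is divisible by $q_1$ if it is of the form $fq_1$ with $f$ a local section of $\mathcal{O}(k-2)$. *)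

theory Defs
  imports "HOL-Analysis.Analysis"
begin

section \<open>The intersection of two quadrics in projective space\<close>

text \<open>A point of projective space is represented by the corresponding line without the
  origin, so that the cone over a set \<open>S\<close> of points, minus the origin, is \<open>\<Union>S\<close>.
  Here \<open>N = CARD('n)\<close>.\<close>

definition proj_pt :: "complex^'n \<Rightarrow> (complex^'n) set" where
  "proj_pt x = {c *s x | c. c \<noteq> 0}"

definition proj_space :: "(complex^'n) set set" where
  "proj_space = proj_pt ` {x. x \<noteq> 0}"

definition q0 :: "complex^'n \<Rightarrow> complex" where
  "q0 x = (\<Sum>i\<in>UNIV. (x $ i)\<^sup>2)"

definition q1 :: "('n::finite \<Rightarrow> complex) \<Rightarrow> complex^'n \<Rightarrow> complex" where
  "q1 \<mu> x = (\<Sum>i\<in>UNIV. \<mu> i * (x $ i)\<^sup>2)"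

definition quadric_Q :: "(complex^'n) set set" where
  "quadric_Q = {p \<in> proj_space. \<forall>x\<in>p. q0 x = 0}"

definition quadric_Q1 :: "('n::finite \<Rightarrow> complex) \<Rightarrow> (complex^'n) set set" where
  "quadric_Q1 \<mu> = {p \<in> proj_space. \<forall>x\<in>p. q1 \<mu> x = 0}"

definition variety_X :: "('n::finite \<Rightarrow> complex) \<Rightarrow> (complex^'n) set set" where
  "variety_X \<mu> = quadric_Q \<inter> quadric_Q1 \<mu>"

definition cone_Q :: "(complex^'n) set" where
  "cone_Q = \<Union>quadric_Q"

definition cone_X :: "('n::finite \<Rightarrow> complex) \<Rightarrow> (complex^'n) set" where
  "cone_X \<mu> = \<Union>(variety_X \<mu>)"


section \<open>Holomorphic functions on the cones\<close>

definition holo :: "(complex^'n) set \<Rightarrow> (complex^'n \<Rightarrow> complex) \<Rightarrow> bool" where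
  "holo V F \<longleftrightarrow> open V \<and>
     (\<forall>x\<in>V. \<exists>L. (F has_derivative L) (at x) \<and> (\<forall>c v. L (c *s v) = c * L v))"

definition local_ext ::
  "(complex^'n) set \<Rightarrow> (complex^'n \<Rightarrow> complex) \<Rightarrow> complex^'n \<Rightarrow>
   (complex^'n) set \<Rightarrow> (complex^'n \<Rightarrow> complex) \<Rightarrow> bool" where
  "local_ext W f x V F \<longleftrightarrow> x \<in> V \<and> holo V F \<and> (\<forall>y\<in>V \<inter> W. F y = f y)"

text \<open>In what follows \<open>W\<close> is a relatively open subset of one of the two cones, which are complex
  submanifolds of \<open>\<complex>\<^sup>N\<close>.\<close>

definition holo_cone :: "(complex^'n) set \<Rightarrow> (complex^'n \<Rightarrow> complex) \<Rightarrow> bool" where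
  "holo_cone W f \<longleftrightarrow> (\<forall>x\<in>W. \<exists>V F. local_ext W f x V F)"

text \<open>The derivative of \<open>f\<close> at \<open>x \<in> W\<close> along \<open>v\<close>: the common value of the derivatives of all local
  holomorphic extensions. It is only meaningful for \<open>v\<close> tangent to the cone.\<close>

definition tderiv ::
  "(complex^'n) set \<Rightarrow> (complex^'n \<Rightarrow> complex) \<Rightarrow> complex^'n \<Rightarrow> complex^'n \<Rightarrow> complex" where
  "tderiv W f x v =
     (THE d. \<exists>V F. local_ext W f x V F \<and> d = frechet_derivative F (at x) v)"


section \<open>Local sections of \<open>\<O>(k)\<close>\<close>

text \<open>Holomorphic functions on \<open>W\<close> satisfying Euler's equation; the value at \<open>x\<close> of the vector field
  \<open>\<Sum>\<^sub>j x\<^sub>j \<partial>\<^sub>j\<close> is \<open>x\<close> itself. Taking for \<open>W\<close> the cone over an open \<open>U\<close> and \<open>k\<close> an integer gives the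
  sections of \<open>\<O>(k)\<close> over \<open>U\<close>; arbitrary \<open>W\<close> are allowed so that \<open>k\<close> may be a half-integer. Sections
  over \<open>W\<close> are extended by \<open>0\<close>, so that equality of sections is equality of functions.\<close>

definition O_sec :: "complex \<Rightarrow> (complex^'n) set \<Rightarrow> (complex^'n \<Rightarrow> complex) set" where
  "O_sec k W = {f. holo_cone W f \<and> (\<forall>x\<in>W. tderiv W f x x = k * f x) \<and> (\<forall>x. x \<notin> W \<longrightarrow> f x = 0)}"

definition restr :: "(complex^'n) set \<Rightarrow> (complex^'n \<Rightarrow> complex) \<Rightarrow> complex^'n \<Rightarrow> complex" where
  "restr W f = (\<lambda>x. if x \<in> W then f x else 0)"

definition divisible_q1 ::
  "('n::finite \<Rightarrow> complex) \<Rightarrow> complex \<Rightarrow> (complex^'n) set \<Rightarrow> (complex^'n \<Rightarrow> complex) \<Rightarrow> bool" where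
  "divisible_q1 \<mu> k W f \<longleftrightarrow> (\<exists>g\<in>O_sec (k - 2) W. f = (\<lambda>x. g x * q1 \<mu> x))"


section \<open>The operators \<open>\<Delta>\<^sub>i\<close>\<close>

definition X_op ::
  "(complex^'n) set \<Rightarrow> 'n \<Rightarrow> 'n \<Rightarrow> (complex^'n \<Rightarrow> complex) \<Rightarrow> complex^'n \<Rightarrow> complex" where
  "X_op W i j f = restr W (\<lambda>x. tderiv W f x ((x $ i) *s axis j 1 - (x $ j) *s axis i 1))"

definition Delta ::
  "('n::finite \<Rightarrow> complex) \<Rightarrow> 'n \<Rightarrow> (complex^'n) set \<Rightarrow> (complex^'n \<Rightarrow> complex) \<Rightarrow> complex^'n \<Rightarrow> complex" where
  "Delta \<mu> i W f = (\<lambda>x. \<Sum>j\<in>UNIV - {i}. X_op W i j (X_op W i j f) x / (\<mu> i - \<mu> j))"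


section \<open>Differential operators on \<open>\<O>(k)\<close>\<close>

text \<open>\<open>C\<close> is one of the two cones, and an operator is a family of maps indexed by the relatively open
  subsets of \<open>C\<close>.\<close>

type_synonym 'n operator = "(complex^'n) set \<Rightarrow> (complex^'n \<Rightarrow> complex) \<Rightarrow> complex^'n \<Rightarrow> complex"

definition sheaf_op :: "(complex^'n) set \<Rightarrow> complex \<Rightarrow> 'n operator \<Rightarrow> bool" where
  "sheaf_op C k D \<longleftrightarrow>
     (\<forall>W. openin (top_of_set C) W \<longrightarrow>
        (\<forall>f\<in>O_sec k W. D W f \<in> O_sec k W) \<and>
        (\<forall>f\<in>O_sec k W. \<forall>g\<in>O_sec k W. \<forall>a b.
           D W (\<lambda>x. a * f x + b * g x) = (\<lambda>x. a * D W f x + b * D W g x)) \<and>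
        (\<forall>f\<in>O_sec k W. \<forall>W'. openin (top_of_set C) W' \<and> W' \<subseteq> W \<longrightarrow>
           D W' (restr W' f) = restr W' (D W f)))"

definition commutator_fun :: "(complex^'n \<Rightarrow> complex) \<Rightarrow> 'n operator \<Rightarrow> 'n operator" where
  "commutator_fun g D = (\<lambda>W f x. D W (\<lambda>y. g y * f y) x - g x * D W f x)"

text \<open>Grothendieck's definition of a differential operator of order at most \<open>m\<close>: all
  \<open>(m+1)\<close>-fold commutators with local holomorphic functions (local sections of \<open>\<O>(0)\<close>) vanish.\<close>

definition diff_op :: "nat \<Rightarrow> (complex^'n) set \<Rightarrow> complex \<Rightarrow> 'n operator \<Rightarrow> bool" where
  "diff_op m C k D \<longleftrightarrow> sheaf_op C k D \<and>
     (\<forall>W. openin (top_of_set C) W \<longrightarrow>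
        (\<forall>gs. length gs = m + 1 \<and> set gs \<subseteq> O_sec 0 W \<longrightarrow>
           (\<forall>f\<in>O_sec k W. foldr commutator_fun gs D W f = (\<lambda>x. 0))))"

definition ops_commute ::
  "(complex^'n) set \<Rightarrow> complex \<Rightarrow> 'n operator \<Rightarrow> 'n operator \<Rightarrow> bool" where
  "ops_commute C k D E \<longleftrightarrow>
     (\<forall>W. openin (top_of_set C) W \<longrightarrow> (\<forall>f\<in>O_sec k W. D W (E W f) = E W (D W f)))"

definition ops_agree ::
  "(complex^'n) set \<Rightarrow> complex \<Rightarrow> 'n operator \<Rightarrow> 'n operator \<Rightarrow> bool" where
  "ops_agree C k D E \<longleftrightarrow>
     (\<forall>W. openin (top_of_set C) W \<longrightarrow> (\<forall>f\<in>O_sec k W. D W f = E W f))"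

definition induces_on_X ::
  "('n::finite \<Rightarrow> complex) \<Rightarrow> complex \<Rightarrow> 'n operator \<Rightarrow> 'n operator \<Rightarrow> bool" where
  "induces_on_X \<mu> k P D \<longleftrightarrow>
     (\<forall>W. openin (top_of_set cone_Q) W \<longrightarrow>
        (\<forall>f\<in>O_sec k W. D (W \<inter> cone_X \<mu>) (restr (W \<inter> cone_X \<mu>) f) = restr (W \<inter> cone_X \<mu>) (P W f)))"


section \<open>The canonical bundle of \<open>X\<close>\<close>

definition tangent_cone_X :: "('n::finite \<Rightarrow> complex) \<Rightarrow> complex^'n \<Rightarrow> (complex^'n) set" where
  "tangent_cone_X \<mu> x =
     {v. frechet_derivative q0 (at x) v = 0 \<and> frechet_derivative (q1 \<mu>) (at x) v = 0}"

definition alternating_form ::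
  "(complex^'n) set \<Rightarrow> nat \<Rightarrow> ((complex^'n) list \<Rightarrow> complex) \<Rightarrow> bool" where
  "alternating_form T p \<phi> \<longleftrightarrow>
     (\<forall>vs i v w a b. length vs = p \<and> set vs \<subseteq> T \<and> i < p \<and> v \<in> T \<and> w \<in> T \<longrightarrow>
        \<phi> (vs[i := a *s v + b *s w]) = a * \<phi> (vs[i := v]) + b * \<phi> (vs[i := w])) \<and>
     (\<forall>vs i j. length vs = p \<and> set vs \<subseteq> T \<and> i < j \<and> j < p \<and> vs ! i = vs ! j \<longrightarrow> \<phi> vs = 0)"

type_synonym 'n form = "complex^'n \<Rightarrow> (complex^'n) list \<Rightarrow> complex"

definition holo_form_cone :: "('n::finite \<Rightarrow> complex) \<Rightarrow> nat \<Rightarrow> (complex^'n) set \<Rightarrow> 'n form \<Rightarrow> bool" where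
  "holo_form_cone \<mu> p W \<omega> \<longleftrightarrow>
     (\<forall>x\<in>W. alternating_form (tangent_cone_X \<mu> x) p (\<omega> x)) \<and>
     (\<forall>x\<in>W. \<exists>V \<Omega>. open V \<and> x \<in> V \<and>
        (\<forall>vs. length vs = p \<longrightarrow> holo V (\<lambda>y. \<Omega> y vs)) \<and>
        (\<forall>y\<in>V. alternating_form UNIV p (\<Omega> y)) \<and>
        (\<forall>y\<in>V \<inter> W. \<forall>vs. length vs = p \<and> set vs \<subseteq> tangent_cone_X \<mu> y \<longrightarrow> \<omega> y vs = \<Omega> y vs)) \<and>
     (\<forall>x vs. \<not> (x \<in> W \<and> length vs = p \<and> set vs \<subseteq> tangent_cone_X \<mu> x) \<longrightarrow> \<omega> x vs = 0)"

text \<open>Local sections of the canonical bundle: holomorphic forms of top degree \<open>N - 3 = dim X\<close>.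
  The tangent space of \<open>X\<close> at \<open>[x]\<close> is \<open>T\<^sub>x / \<complex>x\<close>, where \<open>T\<^sub>x\<close> is the tangent space of the cone, and
  \<open>v\<close> at \<open>x\<close> and \<open>cv\<close> at \<open>cx\<close> represent the same tangent vector. So a form on \<open>X\<close> is (via pull-back) a
  form on the cone which is annihilated by \<open>x\<close> and invariant under scaling. Over the cone \<open>W\<close> of an
  open \<open>U\<close> in \<open>X\<close> the connected component below is all of \<open>\<complex> - {0}\<close>, and one gets the sections of
  the canonical bundle over \<open>U\<close>; the component makes the notion local on the cone, as for \<open>\<O>(k)\<close>.\<close>

definition K_sec :: "('n::finite \<Rightarrow> complex) \<Rightarrow> (complex^'n) set \<Rightarrow> 'n form set" where
  "K_sec \<mu> W = {\<omega>. holo_form_cone \<mu> (CARD('n) - 3) W \<omega> \<and>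
     (\<forall>x\<in>W. \<forall>vs. x \<in> set vs \<longrightarrow> \<omega> x vs = 0) \<and>
     (\<forall>x\<in>W. \<forall>c vs. connected_component {c. c *s x \<in> W} 1 c \<longrightarrow>
        \<omega> (c *s x) (map ((*s) c) vs) = \<omega> x vs)}"

definition restr_form :: "(complex^'n) set \<Rightarrow> 'n form \<Rightarrow> 'n form" where
  "restr_form W \<omega> = (\<lambda>x vs. if x \<in> W then \<omega> x vs else 0)"

text \<open>An isomorphism of line bundles, as an isomorphism of the sheaves of sections, linear over the
  sheaf of holomorphic functions on \<open>X\<close>.\<close>

definition K_iso_O :: "('n::finite \<Rightarrow> complex) \<Rightarrow> complex \<Rightarrow> bool" where
  "K_iso_O \<mu> m \<longleftrightarrow> (\<exists>\<Phi>.
     (\<forall>W. openin (top_of_set (cone_X \<mu>)) W \<longrightarrow>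
        bij_betw (\<Phi> W) (K_sec \<mu> W) (O_sec m W) \<and>
        (\<forall>\<omega>\<in>K_sec \<mu> W. \<forall>\<eta>\<in>K_sec \<mu> W.
           \<Phi> W (\<lambda>x vs. \<omega> x vs + \<eta> x vs) = (\<lambda>x. \<Phi> W \<omega> x + \<Phi> W \<eta> x)) \<and>
        (\<forall>g\<in>O_sec 0 W. \<forall>\<omega>\<in>K_sec \<mu> W. \<Phi> W (\<lambda>x vs. g x * \<omega> x vs) = (\<lambda>x. g x * \<Phi> W \<omega> x)) \<and>
        (\<forall>\<omega>\<in>K_sec \<mu> W. \<forall>W'. openin (top_of_set (cone_X \<mu>)) W' \<and> W' \<subseteq> W \<longrightarrow>
           \<Phi> W' (restr_form W' \<omega>) = restr W' (\<Phi> W \<omega>))))"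

definition O_frame ::
  "('n::finite \<Rightarrow> complex) \<Rightarrow> complex \<Rightarrow> (complex^'n) set \<Rightarrow> (complex^'n \<Rightarrow> complex) \<Rightarrow> bool" where
  "O_frame \<mu> k W s \<longleftrightarrow> s \<in> O_sec k W \<and>
     (\<forall>W'. openin (top_of_set (cone_X \<mu>)) W' \<and> W' \<subseteq> W \<longrightarrow>
        (\<forall>f\<in>O_sec k W'. \<exists>!g. g \<in> O_sec 0 W' \<and> f = (\<lambda>x. g x * s x)))"

definition K_frame :: "('n::finite \<Rightarrow> complex) \<Rightarrow> (complex^'n) set \<Rightarrow> 'n form \<Rightarrow> bool" where
  "K_frame \<mu> W \<sigma> \<longleftrightarrow> \<sigma> \<in> K_sec \<mu> W \<and>
     (\<forall>W'. openin (top_of_set (cone_X \<mu>)) W' \<and> W' \<subseteq> W \<longrightarrow>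
        (\<forall>\<omega>\<in>K_sec \<mu> W'. \<exists>!g. g \<in> O_sec 0 W' \<and> \<omega> = (\<lambda>x vs. g x * \<sigma> x vs)))"

text \<open>\<open>\<O>(k)\<close> is locally free of rank one over \<open>X\<close>, and there is a bilinear pairing \<open>\<beta>\<close> inducing
  \<open>\<O>(k) \<otimes> \<O>(k) \<cong> K\<^sub>X\<close>: for a local frame \<open>s\<close>, the tensor product has the frame \<open>s \<otimes> s\<close>, so
  this means that \<open>\<beta> (s, s)\<close> is a local frame.\<close>

definition sqrt_of_K :: "('n::finite \<Rightarrow> complex) \<Rightarrow> complex \<Rightarrow> bool" where
  "sqrt_of_K \<mu> k \<longleftrightarrow>
     (\<forall>x\<in>cone_X \<mu>. \<exists>W s. openin (top_of_set (cone_X \<mu>)) W \<and> x \<in> W \<and> O_frame \<mu> k W s) \<and>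
     (\<exists>\<beta>. \<forall>W. openin (top_of_set (cone_X \<mu>)) W \<longrightarrow>
        (\<forall>f\<in>O_sec k W. \<forall>g\<in>O_sec k W. \<beta> W f g \<in> K_sec \<mu> W) \<and>
        (\<forall>f\<in>O_sec k W. \<forall>g\<in>O_sec k W. \<forall>h\<in>O_sec k W. \<forall>a\<in>O_sec 0 W. \<forall>b\<in>O_sec 0 W.
           \<beta> W (\<lambda>x. a x * f x + b x * g x) h = (\<lambda>x vs. a x * \<beta> W f h x vs + b x * \<beta> W g h x vs) \<and>
           \<beta> W h (\<lambda>x. a x * f x + b x * g x) = (\<lambda>x vs. a x * \<beta> W h f x vs + b x * \<beta> W h g x vs)) \<and>
        (\<forall>f\<in>O_sec k W. \<forall>g\<in>O_sec k W. \<forall>W'. openin (top_of_set (cone_X \<mu>)) W' \<and> W' \<subseteq> W \<longrightarrow>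
           \<beta> W' (restr W' f) (restr W' g) = restr_form W' (\<beta> W f g)) \<and>
        (\<forall>s. O_frame \<mu> k W s \<longrightarrow> K_frame \<mu> W (\<beta> W s s)))"

end

theory Submission
  imports Defs "HOL-Complex_Analysis.Cauchy_Integral_Formula"
begin

text \<open>The \<open>X\<^sub>i\<^sub>j\<close> act as derivations on holomorphic functions on the cone over \<open>Q\<close>, and the infinitesimal
  braid relations \<open>[X\<^sub>i\<^sub>j\<^sup>2, X\<^sub>i\<^sub>k\<^sup>2 + X\<^sub>j\<^sub>k\<^sup>2] = 0\<close>, together with a partial fraction identity, make the \<open>\<Delta>\<^sub>i\<close>
  commute. From \<open>X\<^sub>i\<^sub>j q\<^sub>1 = 2 (\<mu>\<^sub>j - \<mu>\<^sub>i) x\<^sub>i x\<^sub>j\<close> and \<open>\<Sum>\<^sub>j x\<^sub>j X\<^sub>i\<^sub>j = x\<^sub>i E\<close> on the cone, where \<open>E\<close> is the Euler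
  field, \<open>\<Delta>\<^sub>i (g q\<^sub>1) = q\<^sub>1 \<Delta>\<^sub>i g - (4 deg g + 2 N) x\<^sub>i\<^sup>2 g\<close>, and the last term vanishes precisely for
  \<open>deg g = k - 2 = - N / 2\<close>.

  Sections of \<open>\<O>(k)\<close> over \<open>X\<close> extend locally to \<open>Q\<close>, and \<open>\<Delta>\<^sub>i f\<close> vanishes on \<open>X\<close> whenever \<open>f\<close> does; this is
  shown with derivatives of \<open>f\<close> only, without dividing \<open>f\<close> by \<open>q\<^sub>1\<close>. So the operators descend
  to \<open>X\<close> with all their properties. The canonical bundle is trivialized up to degree by the residue
  form, which is homogeneous of degree \<open>N - 4\<close> and spans the top-degree forms on \<open>X\<close> at each point.\<close>

section \<open>Holomorphic functions of several variables\<close>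

text \<open>A function on a cone has many holomorphic extensions, so each derivative is tied to a
  curve inside the cone; hence the explicit curves built from rays, rotations and square roots. The
  fields \<open>X i j\<close> are tangent to Q but in general not to X, so the induced operator is
  defined by lifting a section from X to Q near each point, and it has a meaning only if the lift
  does not matter. Divisibility by \<open>q1\<close> would give this only after a division theorem
  for functions vanishing on X. Instead, a combination of two rotations that kills \<open>q1\<close>
  is tangent to X and annihilates functions vanishing there; using this relation twice reaches
  second order. Both computations single out the same degree: \<open>4 * (k - 2) + 2 * N = 0\<close>
  in the product formula, \<open>4 - N - 2 * k = 0\<close> here. For half-integral k, homogeneity
  makes sense only near \<open>c = 1\<close>, through \<open>exp (k * Ln c)\<close>, and a lift is
  made homogeneous by normalizing one nonzero coordinate. The degree of the residue form counts
  \<open>N - 2\<close> scaled rows of a determinant, minus 2 from its denominator.\<close>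

abbreviation fd :: "(complex^'n \<Rightarrow> complex) \<Rightarrow> complex^'n \<Rightarrow> complex^'n \<Rightarrow> complex" where
  "fd F x \<equiv> frechet_derivative F (at x)"

lemma norm_smult: "norm (c *s (v::complex^'n)) = norm c * norm v"
  by (simp add: norm_vec_def vector_scalar_mult_def norm_mult L2_set_right_distrib)

lemma smult_of_real: "complex_of_real r *s (v::complex^'n) = r *\<^sub>R v"
  unfolding vec_eq_iff vector_scaleR_component vector_smult_component scaleR_conv_of_real[where 'a=complex] by simp

lemma bounded_linear_smult_left: "bounded_linear (\<lambda>c. c *s (v::complex^'n))"
  by (rule bounded_linear_intro[where K="norm v"])
     (simp_all add: norm_smult vec_eq_iff algebra_simps)

lemma continuous_on_smult [continuous_intros]:
  "continuous_on S f \<Longrightarrow> continuous_on S g \<Longrightarrow> continuous_on S (\<lambda>x. f x *s (g x :: complex^'n))"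
  unfolding vector_scalar_mult_def by (intro continuous_intros)

lemma fd_eq: "(F has_derivative L) (at x) \<Longrightarrow> fd F x = L"
  by (metis frechet_derivative_at)

lemma holo_open: "holo V F \<Longrightarrow> open V"
  by (simp add: holo_def)

lemma holo_has_derivative: "holo V F \<Longrightarrow> x \<in> V \<Longrightarrow> (F has_derivative fd F x) (at x)"
  unfolding holo_def by (metis fd_eq)

lemma holo_fd_smult: "holo V F \<Longrightarrow> x \<in> V \<Longrightarrow> fd F x (c *s v) = c * fd F x v"
  unfolding holo_def by (metis fd_eq)

lemma holo_bounded_linear: "holo V F \<Longrightarrow> x \<in> V \<Longrightarrow> bounded_linear (fd F x)"
  using holo_has_derivative has_derivative_bounded_linear by blast

lemma holo_fd_diff: "holo V F \<Longrightarrow> x \<in> V \<Longrightarrow> fd F x (v - w) = fd F x v - fd F x w"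
  using holo_bounded_linear bounded_linear.linear linear_diff by blast

lemma holo_fd_sum: "holo V F \<Longrightarrow> x \<in> V \<Longrightarrow> fd F x (sum g A) = (\<Sum>i\<in>A. fd F x (g i))"
  using holo_bounded_linear bounded_linear.linear linear_sum by blast

lemma holoI:
  assumes "open V" "\<And>x. x \<in> V \<Longrightarrow> (F has_derivative L x) (at x)"
    "\<And>x c v. x \<in> V \<Longrightarrow> L x (c *s v) = c * L x v"
  shows "holo V F"
  unfolding holo_def using assms by blast

lemma holo_subset: "holo V F \<Longrightarrow> open U \<Longrightarrow> U \<subseteq> V \<Longrightarrow> holo U F"
  unfolding holo_def by blast

lemma holo_const: "open V \<Longrightarrow> holo V (\<lambda>x. c)"
  by (rule holoI[where L="\<lambda>x v. 0"]) auto

lemma has_derivative_nth: "((\<lambda>x::complex^'n. x $ i) has_derivative (\<lambda>v. v $ i)) (at x)"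
  by (rule bounded_linear_imp_has_derivative[OF bounded_linear_vec_nth])

lemma holo_nth: "open V \<Longrightarrow> holo V (\<lambda>x. x $ i)"
  by (rule holoI[where L="\<lambda>x v. v $ i"]) (auto intro: has_derivative_nth)

lemma
  assumes "holo V F" "holo V G"
  shows holo_add: "holo V (\<lambda>x. F x + G x)"
    and holo_mult: "holo V (\<lambda>x. F x * G x)"
    and fd_add: "x \<in> V \<Longrightarrow> fd (\<lambda>x. F x + G x) x v = fd F x v + fd G x v"
    and fd_mult: "x \<in> V \<Longrightarrow> fd (\<lambda>x. F x * G x) x v = F x * fd G x v + fd F x v * G x"
proof -
  note d = holo_has_derivative[OF assms(1)] holo_has_derivative[OF assms(2)]
  note s = holo_fd_smult[OF assms(1)] holo_fd_smult[OF assms(2)]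
  show "holo V (\<lambda>x. F x + G x)"
    by (rule holoI[OF holo_open[OF assms(1)] has_derivative_add[OF d]]) (auto simp: s algebra_simps)
  show "holo V (\<lambda>x. F x * G x)"
    by (rule holoI[OF holo_open[OF assms(1)] has_derivative_mult[OF d]]) (auto simp: s algebra_simps)
  show "x \<in> V \<Longrightarrow> fd (\<lambda>x. F x + G x) x v = fd F x v + fd G x v"
    using fd_eq[OF has_derivative_add[OF d]] by simp
  show "x \<in> V \<Longrightarrow> fd (\<lambda>x. F x * G x) x v = F x * fd G x v + fd F x v * G x"
    using fd_eq[OF has_derivative_mult[OF d]] by simp
qed

lemma holo_sum: "open V \<Longrightarrow> (\<And>i. i \<in> A \<Longrightarrow> holo V (F i)) \<Longrightarrow> holo V (\<lambda>x. \<Sum>i\<in>A. F i x)"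
  by (induction A rule: infinite_finite_induct) (auto intro: holo_const holo_add)

lemma holo_prod: "open V \<Longrightarrow> (\<And>i. i \<in> A \<Longrightarrow> holo V (F i)) \<Longrightarrow> holo V (\<lambda>x. \<Prod>i\<in>A. F i x)"
  by (induction A rule: infinite_finite_induct) (auto intro: holo_const holo_mult)

lemma holo_compose_field:
  assumes F: "holo V F" and g: "\<And>x. x \<in> V \<Longrightarrow> (g has_field_derivative g' (F x)) (at (F x))"
  shows "holo V (\<lambda>x. g (F x))"
proof (rule holoI[OF holo_open[OF F]])
  fix x assume x: "x \<in> V"
  show "((\<lambda>x. g (F x)) has_derivative (\<lambda>v. g' (F x) * fd F x v)) (at x)"
    using has_derivative_compose[OF holo_has_derivative[OF F x] g[OF x, unfolded has_field_derivative_def]]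
    by simp
  show "g' (F x) * fd F x (c *s v) = c * (g' (F x) * fd F x v)" for c v
    by (simp add: holo_fd_smult[OF F x])
qed

lemma holo_divide:
  assumes F: "holo V F" and G: "holo V G" and nz: "\<And>x. x \<in> V \<Longrightarrow> G x \<noteq> 0"
  shows "holo V (\<lambda>x. F x / G x)"
proof -
  have "holo V (\<lambda>x. inverse (G x))"
    by (rule holo_compose_field[OF G, where g'="\<lambda>z. - (inverse z ^ Suc (Suc 0))"])
       (rule DERIV_inverse[OF nz])
  from holo_mult[OF F this] show ?thesis by (simp add: field_simps)
qed

lemma has_derivative_vec:
  fixes G :: "'a::real_normed_vector \<Rightarrow> complex^'n"
  assumes "\<And>i. ((\<lambda>x. G x $ i) has_derivative (\<lambda>v. G' v $ i)) (at x within S)"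
  shows "(G has_derivative G') (at x within S)"
  unfolding has_derivative_componentwise_within[of G]
proof
  fix b :: "complex^'n" assume "b \<in> Basis"
  then obtain i c where b: "b = axis i c" by (auto simp: Basis_vec_def)
  show "((\<lambda>x. G x \<bullet> b) has_derivative (\<lambda>v. G' v \<bullet> b)) (at x within S)"
    using has_derivative_inner_left[OF assms[of i], of c] by (simp add: b inner_axis)
qed

lemma holo_compose:
  fixes G :: "complex^'m \<Rightarrow> complex^'n"
  assumes F: "holo V F" and G: "\<And>i. holo U (\<lambda>x. G x $ i)" and UV: "\<And>x. x \<in> U \<Longrightarrow> G x \<in> V"
  shows "holo U (\<lambda>x. F (G x))"
proof -
  define G' where "G' = (\<lambda>x v. \<chi> i. fd (\<lambda>x. G x $ i) x v)"
  show ?thesis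
  proof (rule holoI)
    show "open U" using holo_open[OF G] .
    fix x assume x: "x \<in> U"
    have "(G has_derivative G' x) (at x)"
      by (rule has_derivative_vec) (use holo_has_derivative[OF G x] in \<open>simp add: G'_def\<close>)
    from has_derivative_compose[OF this holo_has_derivative[OF F UV[OF x]]]
    show "((\<lambda>x. F (G x)) has_derivative (\<lambda>v. fd F (G x) (G' x v))) (at x)" .
    have "G' x (c *s v) = c *s G' x v" for c v
      by (simp add: G'_def vec_eq_iff holo_fd_smult[OF G x])
    then show "fd F (G x) (G' x (c *s v)) = c * fd F (G x) (G' x v)" for c v
      by (simp add: holo_fd_smult[OF F UV[OF x]])
  qed
qed

text \<open>Restriction to a complex line reduces several variables to one, where Cauchy's
  inequality is available.\<close>

lemma holo_line_deriv:
  assumes F: "holo V F" and y: "y + z *s v \<in> V"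
  shows "((\<lambda>z. F (y + z *s v)) has_field_derivative fd F (y + z *s v) v) (at z)"
proof -
  have "((\<lambda>z. y + z *s v) has_derivative (\<lambda>h. h *s v)) (at z)"
    by (rule derivative_eq_intros bounded_linear.has_derivative[OF bounded_linear_smult_left]
        has_derivative_ident | simp)+
  from has_derivative_compose[OF this holo_has_derivative[OF F y]]
  have "((\<lambda>z. F (y + z *s v)) has_derivative (\<lambda>h. fd F (y + z *s v) (h *s v))) (at z)" .
  then show ?thesis
    unfolding has_field_derivative_def
    by (rule has_derivative_eq_rhs) (simp add: fun_eq_iff holo_fd_smult[OF F y] mult.commute)
qed

text \<open>Cauchy's estimates along complex lines make the difference quotients of \<open>F\<close> in the
  direction \<open>v\<close> and their derivatives converge uniformly. So a derivative of a holomorphic function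
  is holomorphic, although continuity of the derivative is not assumed.\<close>

lemma difference_quotient_bound:
  fixes y v :: "complex^'n"
  assumes F: "holo V F" and V: "\<And>z. norm z \<le> 3 \<Longrightarrow> y + z *s v \<in> V"
    and M: "\<And>z. norm z \<le> 3 \<Longrightarrow> norm (F (y + z *s v)) \<le> M"
    and h: "norm h \<le> 1" "h \<noteq> 0"
  shows "norm ((F (y + h *s v) - F y) / h - fd F y v) \<le> 2 * M * norm h"
proof -
  define g where "g = (\<lambda>z. F (y + z *s v))"
  have g: "(g has_field_derivative fd F (y + z *s v) v) (at z)" if "norm z \<le> 3" for z
    unfolding g_def using holo_line_deriv[OF F V[OF that]] .
  have hol: "g holomorphic_on ball 0 3"
    unfolding holomorphic_on_def field_differentiable_def
    using g by (metis has_field_derivative_at_within less_imp_le mem_ball_0)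
  have hol2: "(deriv ^^ i) g holomorphic_on ball 0 3" for i
    by (rule holomorphic_higher_deriv[OF hol]) simp
  have tay: "norm ((deriv ^^ 0) g h - (\<Sum>i\<le>1. (deriv ^^ i) g 0 * (h - 0) ^ i / fact i))
        \<le> 2 * M * norm (h - 0) ^ Suc 1 / fact 1"
  proof (rule complex_Taylor[of "cball 0 1" 1 "\<lambda>i. (deriv ^^ i) g"])
    fix i and x :: complex assume x: "x \<in> cball 0 1"
    then have "x \<in> ball 0 3" by simp
    then have "((deriv ^^ i) g has_field_derivative deriv ((deriv ^^ i) g) x) (at x)"
      using hol2 holomorphic_derivI by blast
    then show "((deriv ^^ i) g has_field_derivative (deriv ^^ Suc i) g x) (at x within cball 0 1)"
      by (simp add: has_field_derivative_at_within)
    \<comment> \<open>Unit discs about points with \<open>norm x \<le> 1\<close> stay within radius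
      2, hence inside the disc of radius 3 where \<open>g\<close> is holomorphic and bounded by
      \<open>M\<close>.\<close>
    have "norm ((deriv ^^ 2) g x) \<le> fact 2 * M / 1 ^ 2"
    proof (rule Cauchy_inequality)
      have sub: "cball x 1 \<subseteq> ball 0 3"
      proof
        fix w assume "w \<in> cball x 1"
        then have "norm (x - w) \<le> 1" by (simp add: dist_norm)
        with x norm_triangle_ineq4[of x "x - w"] show "w \<in> ball 0 3" by simp
      qed
      then show "g holomorphic_on ball x 1" "continuous_on (cball x 1) g"
        using hol holomorphic_on_subset ball_subset_cball[of x 1]
         apply (meson order_trans)
        using hol holomorphic_on_subset holomorphic_on_imp_continuous_on sub by blast
      fix w assume w: "norm (x - w) = 1"
      with x norm_triangle_ineq4[of x "x - w"] have "norm w \<le> 3" by simp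
      then show "norm (g w) \<le> M" unfolding g_def by (rule M)
    qed simp
    then show "norm ((deriv ^^ Suc 1) g x) \<le> 2 * M" by (simp add: numeral_2_eq_2)
  qed (use h in auto)
  have "deriv g 0 = fd F y v"
    using DERIV_imp_deriv[OF g[of 0]] by simp
  moreover have "g 0 = F y" by (simp add: g_def)
  ultimately have "norm (g h - F y - fd F y v * h) \<le> 2 * M * norm h ^ 2"
    using tay by (simp add: power2_eq_square algebra_simps)
  moreover have "(F (y + h *s v) - F y) / h - fd F y v = (g h - F y - fd F y v * h) / h"
    using h by (simp add: g_def field_simps)
  ultimately show ?thesis
    using h by (simp add: norm_divide divide_le_eq power2_eq_square mult.assoc)
qed

text \<open>\<open>fd F x v\<close> is the limit of the difference quotients \<open>q n\<close> with
  step \<open>1 / (n + 1)\<close>; their derivatives \<open>q' n\<close> converge uniformly, so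
  limit and differentiation may be interchanged. Short vectors make the discs of radius 3 fit into
  \<open>V\<close>. The last clause keeps the limit that defines \<open>g'\<close>; the symmetry of
  second derivatives is read off from it.\<close>

lemma holo_directional_derivative_local:
  fixes F :: "complex^'n \<Rightarrow> complex"
  assumes F: "holo V F" and x0: "x0 \<in> V"
  obtains \<delta> where "\<delta> > 0"
    "\<And>v. norm v \<le> \<delta> \<Longrightarrow> \<exists>g'. ((\<lambda>x. fd F x v) has_derivative g') (at x0) \<and>
       (\<forall>c w. g' (c *s w) = c * g' w) \<and>
       (\<forall>w. (\<lambda>n. (fd F (x0 + inverse (of_nat (Suc n)) *s v) w - fd F x0 w) / inverse (of_nat (Suc n)))
          \<longlonglongrightarrow> g' w)"
proof -
  have "continuous_on V F"
    using holo_has_derivative[OF F] has_derivative_continuous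
    by (metis continuous_at_imp_continuous_on)
  obtain e where e: "e > 0" "cball x0 e \<subseteq> V"
    using holo_open[OF F] x0 open_contains_cball by blast
  \<comment> \<open>A point within \<open>2 * d\<close> of \<open>x0\<close>, moved by
    \<open>z *s v\<close> with \<open>norm z \<le> 3\<close> and \<open>norm v \<le> d\<close>,
    stays within \<open>5 * d\<close>.\<close>
  define d where "d = e / 6"
  have d: "d > 0" "cball x0 (6 * d) \<subseteq> V" using e by (auto simp: d_def)
  have "compact (F ` cball x0 (6 * d))"
    by (rule compact_continuous_image) (use \<open>continuous_on V F\<close> d in \<open>auto intro: continuous_on_subset\<close>)
  then obtain M where M: "\<And>y. y \<in> cball x0 (6 * d) \<Longrightarrow> norm (F y) \<le> M"
    by (metis compact_imp_bounded bounded_iff imageI)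
  define h :: "nat \<Rightarrow> complex" where "h = (\<lambda>n. inverse (of_nat (Suc n)))"
  have h: "norm (h n) \<le> 1" "h n \<noteq> 0" for n
    by (auto simp: h_def norm_inverse inverse_eq_divide norm_divide simp del: of_nat_Suc)
  have h0: "h \<longlonglongrightarrow> 0"
    unfolding h_def using LIMSEQ_Suc[OF lim_inverse_n] by simp
  show ?thesis
  proof
    show "d > 0" by fact
    fix v :: "complex^'n" assume v: "norm v \<le> d"
    define q where "q = (\<lambda>n y. (F (y + h n *s v) - F y) / h n)"
    define q' where "q' = (\<lambda>n y w. (fd F (y + h n *s v) w - fd F y w) / h n)"
    have inV: "y + z *s v \<in> cball x0 (6 * d)" if "y \<in> cball x0 (2 * d)" "norm z \<le> 3" for y z
    proof -
      have "norm (z *s v) \<le> 3 * d"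
        using that(2) v d(1) by (auto simp: norm_smult intro: mult_mono)
      then have "dist x0 (y + z *s v) \<le> 2 * d + 3 * d"
        using that(1) norm_triangle_ineq4[of "x0 - y" "z *s v"]
        by (simp add: dist_norm algebra_simps)
      then show ?thesis using d by simp
    qed
    have hV: "y + h n *s v \<in> V" if "y \<in> cball x0 (2 * d)" for y n
      using inV[OF that, of "h n"] h(1)[of n] d by auto
    have yV: "y \<in> V" if "y \<in> cball x0 (2 * d)" for y
      using inV[OF that, of 0] d by auto
    have qlim: "norm (q n y - fd F y v) \<le> 2 * M * norm (h n)" if "y \<in> cball x0 (2 * d)" for y n
      unfolding q_def
      by (rule difference_quotient_bound[OF F _ _ h(1) h(2)]) (use inV[OF that] d M in auto)
    have shift: "((\<lambda>y. F (y + a)) has_derivative fd F (y + a)) (at y)" if "y + a \<in> V" for y a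
    proof -
      have "((\<lambda>y. y + a) has_derivative (\<lambda>v. v)) (at y)"
        by (auto intro!: derivative_eq_intros)
      from has_derivative_compose[OF this holo_has_derivative[OF F that]] show ?thesis .
    qed
    have q': "(q n has_derivative q' n y) (at y)" if "y \<in> cball x0 (2 * d)" for y n
      unfolding q_def q'_def divide_inverse
      by (intro has_derivative_mult_left has_derivative_diff shift hV that holo_has_derivative[OF F] yV)
    have q'_smult: "q' n y (c *s w) = c * q' n y w" if "y \<in> cball x0 (2 * d)" for y n c w
      unfolding q'_def by (simp add: holo_fd_smult[OF F hV[OF that]] holo_fd_smult[OF F yV[OF that]] algebra_simps)
    have hq: "holo (ball x0 (2 * d)) (q n)" for n
      by (rule holoI[OF open_ball q']) (auto simp: q'_smult)
    \<comment> \<open>Cauchy's inequality in the direction \<open>w\<close> for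
      \<open>q n - q m\<close>: a uniform bound for values becomes one for derivatives.\<close>
    have est1: "norm (q' n y w - q' m y w) \<le> 2 * M * (norm (h n) + norm (h m))"
      if y: "y \<in> ball x0 d" and w: "norm w \<le> d" for n m y w
    proof -
      have yw: "y + z *s w \<in> ball x0 (2 * d)" if "norm z \<le> 1" for z
      proof -
        have "norm (z *s w) \<le> 1 * d"
          unfolding norm_smult using that w d(1) by (intro mult_mono) auto
        then show ?thesis
          using y norm_triangle_ineq4[of "x0 - y" "z *s w"]
          by (simp add: dist_norm algebra_simps)
      qed
      define g where "g = (\<lambda>z. q n (y + z *s w) - q m (y + z *s w))"
      have g: "(g has_field_derivative q' n (y + z *s w) w - q' m (y + z *s w) w) (at z)"
        if z: "norm z \<le> 1" for z
      proof -
        have in2: "y + z *s w \<in> cball x0 (2 * d)" using yw[OF z] by simp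
        show ?thesis
          using DERIV_diff[OF holo_line_deriv[OF hq[of n] yw[OF z]] holo_line_deriv[OF hq[of m] yw[OF z]]]
          unfolding g_def by (simp add: fd_eq[OF q'[OF in2]])
      qed
      have "norm ((deriv ^^ 1) g 0) \<le> fact 1 * (2 * M * (norm (h n) + norm (h m))) / 1 ^ 1"
      proof (rule Cauchy_inequality)
        show "g holomorphic_on ball 0 1"
          unfolding holomorphic_on_def field_differentiable_def
          using g by (metis has_field_derivative_at_within less_imp_le mem_ball_0)
        show "continuous_on (cball 0 1) g"
          by (intro continuous_at_imp_continuous_on) (use g in \<open>force intro: DERIV_isCont\<close>)
        fix z :: complex assume "norm (0 - z) = 1"
        then have in2: "y + z *s w \<in> cball x0 (2 * d)" using yw[of z] by simp
        have "norm (g z) \<le> norm (q n (y + z *s w) - fd F (y + z *s w) v) + norm (q m (y + z *s w) - fd F (y + z *s w) v)"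
          using norm_triangle_ineq4[of "q n (y + z *s w) - fd F (y + z *s w) v" "q m (y + z *s w) - fd F (y + z *s w) v"]
          by (simp add: g_def)
        also have "\<dots> \<le> 2 * M * norm (h n) + 2 * M * norm (h m)"
          by (intro add_mono qlim in2)
        finally show "norm (g z) \<le> 2 * M * (norm (h n) + norm (h m))"
          by (simp add: algebra_simps)
      qed simp
      then show ?thesis using DERIV_imp_deriv[OF g[of 0]] by simp
    qed
    \<comment> \<open>Homogeneity in \<open>w\<close> removes the bound on its length and yields the
      factor \<open>norm w\<close> that \<open>has_derivative_sequence\<close> asks for.\<close>
    have est: "norm (q' n y w - q' m y w) \<le> 2 * M / d * (norm (h n) + norm (h m)) * norm w"
      if y: "y \<in> ball x0 d" for n m y w
    proof (cases "w = 0")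
      case True
      have "bounded_linear (q' n y)" for n
        using q'[of y n] y d(1) has_derivative_bounded_linear by fastforce
      then show ?thesis using True by (simp add: linear_simps)
    next
      case False
      define c where "c = complex_of_real (norm w / d)"
      have c: "c \<noteq> 0" "norm c = norm w / d" using False d by (auto simp: c_def norm_divide)
      define u where "u = inverse c *s w"
      have wu: "w = c *s u" using c by (simp add: u_def vec_eq_iff)
      have "norm u \<le> d" using c False d by (simp add: u_def norm_smult norm_inverse)
      have y2: "y \<in> cball x0 (2 * d)" using y d by auto
      have "norm (q' n y w - q' m y w) = norm c * norm (q' n y u - q' m y u)"
        unfolding wu q'_smult[OF y2] by (simp add: norm_mult flip: right_diff_distrib)
      also have "\<dots> \<le> norm c * (2 * M * (norm (h n) + norm (h m)))"
        by (intro mult_left_mono est1 y \<open>norm u \<le> d\<close>) auto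
      also have "\<dots> = 2 * M / d * (norm (h n) + norm (h m)) * norm w" by (simp add: c)
      finally show ?thesis .
    qed
    have hn0: "(\<lambda>n. norm (h n)) \<longlonglongrightarrow> 0" using h0 tendsto_norm_zero by blast
    have q_lim: "(\<lambda>n. q n y) \<longlonglongrightarrow> fd F y v" if "y \<in> cball x0 (2 * d)" for y
    proof -
      have "(\<lambda>n. q n y - fd F y v) \<longlonglongrightarrow> 0"
        by (rule Lim_null_comparison[OF always_eventually[OF allI[OF qlim[OF that]]]
            tendsto_mult_right_zero[OF hn0]])
      then show ?thesis by (simp add: LIM_zero_iff)
    qed
    have "convergent (\<lambda>n. q' n y w)" if y: "y \<in> ball x0 d" for y w
      unfolding Cauchy_convergent_iff[symmetric]
    proof (rule metric_CauchyI)
      fix e :: real assume "e > 0"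
      have "(\<lambda>n. 2 * M / d * (norm (h n)) * norm w) \<longlonglongrightarrow> 2 * M / d * 0 * norm w"
        by (intro tendsto_intros hn0)
      then have "\<forall>\<^sub>F n in sequentially. 2 * M / d * (norm (h n)) * norm w < e / 2"
        using \<open>e > 0\<close> by (intro order_tendstoD) auto
      then obtain N where N: "\<And>n. n \<ge> N \<Longrightarrow> 2 * M / d * (norm (h n)) * norm w < e / 2"
        by (auto simp: eventually_sequentially)
      have "dist (q' m y w) (q' n y w) < e" if "m \<ge> N" "n \<ge> N" for m n
      proof -
        have "dist (q' m y w) (q' n y w) \<le> 2 * M / d * (norm (h m)) * norm w + 2 * M / d * (norm (h n)) * norm w"
          using est[OF y, of m w n] by (simp add: dist_norm algebra_simps add_divide_distrib)
        then show ?thesis using N[OF that(1)] N[OF that(2)] by linarith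
      qed
      then show "\<exists>N. \<forall>m\<ge>N. \<forall>n\<ge>N. dist (q' m y w) (q' n y w) < e" by blast
    qed
    then obtain g' where g': "\<And>y w. y \<in> ball x0 d \<Longrightarrow> (\<lambda>n. q' n y w) \<longlonglongrightarrow> g' y w"
      using that[of "\<lambda>y w. lim (\<lambda>n. q' n y w)"] unfolding convergent_LIMSEQ_iff by blast
    \<comment> \<open>Let \<open>m\<close> tend to infinity in the preceding estimate.\<close>
    have est': "norm (q' n y w - g' y w) \<le> 2 * M / d * norm (h n) * norm w"
      if y: "y \<in> ball x0 d" for n y w
    proof (rule tendsto_le[OF sequentially_bot])
      show "(\<lambda>m. norm (q' n y w - q' m y w)) \<longlonglongrightarrow> norm (q' n y w - g' y w)"
        by (intro tendsto_intros g' y)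
      have "(\<lambda>m. 2 * M / d * (norm (h n) + norm (h m)) * norm w)
          \<longlonglongrightarrow> 2 * M / d * (norm (h n) + 0) * norm w"
        by (intro tendsto_intros hn0)
      then show "(\<lambda>m. 2 * M / d * (norm (h n) + norm (h m)) * norm w)
          \<longlonglongrightarrow> 2 * M / d * norm (h n) * norm w" by simp
      show "\<forall>\<^sub>F m in sequentially. norm (q' n y w - q' m y w) \<le> 2 * M / d * (norm (h n) + norm (h m)) * norm w"
        using est[OF y] by simp
    qed
    have "\<exists>g. \<forall>y\<in>ball x0 d. (\<lambda>n. q n y) \<longlonglongrightarrow> g y \<and> (g has_derivative g' y) (at y within ball x0 d)"
    proof (rule has_derivative_sequence[OF convex_ball, where f'=q' and ?x0.0=x0])
      show "(q n has_derivative q' n y) (at y within ball x0 d)" if "y \<in> ball x0 d" for n y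
      proof -
        have "y \<in> cball x0 (2 * d)" using that d(1) by auto
        from has_derivative_at_withinI[OF q'[OF this]] show ?thesis .
      qed
      fix e :: real assume "e > 0"
      have "(\<lambda>n. 2 * M / d * norm (h n)) \<longlonglongrightarrow> 2 * M / d * 0"
        by (intro tendsto_intros hn0)
      then have "\<forall>\<^sub>F n in sequentially. 2 * M / d * norm (h n) < e"
        using \<open>e > 0\<close> by (intro order_tendstoD) auto
      then show "\<forall>\<^sub>F n in sequentially. \<forall>y\<in>ball x0 d. \<forall>w. norm (q' n y w - g' y w) \<le> e * norm w"
      proof eventually_elim
        case (elim n)
        then show ?case
          using est' by (meson less_imp_le mult_right_mono norm_ge_zero order_trans)
      qed
    next
      show "x0 \<in> ball x0 d" using d by simp
      show "(\<lambda>n. q n x0) \<longlonglongrightarrow> fd F x0 v" using q_lim[of x0] d by simp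
    qed
    then obtain g where g: "\<And>y. y \<in> ball x0 d \<Longrightarrow> (\<lambda>n. q n y) \<longlonglongrightarrow> g y"
      "\<And>y. y \<in> ball x0 d \<Longrightarrow> (g has_derivative g' y) (at y within ball x0 d)" by blast
    have gv: "g y = fd F y v" if y: "y \<in> ball x0 d" for y
    proof -
      have y2: "y \<in> cball x0 (2 * d)" using y d by auto
      show ?thesis using LIMSEQ_unique[OF g(1)[OF y] q_lim[OF y2]] .
    qed
    have x0b: "x0 \<in> ball x0 d" using d by simp
    have "(g has_derivative g' x0) (at x0)"
      using g(2)[OF x0b] at_within_open[OF x0b open_ball] by simp
    then have "((\<lambda>x. fd F x v) has_derivative g' x0) (at x0)"
      by (rule has_derivative_transform_within_open[OF _ open_ball x0b]) (simp add: gv)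
    moreover have "g' x0 (c *s w) = c * g' x0 w" for c w
    proof (rule LIMSEQ_unique)
      show "(\<lambda>n. q' n x0 (c *s w)) \<longlonglongrightarrow> g' x0 (c *s w)" by (rule g'[OF x0b])
      have "(\<lambda>n. c * q' n x0 w) \<longlonglongrightarrow> c * g' x0 w" by (intro tendsto_intros g'[OF x0b])
      then show "(\<lambda>n. q' n x0 (c *s w)) \<longlonglongrightarrow> c * g' x0 w"
        using q'_smult[of x0] d by simp
    qed
    moreover have "(\<lambda>n. (fd F (x0 + inverse (of_nat (Suc n)) *s v) w - fd F x0 w) / inverse (of_nat (Suc n)))
          \<longlonglongrightarrow> g' x0 w" for w
      using g'[OF x0b, of w] unfolding q'_def h_def .
    ultimately show "\<exists>g'. ((\<lambda>x. fd F x v) has_derivative g') (at x0) \<and>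
       (\<forall>c w. g' (c *s w) = c * g' w) \<and>
       (\<forall>w. (\<lambda>n. (fd F (x0 + inverse (of_nat (Suc n)) *s v) w - fd F x0 w) / inverse (of_nat (Suc n)))
          \<longlonglongrightarrow> g' w)" by blast
  qed
qed

lemma small_multiple:
  fixes v :: "complex^'n"
  assumes "\<delta> > 0"
  obtains c :: complex where "c \<noteq> 0" "norm (c *s v) \<le> \<delta>"
proof
  show "complex_of_real (\<delta> / (norm v + 1)) \<noteq> 0"
    using assms norm_ge_zero[of v]
    by (simp del: of_real_divide of_real_add add: add_nonneg_eq_0_iff)
  have "norm (complex_of_real (\<delta> / (norm v + 1)) *s v) = \<delta> * (norm v / (norm v + 1))"
    using assms by (simp add: norm_smult norm_divide add_nonneg_nonneg)
  also have "\<dots> \<le> \<delta> * 1"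
    using assms by (intro mult_left_mono) (auto simp: divide_le_eq add_nonneg_pos)
  finally show "norm (complex_of_real (\<delta> / (norm v + 1)) *s v) \<le> \<delta>" by simp
qed

text \<open>A nonzero multiple of \<open>v\<close> is short enough for the local result, and
  linearity of \<open>fd F x\<close> divides the factor out again.\<close>

lemma holo_fd:
  assumes F: "holo V F"
  shows "holo V (\<lambda>x. fd F x v)"
  unfolding holo_def
proof (intro conjI ballI)
  show "open V" using holo_open[OF F] .
  fix x assume x: "x \<in> V"
  obtain \<delta> where \<delta>: "\<delta> > 0" "\<And>v. norm v \<le> \<delta> \<Longrightarrow> \<exists>g'. ((\<lambda>x. fd F x v) has_derivative g') (at x) \<and>
       (\<forall>c w. g' (c *s w) = c * g' w)"
    by (rule holo_directional_derivative_local[OF F x]) meson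
  obtain c where c: "c \<noteq> 0" "norm (c *s v) \<le> \<delta>" by (rule small_multiple[OF \<delta>(1)])
  from \<delta>(2)[OF c(2)] obtain g' where g': "((\<lambda>x. fd F x (c *s v)) has_derivative g') (at x)"
    "\<And>c w. g' (c *s w) = c * g' w" by blast
  have "((\<lambda>x. fd F x v) has_derivative (\<lambda>w. g' w / c)) (at x)"
  proof (rule has_derivative_transform_within_open[OF _ \<open>open V\<close> x])
    show "((\<lambda>x. fd F x (c *s v) / c) has_derivative (\<lambda>w. g' w / c)) (at x)"
      unfolding divide_inverse by (rule has_derivative_mult_left[OF g'(1)])
  qed (simp add: holo_fd_smult[OF F] c)
  then show "\<exists>L. ((\<lambda>x. fd F x v) has_derivative L) (at x) \<and> (\<forall>c v. L (c *s v) = c * L v)"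
    using g'(2) by (intro exI[of _ "\<lambda>w. g' w / c"]) simp
qed

text \<open>Both sides are limits of the same quotients of \<open>fd F\<close> in direction
  \<open>w\<close> along small multiples of \<open>v\<close>: the left by the last clause of
  \<open>holo_directional_derivative_local\<close>, the right because \<open>fd F\<close> in
  direction \<open>w\<close> is itself holomorphic.\<close>

lemma fd_fd_commute:
  assumes F: "holo V F" and x: "x \<in> V"
  shows "fd (\<lambda>x. fd F x v) x w = fd (\<lambda>x. fd F x w) x v"
proof -
  obtain \<delta> where \<delta>: "\<delta> > 0" "\<And>v. norm v \<le> \<delta> \<Longrightarrow> \<exists>g'. ((\<lambda>x. fd F x v) has_derivative g') (at x) \<and>
       (\<forall>w. (\<lambda>n. (fd F (x + inverse (of_nat (Suc n)) *s v) w - fd F x w) / inverse (of_nat (Suc n)))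
          \<longlonglongrightarrow> g' w)"
    by (rule holo_directional_derivative_local[OF F x]) meson
  obtain c where c: "c \<noteq> 0" "norm (c *s v) \<le> \<delta>" by (rule small_multiple[OF \<delta>(1)])
  from \<delta>(2)[OF c(2)] obtain g' where g': "((\<lambda>x. fd F x (c *s v)) has_derivative g') (at x)" and
    lim: "(\<lambda>n. (fd F (x + inverse (of_nat (Suc n)) *s (c *s v)) w - fd F x w) / inverse (of_nat (Suc n)))
          \<longlonglongrightarrow> g' w" by blast
  have h0: "(\<lambda>n. inverse (of_nat (Suc n)) :: complex) \<longlonglongrightarrow> 0"
    using LIMSEQ_Suc[OF lim_inverse_n] by simp
  have "((\<lambda>z. fd F (x + z *s (c *s v)) w) has_field_derivative fd (\<lambda>x. fd F x w) (x + 0 *s (c *s v)) (c *s v)) (at 0)"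
    by (rule holo_line_deriv[OF holo_fd[OF F]]) (use x in simp)
  then have "(\<lambda>h. (fd F (x + h *s (c *s v)) w - fd F x w) / h) \<midarrow>0\<rightarrow> fd (\<lambda>x. fd F x w) x (c *s v)"
    by (simp add: DERIV_def)
  then have "(\<lambda>n. (fd F (x + inverse (of_nat (Suc n)) *s (c *s v)) w - fd F x w) / inverse (of_nat (Suc n)))
      \<longlonglongrightarrow> fd (\<lambda>x. fd F x w) x (c *s v)"
    by (rule filterlim_compose) (use h0 in \<open>auto simp: filterlim_at simp del: of_nat_Suc\<close>)
  then have "g' w = fd (\<lambda>x. fd F x w) x (c *s v)"
    using lim LIMSEQ_unique by blast
  then have *: "fd (\<lambda>x. fd F x (c *s v)) x w = c * fd (\<lambda>x. fd F x w) x v"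
    using fd_eq[OF g'] holo_fd_smult[OF holo_fd[OF F] x] by simp
  have "((\<lambda>x. c * fd F x v) has_derivative (\<lambda>w. c * fd (\<lambda>x. fd F x v) x w)) (at x)"
    by (intro has_derivative_mult_right holo_has_derivative[OF holo_fd[OF F] x])
  then have "((\<lambda>x. fd F x (c *s v)) has_derivative (\<lambda>w. c * fd (\<lambda>x. fd F x v) x w)) (at x)"
    by (rule has_derivative_transform_within_open[OF _ holo_open[OF F] x]) (simp add: holo_fd_smult[OF F])
  from fd_eq[OF this] * c(1) show ?thesis by simp
qed

section \<open>Linear vector fields on the cones\<close>

text \<open>No degree is prescribed, because coordinates, \<open>q1\<close> and sections of
  different degrees are multiplied and differentiated together.\<close>

definition hol :: "(complex^'n) set \<Rightarrow> (complex^'n \<Rightarrow> complex) set" where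
  "hol W = {f. holo_cone W f \<and> (\<forall>x. x \<notin> W \<longrightarrow> f x = 0)}"

text \<open>If \<open>v\<close> is the velocity of a curve in \<open>W\<close>, the derivative along \<open>v\<close> is the same for all
  extensions of \<open>f\<close>, so that the definite description in \<^const>\<open>tderiv\<close> is meaningful.\<close>

definition curve_tangent :: "(complex^'n) set \<Rightarrow> complex^'n \<Rightarrow> complex^'n \<Rightarrow> bool" where
  "curve_tangent W x v \<longleftrightarrow> (\<exists>\<gamma>::real \<Rightarrow> complex^'n. \<gamma> 0 = x \<and> (\<gamma> has_vector_derivative v) (at 0) \<and>
     (\<forall>\<^sub>F t in at 0. \<gamma> t \<in> W))"

text \<open>A field given by a matrix keeps \<open>fd F y (R y)\<close> holomorphic in
  \<open>y\<close>, so the action can be iterated, and brackets become commutators of matrices.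
  Rotations and the Euler field are of this kind.\<close>

definition lin_field :: "(complex^'n) set \<Rightarrow> (complex^'n \<Rightarrow> complex^'n) \<Rightarrow> bool" where
  "lin_field W R \<longleftrightarrow> (\<exists>A. R = (\<lambda>x. A *v x)) \<and> (\<forall>x\<in>W. curve_tangent W x (R x))"

definition lie ::
  "(complex^'n) set \<Rightarrow> (complex^'n \<Rightarrow> complex^'n) \<Rightarrow> (complex^'n \<Rightarrow> complex) \<Rightarrow> complex^'n \<Rightarrow> complex" where
  "lie W R f = restr W (\<lambda>x. tderiv W f x (R x))"

text \<open>Both extensions equal \<open>f\<close> along the curve, so their composites with it have
  the same derivative at 0, which the chain rule identifies with the two sides. The curve condition
  is punctured; agreement at \<open>t = 0\<close> comes from \<open>x \<in> W\<close>.\<close>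

lemma curve_tangent_deriv_unique:
  fixes x :: "complex^'n"
  assumes "curve_tangent W x v" "local_ext W f x V F" "local_ext W f x V' F'" "x \<in> W"
  shows "fd F x v = fd F' x v"
proof -
  obtain \<gamma> :: "real \<Rightarrow> complex^'n" where \<gamma>: "\<gamma> 0 = x" "(\<gamma> has_vector_derivative v) (at 0)" "\<forall>\<^sub>F t in at 0. \<gamma> t \<in> W"
    using assms(1) by (auto simp: curve_tangent_def)
  have F: "holo V F" "x \<in> V" "holo V' F'" "x \<in> V'" and
    eq: "\<And>y. y \<in> V \<Longrightarrow> y \<in> W \<Longrightarrow> F y = f y" "\<And>y. y \<in> V' \<Longrightarrow> y \<in> W \<Longrightarrow> F' y = f y"
    using assms by (auto simp: local_ext_def)
  have d: "((\<lambda>t. G (\<gamma> t)) has_vector_derivative fd G x v) (at 0)" if G: "holo U G" "x \<in> U" for G U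
  proof -
    have "((\<lambda>t. G (\<gamma> t)) has_derivative (\<lambda>t. fd G x (t *\<^sub>R v))) (at 0)"
      using has_derivative_compose[OF \<gamma>(2)[unfolded has_vector_derivative_def], of G "fd G x"]
        holo_has_derivative[OF G] \<gamma>(1) by simp
    then show ?thesis
      unfolding has_vector_derivative_def
      by (rule has_derivative_eq_rhs)
         (use holo_bounded_linear[OF G] in \<open>simp add: bounded_linear.linear linear_cmul fun_eq_iff\<close>)
  qed
  have "(\<gamma> \<longlongrightarrow> x) (at 0)"
    using has_vector_derivative_continuous[OF \<gamma>(2)] \<gamma>(1) by (simp add: isCont_def)
  then have ev: "\<forall>\<^sub>F t in at 0. \<gamma> t \<in> V" "\<forall>\<^sub>F t in at 0. \<gamma> t \<in> V'"
    using F holo_open topological_tendstoD by blast+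
  have "\<forall>\<^sub>F t in at 0. F (\<gamma> t) = F' (\<gamma> t)"
    using ev \<gamma>(3) by eventually_elim (simp add: eq)
  then have "((\<lambda>t. F' (\<gamma> t)) has_vector_derivative fd F x v) (at 0)"
    using has_derivative_transform_eventually[OF d[OF F(1,2), unfolded has_vector_derivative_def]]
      \<gamma>(1) eq F assms(4) unfolding has_vector_derivative_def by simp
  with d[OF F(3,4)] show ?thesis
    using vector_derivative_unique_at by blast
qed

lemma tderiv_eq:
  assumes "curve_tangent W x v" "local_ext W f x V F" "x \<in> W"
  shows "tderiv W f x v = fd F x v"
  unfolding tderiv_def
  using assms curve_tangent_deriv_unique by (intro the_equality) blast+

lemma curve_tangent_openin:
  fixes x :: "complex^'n"
  assumes "curve_tangent C x v" "openin (top_of_set C) W" "x \<in> W"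
  shows "curve_tangent W x v"
proof -
  obtain \<gamma> :: "real \<Rightarrow> complex^'n" where \<gamma>: "\<gamma> 0 = x" "(\<gamma> has_vector_derivative v) (at 0)" "\<forall>\<^sub>F t in at 0. \<gamma> t \<in> C"
    using assms(1) by (auto simp: curve_tangent_def)
  obtain U where U: "open U" "W = C \<inter> U" using assms(2) by (auto simp: openin_open)
  have "(\<gamma> \<longlongrightarrow> x) (at 0)"
    using has_vector_derivative_continuous[OF \<gamma>(2)] \<gamma>(1) by (simp add: isCont_def)
  then have "\<forall>\<^sub>F t in at 0. \<gamma> t \<in> U" using U assms(3) topological_tendstoD by blast
  then have "\<forall>\<^sub>F t in at 0. \<gamma> t \<in> W" using \<gamma>(3) by eventually_elim (simp add: U)
  then show ?thesis using \<gamma> by (auto simp: curve_tangent_def)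
qed

lemma lin_field_openin:
  assumes "lin_field C R" "openin (top_of_set C) W"
  shows "lin_field W R"
  using assms curve_tangent_openin openin_imp_subset unfolding lin_field_def by blast

lemma hol_ex: "f \<in> hol W \<Longrightarrow> x \<in> W \<Longrightarrow> \<exists>V F. local_ext W f x V F"
  by (auto simp: hol_def holo_cone_def)

lemma hol_outside: "f \<in> hol W \<Longrightarrow> x \<notin> W \<Longrightarrow> f x = 0"
  by (simp add: hol_def)

lemma local_ext_value: "local_ext W f x V F \<Longrightarrow> x \<in> W \<Longrightarrow> f x = F x"
  by (simp add: local_ext_def)

lemma local_ext_two:
  assumes "local_ext W f x V F" "local_ext W g x V' G"
  shows "local_ext W f x (V \<inter> V') F" "local_ext W g x (V \<inter> V') G"
  using assms by (auto simp: local_ext_def intro: holo_subset holo_open)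

lemma lin_fieldD: "lin_field W R \<Longrightarrow> x \<in> W \<Longrightarrow> curve_tangent W x (R x)"
  by (simp add: lin_field_def)

lemma lie_eq:
  assumes "lin_field W R" "local_ext W f x V F" "x \<in> W"
  shows "lie W R f x = fd F x (R x)"
  using tderiv_eq[OF lin_fieldD[OF assms(1,3)] assms(2,3)] assms(3) by (simp add: lie_def restr_def)

lemma vec_expand_axis: "(v::complex^'n) = (\<Sum>i\<in>UNIV. (v $ i) *s axis i 1)"
  by (simp add: basis_expansion)

lemma holo_fd_expand:
  assumes "holo V F" "x \<in> V"
  shows "fd F x v = (\<Sum>i\<in>UNIV. v $ i * fd F x (axis i 1))"
  by (subst vec_expand_axis[of v]) (simp add: holo_fd_sum[OF assms] holo_fd_smult[OF assms])

lemma holo_linear_component: "open V \<Longrightarrow> holo V (\<lambda>x. (A *v x) $ i)"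
  unfolding matrix_vector_mult_def by (simp add: holo_sum holo_mult holo_const holo_nth)

lemma holo_transform:
  assumes F: "holo V F" and eq: "\<And>x. x \<in> V \<Longrightarrow> G x = F x"
  shows "holo V G"
proof (rule holoI[OF holo_open[OF F]])
  show "(G has_derivative fd F x) (at x)" if "x \<in> V" for x
    by (rule has_derivative_transform_within_open[OF holo_has_derivative[OF F that] holo_open[OF F] that])
       (simp add: eq)
qed (rule holo_fd_smult[OF F])

lemma holo_fd_field:
  assumes "holo V F"
  shows "holo V (\<lambda>x. fd F x (A *v x))"
proof -
  have "holo V (\<lambda>x. \<Sum>i\<in>UNIV. (A *v x) $ i * fd F x (axis i 1))"
    by (intro holo_sum holo_mult holo_linear_component holo_fd assms holo_open[OF assms])
  then show ?thesis by (rule holo_transform) (rule holo_fd_expand[OF assms])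
qed

lemma fd_transform:
  assumes "open V" "x \<in> V" "\<And>y. y \<in> V \<Longrightarrow> F y = G y"
  shows "fd F x = fd G x"
proof -
  have "(F has_derivative D) (at x) \<longleftrightarrow> (G has_derivative D) (at x)" for D
    using assms has_derivative_transform_within_open by metis
  then show ?thesis by (simp add: frechet_derivative_def)
qed

lemma fd_sum:
  assumes "\<And>i. i \<in> A \<Longrightarrow> holo V (F i)" "x \<in> V"
  shows "fd (\<lambda>x. \<Sum>i\<in>A. F i x) x v = (\<Sum>i\<in>A. fd (F i) x v)"
proof -
  have "((\<lambda>x. \<Sum>i\<in>A. F i x) has_derivative (\<lambda>v. \<Sum>i\<in>A. fd (F i) x v)) (at x)"
    by (rule has_derivative_sum) (rule holo_has_derivative[OF assms])
  from fd_eq[OF this] show ?thesis by simp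
qed

lemma fd_nth: "fd (\<lambda>x. x $ i) x v = v $ i"
  using fd_eq[OF has_derivative_nth] by metis

lemma fd_linear_component:
  fixes x :: "complex^'n"
  shows "fd (\<lambda>x. (A *v x) $ i) x v = (A *v v) $ i"
proof -
  have "((\<lambda>x::complex^'n. (A *v x) $ i) has_derivative (\<lambda>v. (A *v v) $ i)) (at x)"
    unfolding matrix_vector_mult_def vec_lambda_beta
    by (intro has_derivative_sum has_derivative_mult_right has_derivative_nth)
  from fd_eq[OF this] show ?thesis by simp
qed

text \<open>Product rule: the first term freezes the direction at \<open>A *v x\<close>, the second
  differentiates the linear coefficient and is all that survives in a bracket.\<close>

lemma fd_fd_field:
  fixes x :: "complex^'n"
  assumes F: "holo V F" and x: "x \<in> V"
  shows "fd (\<lambda>y. fd F y (A *v y)) x v = fd (\<lambda>y. fd F y (A *v x)) x v + fd F x (A *v v)"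
proof -
  have *: "fd (\<lambda>y. fd F y (a y)) x v =
      (\<Sum>i\<in>UNIV. a x $ i * fd (\<lambda>y. fd F y (axis i 1)) x v + fd (\<lambda>y. a y $ i) x v * fd F x (axis i 1))"
    if a: "\<And>i. holo V (\<lambda>y. a y $ i)" for a :: "complex^'n \<Rightarrow> complex^'n"
  proof -
    have "fd (\<lambda>y. fd F y (a y)) x v = fd (\<lambda>y. \<Sum>i\<in>UNIV. a y $ i * fd F y (axis i 1)) x v"
      by (rule fun_cong[OF fd_transform[OF holo_open[OF F] x]]) (rule holo_fd_expand[OF F])
    also have "\<dots> = (\<Sum>i\<in>UNIV. fd (\<lambda>y. a y $ i * fd F y (axis i 1)) x v)"
      by (rule fd_sum[OF _ x]) (intro holo_mult a holo_fd F)
    finally show ?thesis by (simp add: fd_mult[OF a holo_fd[OF F] x])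
  qed
  show ?thesis
    using *[of "\<lambda>y. A *v y", OF holo_linear_component[OF holo_open[OF F]]] *[of "\<lambda>y. A *v x", OF holo_const[OF holo_open[OF F]]]
    by (simp add: fd_linear_component sum.distrib holo_fd_expand[OF F x, of "A *v v"])
qed

text \<open>The new extension lives on the same neighbourhood, so iterated fields are computed by
  differentiating a single \<open>F\<close> repeatedly.\<close>

lemma lie_local_ext:
  assumes R: "lin_field W R" and f: "local_ext W f x V F"
  shows "local_ext W (lie W R f) x V (\<lambda>y. fd F y (R y))"
proof -
  obtain A where A: "R = (\<lambda>x. A *v x)" using R by (auto simp: lin_field_def)
  have "lie W R f y = fd F y (R y)" if "y \<in> V" "y \<in> W" for y
    by (rule lie_eq[OF R _ that(2)]) (use f that in \<open>auto simp: local_ext_def\<close>)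
  then show ?thesis
    using f holo_fd_field[of V F A] by (auto simp: local_ext_def A)
qed

lemma lie_outside: "x \<notin> W \<Longrightarrow> lie W R f x = 0"
  by (simp add: lie_def restr_def)

lemma lie_hol: "lin_field W R \<Longrightarrow> f \<in> hol W \<Longrightarrow> lie W R f \<in> hol W"
  using lie_local_ext lie_outside unfolding hol_def holo_cone_def mem_Collect_eq by meson

section \<open>Algebra of functions on a cone and Leibniz calculus\<close>

lemma hol_linear:
  assumes "f \<in> hol W" "g \<in> hol W"
  shows "(\<lambda>x. a * f x + b * g x) \<in> hol W"
  unfolding hol_def holo_cone_def mem_Collect_eq
proof (intro conjI ballI allI impI)
  fix x assume x: "x \<in> W"
  obtain V F V' G where "local_ext W f x V F" "local_ext W g x V' G" using hol_ex assms x by meson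
  note e = local_ext_two[OF this]
  have "local_ext W (\<lambda>x. a * f x + b * g x) x (V \<inter> V') (\<lambda>x. a * F x + b * G x)"
    using e by (auto simp: local_ext_def intro!: holo_add holo_mult holo_const dest: holo_open)
  then show "\<exists>V F. local_ext W (\<lambda>x. a * f x + b * g x) x V F" by blast
qed (use assms in \<open>auto simp: hol_outside\<close>)

lemma hol_mult:
  assumes "f \<in> hol W" "g \<in> hol W"
  shows "(\<lambda>x. f x * g x) \<in> hol W"
  unfolding hol_def holo_cone_def mem_Collect_eq
proof (intro conjI ballI allI impI)
  fix x assume x: "x \<in> W"
  obtain V F V' G where "local_ext W f x V F" "local_ext W g x V' G" using hol_ex assms x by meson
  note e = local_ext_two[OF this]
  have "local_ext W (\<lambda>x. f x * g x) x (V \<inter> V') (\<lambda>x. F x * G x)"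
    using e by (auto simp: local_ext_def intro!: holo_mult)
  then show "\<exists>V F. local_ext W (\<lambda>x. f x * g x) x V F" by blast
qed (use assms in \<open>auto simp: hol_outside\<close>)

lemma hol_zero: "(\<lambda>x. 0) \<in> hol W"
proof -
  have "local_ext W (\<lambda>x. 0) x UNIV (\<lambda>x. 0)" for x by (simp add: local_ext_def holo_const)
  then show ?thesis unfolding hol_def holo_cone_def by blast
qed

lemma hol_cmult: "f \<in> hol W \<Longrightarrow> (\<lambda>x. a * f x) \<in> hol W"
  using hol_linear[of f W f a 0] by simp

lemma hol_add: "f \<in> hol W \<Longrightarrow> g \<in> hol W \<Longrightarrow> (\<lambda>x. f x + g x) \<in> hol W"
  using hol_linear[of f W g 1 1] by simp

lemma hol_diff: "f \<in> hol W \<Longrightarrow> g \<in> hol W \<Longrightarrow> (\<lambda>x. f x - g x) \<in> hol W"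
  using hol_linear[of f W g 1 "-1"] by simp

lemma hol_sum: "(\<And>i. i \<in> A \<Longrightarrow> f i \<in> hol W) \<Longrightarrow> (\<lambda>x. \<Sum>i\<in>A. f i x) \<in> hol W"
  by (induction A rule: infinite_finite_induct) (auto intro: hol_zero hol_add)

lemma local_ext_restr: "holo V P \<Longrightarrow> x \<in> V \<Longrightarrow> local_ext W (restr W P) x V P"
  by (simp add: local_ext_def restr_def)

lemma hol_restr_holo: "holo V P \<Longrightarrow> W \<subseteq> V \<Longrightarrow> restr W P \<in> hol W"
  using local_ext_restr unfolding hol_def holo_cone_def by (fastforce simp: restr_def)

lemma lie_restr_holo:
  assumes "lin_field W R" "holo V P" "x \<in> V" "x \<in> W"
  shows "lie W R (restr W P) x = fd P x (R x)"
  using lie_eq[OF assms(1) local_ext_restr[OF assms(2,3)] assms(4)] .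

lemma lie_linear:
  assumes R: "lin_field W R" and f: "f \<in> hol W" "g \<in> hol W"
  shows "lie W R (\<lambda>x. a * f x + b * g x) = (\<lambda>x. a * lie W R f x + b * lie W R g x)"
proof
  fix x show "lie W R (\<lambda>x. a * f x + b * g x) x = a * lie W R f x + b * lie W R g x"
  proof (cases "x \<in> W")
    case x: True
    obtain V F V' G where "local_ext W f x V F" "local_ext W g x V' G" using hol_ex f x by meson
    note e = local_ext_two[OF this]
    then have hF: "holo (V \<inter> V') F" "holo (V \<inter> V') G" "x \<in> V \<inter> V'" by (auto simp: local_ext_def)
    note op = holo_open[OF hF(1)]
    have e': "local_ext W (\<lambda>x. a * f x + b * g x) x (V \<inter> V') (\<lambda>x. a * F x + b * G x)"
      using e op by (auto simp: local_ext_def intro!: holo_add holo_mult holo_const)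
    have [simp]: "fd (\<lambda>x. c::complex) x v = 0" for c v by (simp add: fd_eq[OF has_derivative_const])
    show ?thesis
      unfolding lie_eq[OF R e' x] lie_eq[OF R e(1) x] lie_eq[OF R e(2) x]
      using hF op by (simp add: fd_add[where V="V \<inter> V'"] fd_mult[where V="V \<inter> V'"] holo_mult holo_const)
  qed (simp add: lie_outside)
qed

lemma lie_mult:
  assumes R: "lin_field W R" and f: "f \<in> hol W" "g \<in> hol W"
  shows "lie W R (\<lambda>x. f x * g x) = (\<lambda>x. f x * lie W R g x + lie W R f x * g x)"
proof
  fix x show "lie W R (\<lambda>x. f x * g x) x = f x * lie W R g x + lie W R f x * g x"
  proof (cases "x \<in> W")
    case x: True
    obtain V F V' G where "local_ext W f x V F" "local_ext W g x V' G" using hol_ex f x by meson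
    note e = local_ext_two[OF this]
    then have hF: "holo (V \<inter> V') F" "holo (V \<inter> V') G" "x \<in> V \<inter> V'" by (auto simp: local_ext_def)
    have e': "local_ext W (\<lambda>x. f x * g x) x (V \<inter> V') (\<lambda>x. F x * G x)"
      using e by (auto simp: local_ext_def intro!: holo_mult)
    show ?thesis
      unfolding lie_eq[OF R e' x] lie_eq[OF R e(1) x] lie_eq[OF R e(2) x]
      using fd_mult[OF hF] local_ext_value[OF e(1) x] local_ext_value[OF e(2) x] by simp
  qed (simp add: lie_outside)
qed

lemma lie_zero: "lin_field W R \<Longrightarrow> lie W R (\<lambda>x. 0) = (\<lambda>x. 0)"
  using lie_linear[OF _ hol_zero hol_zero, of W R 0 0] by simp

lemma lie_cmult: "lin_field W R \<Longrightarrow> f \<in> hol W \<Longrightarrow> lie W R (\<lambda>x. a * f x) = (\<lambda>x. a * lie W R f x)"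
  using lie_linear[of W R f f a 0] by simp

lemma lie_add: "lin_field W R \<Longrightarrow> f \<in> hol W \<Longrightarrow> g \<in> hol W \<Longrightarrow> lie W R (\<lambda>x. f x + g x) = (\<lambda>x. lie W R f x + lie W R g x)"
  using lie_linear[of W R f g 1 1] by simp

lemma lie_diff: "lin_field W R \<Longrightarrow> f \<in> hol W \<Longrightarrow> g \<in> hol W \<Longrightarrow> lie W R (\<lambda>x. f x - g x) = (\<lambda>x. lie W R f x - lie W R g x)"
  using lie_linear[of W R f g 1 "-1"] by simp

lemma lie_sum: 
  assumes "lin_field W R" "\<And>i. i \<in> A \<Longrightarrow> f i \<in> hol W"
  shows "lie W R (\<lambda>x. \<Sum>i\<in>A. f i x) = (\<lambda>x. \<Sum>i\<in>A. lie W R (f i) x)"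
  using assms(2)
  by (induction A rule: infinite_finite_induct) (auto simp: lie_zero lie_add assms(1) hol_sum)

text \<open>The second derivatives cancel by symmetry. In the remaining first-order terms the
  matrices are composed in the order opposite to the operators, which explains the sign convention
  for \<open>T\<close>.\<close>

lemma lie_bracket:
  assumes R: "lin_field W R" and S: "lin_field W S" and T: "lin_field W T" and f: "f \<in> hol W"
    and RS: "\<And>x. T x = R (S x) - S (R x)"
  shows "lie W S (lie W R f) x - lie W R (lie W S f) x = lie W T f x"
proof (cases "x \<in> W")
  case x: True
  obtain A B where A: "R = (\<lambda>x. A *v x)" "S = (\<lambda>x. B *v x)" using R S by (auto simp: lin_field_def)
  obtain V F where F: "local_ext W f x V F" using hol_ex f x by meson
  then have hF: "holo V F" "x \<in> V" by (auto simp: local_ext_def)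
  show ?thesis
    unfolding lie_eq[OF S lie_local_ext[OF R F] x]
      lie_eq[OF R lie_local_ext[OF S F] x] lie_eq[OF T F x]
    unfolding A fd_fd_field[OF hF]
    by (simp add: fd_fd_commute[OF hF, of "A *v x"] RS[unfolded A] holo_fd_diff[OF hF])
qed (simp add: lie_outside)

lemma lie_restr:
  assumes R: "lin_field W R" and R': "lin_field W' R" and W: "W' \<subseteq> W" and f: "f \<in> hol W"
  shows "lie W' R (restr W' f) = restr W' (lie W R f)"
proof
  fix x show "lie W' R (restr W' f) x = restr W' (lie W R f) x"
  proof (cases "x \<in> W'")
    case x: True
    then have x': "x \<in> W" using W by auto
    obtain V F where F: "local_ext W f x V F" using hol_ex f x' by meson
    then have "local_ext W' (restr W' f) x V F" using W by (auto simp: local_ext_def restr_def)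
    then show ?thesis
      using lie_eq[OF R' _ x] lie_eq[OF R F x'] x by (simp add: restr_def)
  qed (simp add: lie_outside restr_def)
qed

lemma hol_restr: 
  assumes "f \<in> hol W" "W' \<subseteq> W"
  shows "restr W' f \<in> hol W'"
proof -
  have "\<exists>V F. local_ext W' (restr W' f) x V F" if x: "x \<in> W'" for x
  proof -
    obtain V F where "local_ext W f x V F" using hol_ex[OF assms(1), of x] assms(2) x by blast
    then have "local_ext W' (restr W' f) x V F" using assms(2) by (auto simp: local_ext_def restr_def)
    then show ?thesis by blast
  qed
  then show ?thesis by (auto simp: hol_def holo_cone_def restr_def)
qed

subsection \<open>The two cones\<close>

lemma q0_smult: "q0 (c *s x) = c\<^sup>2 * q0 x"
  by (simp add: q0_def power_mult_distrib sum_distrib_left)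

lemma q1_smult: "q1 \<mu> (c *s x) = c\<^sup>2 * q1 \<mu> x"
  by (simp add: q1_def power_mult_distrib sum_distrib_left algebra_simps)

lemma proj_pt_refl: "x \<in> proj_pt x"
  unfolding proj_pt_def by (auto intro!: exI[of _ 1])

lemma cone_Q_iff: "x \<in> cone_Q \<longleftrightarrow> x \<noteq> 0 \<and> q0 x = 0"
proof
  assume "x \<in> cone_Q"
  then obtain y c where "y \<noteq> 0" "c \<noteq> 0" "x = c *s y" "q0 x = 0"
    by (auto simp: cone_Q_def quadric_Q_def proj_space_def proj_pt_def)
  then show "x \<noteq> 0 \<and> q0 x = 0" by simp
next
  assume x: "x \<noteq> 0 \<and> q0 x = 0"
  then have "proj_pt x \<in> quadric_Q"
    by (auto simp: quadric_Q_def proj_space_def proj_pt_def q0_smult)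
  then show "x \<in> cone_Q" unfolding cone_Q_def using proj_pt_refl by blast
qed

lemma cone_X_iff: "x \<in> cone_X \<mu> \<longleftrightarrow> x \<noteq> 0 \<and> q0 x = 0 \<and> q1 \<mu> x = 0"
proof
  assume "x \<in> cone_X \<mu>"
  then obtain y c where "y \<noteq> 0" "c \<noteq> 0" "x = c *s y" "q0 x = 0" "q1 \<mu> x = 0"
    by (auto simp: cone_X_def variety_X_def quadric_Q_def quadric_Q1_def proj_space_def proj_pt_def)
  then show "x \<noteq> 0 \<and> q0 x = 0 \<and> q1 \<mu> x = 0" by simp
next
  assume x: "x \<noteq> 0 \<and> q0 x = 0 \<and> q1 \<mu> x = 0"
  then have "proj_pt x \<in> variety_X \<mu>"
    by (auto simp: variety_X_def quadric_Q_def quadric_Q1_def proj_space_def proj_pt_def q0_smult q1_smult)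
  then show "x \<in> cone_X \<mu>" unfolding cone_X_def using proj_pt_refl by blast
qed

lemma cone_X_subset_Q: "cone_X \<mu> \<subseteq> cone_Q"
  by (auto simp: cone_X_iff cone_Q_iff)

definition rot :: "'n \<Rightarrow> 'n \<Rightarrow> complex^'n \<Rightarrow> complex^'n" where
  "rot i j x = (x $ i) *s axis j 1 - (x $ j) *s axis i 1"

lemma X_op_lie: "X_op W i j f = lie W (rot i j) f"
  by (simp add: X_op_def lie_def rot_def[abs_def])

lemma rot_nth: "rot i j x $ l = (if l = j then x $ i else 0) - (if l = i then x $ j else 0)"
  by (simp add: rot_def axis_def)

lemma curve_tangent_ray:
  fixes x :: "complex^'n"
  assumes "x \<in> C" "\<And>c x. c \<noteq> 0 \<Longrightarrow> x \<in> C \<Longrightarrow> c *s x \<in> C"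
  shows "curve_tangent C x x"
proof -
  define \<gamma> :: "real \<Rightarrow> complex^'n" where "\<gamma> = (\<lambda>t. x + t *\<^sub>R x)"
  have "(\<gamma> has_vector_derivative x) (at 0)"
    unfolding \<gamma>_def by (auto intro!: derivative_eq_intros)
  moreover have "\<forall>\<^sub>F t in at (0::real). t \<noteq> -1"
    by (rule eventually_neq_at_within)
  then have "\<forall>\<^sub>F t in at 0. \<gamma> t \<in> C"
  proof eventually_elim
    case (elim t)
    then have "1 + complex_of_real t \<noteq> 0"
      by (metis add.inverse_inverse add_eq_0_iff of_real_1 of_real_eq_iff of_real_minus)
    moreover have "\<gamma> t = (1 + complex_of_real t) *s x"
      by (simp add: \<gamma>_def smult_of_real vec_eq_iff algebra_simps flip: scaleR_conv_of_real)
    ultimately show ?case using assms(1) assms(2)[of "1 + complex_of_real t" x] by metis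
  qed
  ultimately show ?thesis unfolding curve_tangent_def by (intro exI[of _ \<gamma>]) (simp add: \<gamma>_def)
qed

lemma cone_Q_smult: "c \<noteq> 0 \<Longrightarrow> x \<in> cone_Q \<Longrightarrow> c *s x \<in> cone_Q"
  by (auto simp: cone_Q_iff q0_smult vec_eq_iff)

lemma cone_X_smult: "c \<noteq> 0 \<Longrightarrow> x \<in> cone_X \<mu> \<Longrightarrow> c *s x \<in> cone_X \<mu>"
  by (auto simp: cone_X_iff q0_smult q1_smult vec_eq_iff)

lemma sum_UNIV_two:
  fixes f :: "'n::finite \<Rightarrow> complex"
  assumes "i \<noteq> j"
  shows "sum f UNIV = f i + f j + sum f (UNIV - {i, j})"
proof -
  have "sum f UNIV = sum f {i, j} + sum f (UNIV - {i, j})"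
    by (metis sum.subset_diff finite subset_UNIV add.commute)
  then show ?thesis using assms by simp
qed

lemma curve_tangent_rot:
  fixes x :: "complex^'n"
  assumes x: "x \<in> cone_Q"
  shows "curve_tangent cone_Q x (rot i j x)"
proof (cases "i = j")
  case True
  then show ?thesis
    unfolding curve_tangent_def using x by (intro exI[of _ "\<lambda>t. x"]) (auto simp: rot_def)
next
  case False
  \<comment> \<open>Rotation by the angle \<open>t\<close> in the plane of the coordinates
    \<open>i\<close> and \<open>j\<close>, written as a correction to \<open>x\<close>; it preserves
    \<open>q0\<close>.\<close>
  define \<gamma> :: "real \<Rightarrow> complex^'n" where
    "\<gamma> = (\<lambda>t. x + (cos t - 1) *\<^sub>R (x $ i *s axis i 1 + x $ j *s axis j 1) + sin t *\<^sub>R rot i j x)"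
  have g0: "\<gamma> 0 = x" by (simp add: \<gamma>_def)
  have d: "(\<gamma> has_vector_derivative rot i j x) (at 0)"
    unfolding \<gamma>_def by (auto intro!: derivative_eq_intros)
  have "(\<gamma> \<longlongrightarrow> x) (at 0)"
    using has_vector_derivative_continuous[OF d] g0 by (simp add: isCont_def)
  then have "\<forall>\<^sub>F t in at 0. \<gamma> t \<noteq> 0"
    using x by (intro tendsto_imp_eventually_ne) (auto simp: cone_Q_iff)
  moreover have "q0 (\<gamma> t) = q0 x" for t
  proof -
    have 1: "\<gamma> t $ i = cos t * x $ i - sin t * x $ j" "\<gamma> t $ j = cos t * x $ j + sin t * x $ i"
      using False by (auto simp: \<gamma>_def rot_nth axis_def scaleR_conv_of_real[where 'a=complex] algebra_simps)
    have 2: "\<gamma> t $ l = x $ l" if "l \<noteq> i" "l \<noteq> j" for l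
      using that by (simp add: \<gamma>_def rot_nth axis_def)
    have "(cos (complex_of_real t))\<^sup>2 = 1 - (sin (complex_of_real t))\<^sup>2" by (simp add: cos_squared_eq)
    then have "(\<gamma> t $ i)\<^sup>2 + (\<gamma> t $ j)\<^sup>2 = (x $ i)\<^sup>2 + (x $ j)\<^sup>2"
      unfolding 1 cos_of_real sin_of_real by algebra
    moreover have "(\<Sum>l\<in>UNIV - {i,j}. (\<gamma> t $ l)\<^sup>2) = (\<Sum>l\<in>UNIV - {i,j}. (x $ l)\<^sup>2)"
      by (intro sum.cong) (auto simp: 2)
    ultimately show ?thesis
      unfolding q0_def sum_UNIV_two[OF False] by simp
  qed
  then have "\<gamma> t \<in> cone_Q \<longleftrightarrow> \<gamma> t \<noteq> 0" for t using x by (simp add: cone_Q_iff)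
  ultimately have "\<forall>\<^sub>F t in at 0. \<gamma> t \<in> cone_Q" by simp
  with g0 d show ?thesis unfolding curve_tangent_def by blast
qed

lemma lin_field_id:
  assumes "openin (top_of_set C) W" "\<And>c x. c \<noteq> 0 \<Longrightarrow> x \<in> C \<Longrightarrow> c *s x \<in> C"
  shows "lin_field W (\<lambda>x. x)"
proof (rule lin_field_openin[OF _ assms(1)])
  have "(\<lambda>x::complex^'a. x) = (\<lambda>x. mat 1 *v x)" by simp
  then show "lin_field C (\<lambda>x. x)" unfolding lin_field_def using curve_tangent_ray[OF _ assms(2)] by blast
qed

lemma lin_field_rot:
  assumes "openin (top_of_set cone_Q) W"
  shows "lin_field W (rot i j)"
proof (rule lin_field_openin[OF _ assms])
  have "rot i j x = (\<chi> l m. (if l = j \<and> m = i then 1 else 0) - (if l = i \<and> m = j then 1 else 0)) *v x" for x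
    unfolding vec_eq_iff matrix_vector_mult_def rot_nth
    by (auto simp: left_diff_distrib sum_subtractf if_distrib[of "\<lambda>c. c * _"] cong: if_cong)
  then show "lin_field cone_Q (rot i j)" unfolding lin_field_def using curve_tangent_rot by blast
qed

lemma O_sec_iff_gen:
  assumes "openin (top_of_set C) W" "\<And>c x. c \<noteq> 0 \<Longrightarrow> x \<in> C \<Longrightarrow> c *s x \<in> C"
  shows "f \<in> O_sec k W \<longleftrightarrow> f \<in> hol W \<and> lie W (\<lambda>x. x) f = (\<lambda>x. k * f x)"
  by (auto simp: O_sec_def hol_def lie_def restr_def fun_eq_iff)

section \<open>The operators on the quadric\<close>

locale open_in_Q =
  fixes W :: "(complex^'n) set"
  assumes W: "openin (top_of_set cone_Q) W"
begin

abbreviation X :: "'n \<Rightarrow> 'n \<Rightarrow> (complex^'n \<Rightarrow> complex) \<Rightarrow> complex^'n \<Rightarrow> complex" where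
  "X \<equiv> X_op W"

abbreviation E :: "(complex^'n \<Rightarrow> complex) \<Rightarrow> complex^'n \<Rightarrow> complex" where
  "E \<equiv> lie W (\<lambda>x. x)"

abbreviation crd :: "'n \<Rightarrow> complex^'n \<Rightarrow> complex" where
  "crd l \<equiv> restr W (\<lambda>x. x $ l)"

lemma W_cone: "x \<in> W \<Longrightarrow> q0 x = 0"
  using W openin_imp_subset cone_Q_iff by blast

lemma field_rot: "lin_field W (rot i j)"
  by (rule lin_field_rot[OF W])

lemma field_id: "lin_field W (\<lambda>x. x)"
  by (rule lin_field_id[OF W cone_Q_smult])

lemma O_sec_iff: "f \<in> O_sec k W \<longleftrightarrow> f \<in> hol W \<and> E f = (\<lambda>x. k * f x)"
  by (rule O_sec_iff_gen[OF W cone_Q_smult])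

lemma X_hol: "f \<in> hol W \<Longrightarrow> X i j f \<in> hol W"
  unfolding X_op_lie by (rule lie_hol[OF field_rot])

lemmas X_add = lie_add[OF field_rot, folded X_op_lie]
  and X_diff = lie_diff[OF field_rot, folded X_op_lie]
  and X_cmult = lie_cmult[OF field_rot, folded X_op_lie]
  and X_mult = lie_mult[OF field_rot, folded X_op_lie]
  and X_sum = lie_sum[OF field_rot, folded X_op_lie]
  and X_linear = lie_linear[OF field_rot, folded X_op_lie]

lemma X_refl: "f \<in> hol W \<Longrightarrow> X i i f = (\<lambda>x. 0)"
proof
  fix x assume f: "f \<in> hol W" 
  show "X i i f x = 0"
  proof (cases "x \<in> W")
    case x: True
    then obtain V F where F: "local_ext W f x V F" using hol_ex f by blast
    then have "bounded_linear (fd F x)" by (auto simp: local_ext_def intro: holo_bounded_linear)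
    then show ?thesis
      unfolding X_op_lie lie_eq[OF field_rot F x] by (simp add: rot_def linear_simps)
  qed (simp add: X_op_lie lie_outside)
qed

lemma X_swap: "f \<in> hol W \<Longrightarrow> X j i f = (\<lambda>x. - X i j f x)"
proof
  fix x assume f: "f \<in> hol W" 
  show "X j i f x = - X i j f x"
  proof (cases "x \<in> W")
    case x: True
    then obtain V F where F: "local_ext W f x V F" using hol_ex f by blast
    then have "bounded_linear (fd F x)" by (auto simp: local_ext_def intro: holo_bounded_linear)
    moreover have "rot j i x = - rot i j x" by (simp add: rot_def)
    ultimately show ?thesis
      unfolding X_op_lie lie_eq[OF field_rot F x] by (simp add: linear_simps)
  qed (simp add: X_op_lie lie_outside)
qed

lemma XX_swap: "f \<in> hol W \<Longrightarrow> X j i (X j i f) = X i j (X i j f)"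
  using X_cmult[OF X_hol[of f i j], of j i "-1"] X_swap[OF X_hol[of f i j], of j i]
  by (simp add: X_swap[of f j i])

lemma XX_hol: "f \<in> hol W \<Longrightarrow> X i j (X i j f) \<in> hol W"
  by (intro X_hol)

lemma X_bracket:
  assumes f: "f \<in> hol W" and ijk: "i \<noteq> j" "i \<noteq> k" "j \<noteq> k"
  shows "X i j (X j k f) = (\<lambda>x. X j k (X i j f) x + X i k f x)"
    and "X i j (X i k f) = (\<lambda>x. X i k (X i j f) x - X j k f x)"
proof -
  have 1: "X i j (X j k f) x - X j k (X i j f) x = X i k f x" for x
    unfolding X_op_lie
    by (rule lie_bracket[OF field_rot field_rot field_rot f])
       (use ijk in \<open>auto simp: vec_eq_iff rot_nth\<close>)
  have 2: "X i j (X i k f) x - X i k (X i j f) x = X k j f x" for x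
    unfolding X_op_lie
    by (rule lie_bracket[OF field_rot field_rot field_rot f])
       (use ijk in \<open>auto simp: vec_eq_iff rot_nth\<close>)
  show "X i j (X j k f) = (\<lambda>x. X j k (X i j f) x + X i k f x)"
    using 1 by (auto simp: fun_eq_iff algebra_simps)
  show "X i j (X i k f) = (\<lambda>x. X i k (X i j f) x - X j k f x)"
    using 2 X_swap[OF f, of k j] by (auto simp: fun_eq_iff algebra_simps)
qed

lemma X_commute_disjoint:
  assumes f: "f \<in> hol W" and d: "{i, j} \<inter> {k, l} = {}"
  shows "X i j (X k l f) = X k l (X i j f)"
proof
  fix x
  \<comment> \<open>The vanishing bracket is represented by \<open>rot i i\<close>, which is the
    zero field.\<close>
  have "X i j (X k l f) x - X k l (X i j f) x = X i i f x"
    unfolding X_op_lie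
    by (rule lie_bracket[OF field_rot field_rot field_rot f])
       (use d in \<open>auto simp: vec_eq_iff rot_nth\<close>)
  then show "X i j (X k l f) x = X k l (X i j f) x" by (simp add: X_refl f)
qed

lemma E_X_commute:
  assumes f: "f \<in> hol W"
  shows "E (X i j f) = X i j (E f)"
proof
  fix x
  have "E (X i j f) x - X i j (E f) x = X i i f x"
    unfolding X_op_lie
    by (rule lie_bracket[OF field_rot field_id field_rot f]) (auto simp: vec_eq_iff rot_nth)
  then show "E (X i j f) x = X i j (E f) x" by (simp add: X_refl f)
qed

lemma X_O_sec: "f \<in> O_sec k W \<Longrightarrow> X i j f \<in> O_sec k W"
  by (simp add: O_sec_iff X_hol E_X_commute X_cmult)

text \<open>\<open>X\<^sub>i\<^sub>j\<^sup>2 + X\<^sub>i\<^sub>k\<^sup>2 + X\<^sub>j\<^sub>k\<^sup>2\<close> is the Casimir operator of an \<open>so(3)\<close>, so it commutes with \<open>X\<^sub>i\<^sub>j\<close>.\<close>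

lemma Casimir_commute:
  assumes f: "f \<in> hol W" and ijk: "i \<noteq> j" "i \<noteq> k" "j \<noteq> k"
  shows "X i j (\<lambda>x. X i k (X i k f) x + X j k (X j k f) x)
       = (\<lambda>x. X i k (X i k (X i j f)) x + X j k (X j k (X i j f)) x)"
proof -
  note b = X_bracket[OF _ ijk]
  have 1: "X i j (X i k (X i k f)) = (\<lambda>x. X i k (X i k (X i j f)) x - X i k (X j k f) x - X j k (X i k f) x)"
    by (simp add: b X_hol f X_diff)
  have 2: "X i j (X j k (X j k f)) = (\<lambda>x. X j k (X j k (X i j f)) x + X j k (X i k f) x + X i k (X j k f) x)"
    by (simp add: b X_hol f X_add)
  show ?thesis by (simp add: X_add X_hol f 1 2)
qed

text \<open>\<open>Casimir_commute\<close> is applied once for each factor of the square of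
  \<open>X i j\<close>.\<close>

lemma XX_braid:
  assumes f: "f \<in> hol W" and ijk: "i \<noteq> j" "i \<noteq> k" "j \<noteq> k"
  shows "X i j (X i j (X i k (X i k f))) x + X i j (X i j (X j k (X j k f))) x
       = X i k (X i k (X i j (X i j f))) x + X j k (X j k (X i j (X i j f))) x"
proof -
  have "X i j (X i j (\<lambda>x. X i k (X i k f) x + X j k (X j k f) x))
       = (\<lambda>x. X i k (X i k (X i j (X i j f))) x + X j k (X j k (X i j (X i j f))) x)"
    by (simp add: Casimir_commute[OF _ ijk] X_hol f)
  then show ?thesis by (simp add: X_add X_hol f fun_eq_iff)
qed

subsection \<open>Commutativity\<close>

lemma Delta_hol: "f \<in> hol W \<Longrightarrow> Delta \<mu> i W f \<in> hol W"
  unfolding Delta_def divide_inverse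
  by (intro hol_sum) (use hol_cmult[OF XX_hol] in \<open>simp add: mult.commute\<close>)

lemma Delta_linear:
  assumes "f \<in> hol W" "g \<in> hol W"
  shows "Delta \<mu> i W (\<lambda>x. a * f x + b * g x) = (\<lambda>x. a * Delta \<mu> i W f x + b * Delta \<mu> i W g x)"
  unfolding Delta_def
  by (simp add: X_linear X_hol assms add_divide_distrib sum.distrib sum_distrib_left)

lemma XX_Delta:
  assumes "f \<in> hol W"
  shows "X k l (X k l (Delta \<mu> i W f)) x
       = (\<Sum>j\<in>UNIV - {i}. X k l (X k l (X i j (X i j f))) x / (\<mu> i - \<mu> j))"
proof -
  have D: "Delta \<mu> i W f = (\<lambda>x. \<Sum>j\<in>UNIV - {i}. inverse (\<mu> i - \<mu> j) * X i j (X i j f) x)"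
    by (simp add: Delta_def divide_inverse mult.commute)
  show ?thesis
    unfolding D
    by (simp add: X_sum X_cmult hol_cmult X_hol assms divide_inverse mult.commute)
qed

lemma Delta_commute:
  assumes f: "f \<in> hol W" and inj: "inj \<mu>"
  shows "Delta \<mu> i W (Delta \<mu> k W f) = Delta \<mu> k W (Delta \<mu> i W f)"
proof (cases "i = k")
  case False
  show ?thesis
  proof
    fix x
    \<comment> \<open>\<open>c\<close> is the commutator of two squares and \<open>G j l\<close> the
      contribution of the pair \<open>(j, l)\<close>. Disjoint index pairs contribute nothing; the
      rest is grouped by the third index \<open>l\<close> of a triple
      \<open>i, k, l\<close>.\<close>
    define c where "c = (\<lambda>i j k l. X i j (X i j (X k l (X k l f))) x - X k l (X k l (X i j (X i j f))) x)"
    define G where "G = (\<lambda>j l. c i j k l / ((\<mu> i - \<mu> j) * (\<mu> k - \<mu> l)))"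
    have sw2: "c i j k l = c i j l k" and sw: "c i j k l = - c k l i j" for i j k l
      unfolding c_def using f by (simp_all add: XX_swap[of _ j i] XX_swap[of _ l k] X_hol)
    have br: "c i j i k + c i j j k = 0" if "i \<noteq> j" "i \<noteq> k" "j \<noteq> k" for i j k
      using XX_braid[OF f that, of x] unfolding c_def by (simp add: algebra_simps)
    have disj: "c i j k l = 0" if "{i, j} \<inter> {k, l} = {}" for i j k l
      by (simp add: c_def X_commute_disjoint[OF _ that] X_hol f)
    have "Delta \<mu> i W (Delta \<mu> k W f) x = (\<Sum>j\<in>UNIV - {i}. \<Sum>l\<in>UNIV - {k}.
        X i j (X i j (X k l (X k l f))) x / ((\<mu> i - \<mu> j) * (\<mu> k - \<mu> l)))"
      by (subst Delta_def) (simp add: XX_Delta f sum_divide_distrib mult.commute)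
    moreover have "Delta \<mu> k W (Delta \<mu> i W f) x = (\<Sum>j\<in>UNIV - {i}. \<Sum>l\<in>UNIV - {k}.
        X k l (X k l (X i j (X i j f))) x / ((\<mu> i - \<mu> j) * (\<mu> k - \<mu> l)))"
      by (subst Delta_def, subst sum.swap) (simp add: XX_Delta f sum_divide_distrib)
    ultimately have "Delta \<mu> i W (Delta \<mu> k W f) x - Delta \<mu> k W (Delta \<mu> i W f) x
        = (\<Sum>j\<in>UNIV - {i}. \<Sum>l\<in>UNIV - {k}. G j l)"
      by (simp add: G_def c_def sum_subtractf diff_divide_distrib)
    also have "\<dots> = (\<Sum>l\<in>UNIV - {k}. G k l) + (\<Sum>j\<in>UNIV - {i, k}. \<Sum>l\<in>UNIV - {k}. G j l)"
      using False by (subst sum.remove[of _ k]) (auto simp: Diff_insert2[symmetric] insert_commute intro!: sum.cong)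
    also have "(\<Sum>l\<in>UNIV - {k}. G k l) = (\<Sum>l\<in>UNIV - {i, k}. G k l)"
    proof -
      \<comment> \<open>For \<open>l = i\<close> the two squares coincide, since
        \<open>X k i\<close> and \<open>X i k\<close> differ by a sign.\<close>
      have "c i k k i = 0" using sw2[of i k k i] by (simp add: c_def)
      then have "G k i = 0" by (simp add: G_def)
      then show ?thesis
        using False by (subst sum.remove[of _ i]) (auto simp: Diff_insert2[symmetric] insert_commute intro!: sum.cong)
    qed
    also have "(\<Sum>j\<in>UNIV - {i, k}. \<Sum>l\<in>UNIV - {k}. G j l) = (\<Sum>j\<in>UNIV - {i, k}. G j i + G j j)"
    proof (rule sum.cong[OF refl])
      fix j assume j: "j \<in> UNIV - {i, k}"
      have "(\<Sum>l\<in>UNIV - {k}. G j l) = (\<Sum>l\<in>{i, j}. G j l)"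
        by (rule sum.mono_neutral_right) (use j False disj in \<open>auto simp: G_def\<close>)
      then show "(\<Sum>l\<in>UNIV - {k}. G j l) = G j i + G j j" using j by (auto simp: insert_commute)
    qed
    also have "(\<Sum>l\<in>UNIV - {i, k}. G k l) + (\<Sum>j\<in>UNIV - {i, k}. G j i + G j j)
        = (\<Sum>l\<in>UNIV - {i, k}. G k l + (G l i + G l l))"
      by (simp add: sum.distrib)
    also have "\<dots> = 0"
    proof (rule sum.neutral, rule ballI)
      fix l assume "l \<in> UNIV - {i, k}"
      then have l: "l \<noteq> i" "l \<noteq> k" by auto
      \<comment> \<open>By the braid relations the commutators among the three squares of a triple
        agree up to sign, so one number describes them.\<close>
      define A where "A = c i k k l"
      have A1: "c i l k i = A"
        using br[of i k l] sw[of i l i k] sw2[of i l k i] False l by (simp add: A_def add_eq_0_iff)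
      have A2: "c i l k l = - A"
        using br[of i l k] sw2[of i l k i] sw2[of i l k l] A1 False l by (simp add: add_eq_0_iff)
      have d: "\<mu> i - \<mu> k \<noteq> 0" "\<mu> i - \<mu> l \<noteq> 0" "\<mu> k - \<mu> l \<noteq> 0"
        using inj False l by (auto simp: inj_eq)
      \<comment> \<open>The partial fraction identity that explains the coefficients
        \<open>1 / (\<mu> i - \<mu> j)\<close>.\<close>
      have "A / ((\<mu> i - \<mu> k) * (\<mu> k - \<mu> l)) + (A / ((\<mu> i - \<mu> l) * (\<mu> k - \<mu> i)) - A / ((\<mu> i - \<mu> l) * (\<mu> k - \<mu> l))) = 0"
      proof -
        have "A / ((\<mu> i - \<mu> l) * (\<mu> k - \<mu> i)) = - (A / ((\<mu> i - \<mu> l) * (\<mu> i - \<mu> k)))"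
          by (metis minus_diff_eq minus_divide_right mult_minus_right)
        moreover have "A / ((\<mu> i - \<mu> k) * (\<mu> k - \<mu> l)) - A / ((\<mu> i - \<mu> l) * (\<mu> i - \<mu> k)) - A / ((\<mu> i - \<mu> l) * (\<mu> k - \<mu> l)) = 0"
          using d by (simp add: divide_simps) (simp add: algebra_simps)
        ultimately show ?thesis by algebra
      qed
      then show "G k l + (G l i + G l l) = 0"
        unfolding G_def A1 A2 A_def[symmetric] by simp
    qed
    finally show "Delta \<mu> i W (Delta \<mu> k W f) x = Delta \<mu> k W (Delta \<mu> i W f) x" by simp
  qed
qed simp

lemma Delta_O_sec: 
  assumes "f \<in> O_sec k W"
  shows "Delta \<mu> i W f \<in> O_sec k W"
proof -
  have f: "f \<in> hol W" using assms by (simp add: O_sec_iff)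
  have D: "Delta \<mu> i W f = (\<lambda>x. \<Sum>j\<in>UNIV - {i}. inverse (\<mu> i - \<mu> j) * X i j (X i j f) x)"
    by (simp add: Delta_def divide_inverse mult.commute)
  have "E (X i j (X i j f)) = (\<lambda>x. k * X i j (X i j f) x)" for j
    using X_O_sec[OF X_O_sec[OF assms]] by (simp add: O_sec_iff)
  then have "E (Delta \<mu> i W f) = (\<lambda>x. k * Delta \<mu> i W f x)"
    unfolding D
    by (simp add: lie_sum[OF field_id] lie_cmult[OF field_id] hol_cmult X_hol f sum_distrib_left mult.left_commute)
  then show ?thesis using Delta_hol[OF f] by (simp add: O_sec_iff)
qed

lemma Delta_restr:
  assumes W': "openin (top_of_set cone_Q) W'" "W' \<subseteq> W" and f: "f \<in> hol W"
  shows "Delta \<mu> i W' (restr W' f) = restr W' (Delta \<mu> i W f)"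
proof -
  have "X_op W' i j (X_op W' i j (restr W' f)) = restr W' (X i j (X i j f))" for j
    unfolding X_op_lie
    using lie_restr[OF field_rot lin_field_rot[OF W'(1)] W'(2)] f X_hol by (simp add: X_op_lie)
  then show ?thesis
    by (auto simp: Delta_def restr_def fun_eq_iff intro!: sum.neutral)
qed

subsection \<open>The order of the operators\<close>

lemma commutator_Delta:
  assumes "f \<in> hol W" "g \<in> hol W"
  shows "commutator_fun g (Delta \<mu> i) W f
    = (\<lambda>x. \<Sum>j\<in>UNIV - {i}. (2 * (X i j g x * X i j f x) + f x * X i j (X i j g) x) / (\<mu> i - \<mu> j))"
  unfolding commutator_fun_def Delta_def sum_distrib_left sum_subtractf[symmetric]
  by (intro ext sum.cong refl)
     (simp add: X_mult X_add X_hol hol_mult assms diff_divide_distrib[symmetric] algebra_simps)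

text \<open>Each commutator lowers the order by one: by Leibniz' rule the first is of first order,
  the second is multiplication by a function, and multiplications commute.\<close>

lemma commutator3_Delta:
  assumes f: "f \<in> hol W" and g: "g1 \<in> hol W" "g2 \<in> hol W" "g3 \<in> hol W"
  shows "commutator_fun g1 (commutator_fun g2 (commutator_fun g3 (Delta \<mu> i))) W f = (\<lambda>x. 0)"
proof -
  have c2: "commutator_fun g2 (commutator_fun g3 (Delta \<mu> i)) W f
    = (\<lambda>x. \<Sum>j\<in>UNIV - {i}. (2 * (X i j g3 x * X i j g2 x) * f x) / (\<mu> i - \<mu> j))" if f: "f \<in> hol W" for f
  proof -
    have "commutator_fun g2 (commutator_fun g3 (Delta \<mu> i)) W f = (\<lambda>x.
        commutator_fun g3 (Delta \<mu> i) W (\<lambda>y. g2 y * f y) x - g2 x * commutator_fun g3 (Delta \<mu> i) W f x)"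
      by (simp add: commutator_fun_def[of g2])
    then show ?thesis
      unfolding commutator_Delta[OF hol_mult[OF g(2) f] g(3)] commutator_Delta[OF f g(3)]
        sum_distrib_left sum_subtractf[symmetric] X_mult[OF g(2) f]
      by (simp add: diff_divide_distrib[symmetric] algebra_simps)
  qed
  show ?thesis
    unfolding commutator_fun_def[of g1]
    by (simp add: c2 hol_mult f g sum_distrib_left sum_subtractf[symmetric] algebra_simps)
qed

subsection \<open>Multiplication by \<open>q\<^sub>1\<close>\<close>

lemma crd_hol: "crd l \<in> hol W"
  by (rule hol_restr_holo[OF holo_nth[OF open_UNIV]]) simp

lemma X_crd: "X i j (crd l) x = (if l = j then crd i x else 0) - (if l = i then crd j x else 0)"
proof (cases "x \<in> W")
  case True
  then show ?thesis
    unfolding X_op_lie lie_restr_holo[OF field_rot holo_nth[OF open_UNIV] UNIV_I True]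
    by (simp add: fd_nth rot_nth restr_def)
qed (simp add: X_op_lie lie_outside restr_def)

lemma E_crd: "E (crd l) = crd l"
proof
  fix x show "E (crd l) x = crd l x"
  proof (cases "x \<in> W")
    case True
    then show ?thesis
      using lie_restr_holo[OF field_id holo_nth[OF open_UNIV] UNIV_I True]
      by (simp add: fd_nth restr_def)
  qed (simp add: lie_outside restr_def)
qed

lemma restr_q1: "restr W (q1 \<mu>) = (\<lambda>x. \<Sum>i\<in>UNIV. \<mu> i * (crd i x * crd i x))"
  by (auto simp: restr_def q1_def fun_eq_iff power2_eq_square)

lemma q1_hol: "restr W (q1 \<mu>) \<in> hol W"
  unfolding restr_q1 by (intro hol_sum hol_cmult hol_mult crd_hol)

lemma X_q1: "X i j (restr W (q1 \<mu>)) = (\<lambda>x. 2 * (\<mu> j - \<mu> i) * (crd i x * crd j x))"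
proof (cases "i = j")
  case False
  show ?thesis
    unfolding restr_q1
    by (rule ext, subst X_sum)
       (use False in \<open>auto simp: X_cmult X_mult hol_cmult hol_mult crd_hol X_crd sum_UNIV_two[of i j] algebra_simps\<close>)
qed (simp add: X_refl q1_hol)

lemma XX_q1: 
  assumes "i \<noteq> j"
  shows "X i j (X i j (restr W (q1 \<mu>))) = (\<lambda>x. 2 * (\<mu> j - \<mu> i) * ((crd i x)\<^sup>2 - (crd j x)\<^sup>2))"
  unfolding X_q1 X_cmult[OF hol_mult[OF crd_hol crd_hol]] X_mult[OF crd_hol crd_hol] X_crd
  using assms by (auto simp: fun_eq_iff power2_eq_square)

lemma sum_crd_X:
  assumes f: "f \<in> hol W"
  shows "(\<Sum>l\<in>UNIV. crd l x * X i l f x) = crd i x * E f x"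
proof (cases "x \<in> W")
  case x: True
  then obtain V F where F: "local_ext W f x V F" using hol_ex f by blast
  then have hF: "holo V F" "x \<in> V" by (auto simp: local_ext_def)
  have "(\<Sum>l\<in>UNIV. crd l x * X i l f x) = fd F x (\<Sum>l\<in>UNIV. x $ l *s rot i l x)"
    unfolding X_op_lie lie_eq[OF field_rot F x]
    using x by (simp add: restr_def holo_fd_sum[OF hF] holo_fd_smult[OF hF])
  \<comment> \<open>This is where the cone enters: in general the sum differs from
    \<open>x $ i *s x\<close> by the multiple \<open>q0 x\<close> of
    \<open>axis i 1\<close>.\<close>
  also have "(\<Sum>l\<in>UNIV. x $ l *s rot i l x) = x $ i *s x"
  proof -
    have "(\<Sum>l\<in>UNIV. x $ l *s rot i l x) $ m = x $ i * x $ m - (if m = i then q0 x else 0)" for m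
      by (simp add: rot_nth right_diff_distrib sum_subtractf q0_def power2_eq_square
          if_distrib[of "\<lambda>c. _ * c"] mult.commute cong: if_cong)
    then show ?thesis using W_cone[OF x] by (simp add: vec_eq_iff)
  qed
  also have "fd F x (x $ i *s x) = crd i x * E f x"
    unfolding lie_eq[OF field_id F x] using x by (simp add: restr_def holo_fd_smult[OF hF])
  finally show ?thesis .
qed (simp add: lie_outside X_op_lie)

lemma sum_crd_sq: "(\<Sum>l\<in>UNIV. (crd l x)\<^sup>2) = 0"
  using W_cone by (cases "x \<in> W") (auto simp: restr_def q0_def)

lemma sum_diff_sq: "(\<Sum>j\<in>UNIV - {i}. (crd i x)\<^sup>2 - (crd j x)\<^sup>2) = of_nat CARD('n) * (crd i x)\<^sup>2"
proof -
  have "(\<Sum>j\<in>UNIV - {i}. (crd i x)\<^sup>2 - (crd j x)\<^sup>2) = (\<Sum>j\<in>UNIV. (crd i x)\<^sup>2 - (crd j x)\<^sup>2)"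
    by (rule sum.mono_neutral_left) auto
  then show ?thesis by (simp add: sum_subtractf sum_crd_sq)
qed

lemma sum_crd_X': "f \<in> hol W \<Longrightarrow> (\<Sum>l\<in>UNIV - {i}. crd l x * X i l f x) = crd i x * E f x"
  by (subst sum_crd_X[symmetric], assumption, rule sum.mono_neutral_left) (auto simp: X_refl)

text \<open>The factor \<open>\<mu> j - \<mu> i\<close> in \<open>X i j q1\<close> cancels the
  denominator, so the cross terms sum to an Euler term and the zeroth-order terms to a multiple of
  the squared coordinate \<open>i\<close>. The quotient by \<open>q1\<close> is thus explicit: it is
  the same operator applied to \<open>g\<close>.\<close>

lemma Delta_q1:
  assumes inj: "inj \<mu>" and g: "g \<in> O_sec (k - 2) W" and k: "k = - (of_nat CARD('n) - 4) / 2"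
  shows "Delta \<mu> i W (\<lambda>x. g x * q1 \<mu> x) = (\<lambda>x. Delta \<mu> i W g x * q1 \<mu> x)"
proof
  fix x
  have gh: "g \<in> hol W" and Eg: "E g x = (k - 2) * g x" using g by (auto simp: O_sec_iff)
  define q where "q = restr W (q1 \<mu>)"
  have gq: "(\<lambda>x. g x * q1 \<mu> x) = (\<lambda>x. g x * q x)"
    using hol_outside[OF gh] by (auto simp: q_def restr_def fun_eq_iff)
  have q: "q \<in> hol W" unfolding q_def by (rule q1_hol)
  have "X i j (X i j (\<lambda>x. g x * q x)) x / (\<mu> i - \<mu> j) = X i j (X i j g) x / (\<mu> i - \<mu> j) * q x
      - 4 * crd i x * (crd j x * X i j g x) - 2 * g x * ((crd i x)\<^sup>2 - (crd j x)\<^sup>2)" if "j \<in> UNIV - {i}" for j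
  proof -
    have ne: "i \<noteq> j" "\<mu> i - \<mu> j \<noteq> 0" using that inj by (auto simp: inj_eq)
    have Xq: "X i j q x = 2 * (\<mu> j - \<mu> i) * (crd i x * crd j x)"
      and XXq: "X i j (X i j q) x = 2 * (\<mu> j - \<mu> i) * ((crd i x)\<^sup>2 - (crd j x)\<^sup>2)"
      unfolding q_def by (simp_all only: XX_q1[OF ne(1)]) (simp only: X_q1)
    have "X i j (X i j (\<lambda>x. g x * q x)) x = X i j (X i j g) x * q x + 2 * (X i j g x * X i j q x) + g x * X i j (X i j q) x"
      by (simp add: X_mult X_add X_hol hol_mult gh q algebra_simps)
    also have "\<dots> = (\<mu> i - \<mu> j) * (X i j (X i j g) x / (\<mu> i - \<mu> j) * q x
      - 4 * crd i x * (crd j x * X i j g x) - 2 * g x * ((crd i x)\<^sup>2 - (crd j x)\<^sup>2))"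
      unfolding Xq XXq using ne(2) by (simp add: field_simps)
    finally show ?thesis using ne(2) by simp
  qed
  then have "Delta \<mu> i W (\<lambda>x. g x * q x) x = (\<Sum>j\<in>UNIV - {i}. X i j (X i j g) x / (\<mu> i - \<mu> j) * q x
      - 4 * crd i x * (crd j x * X i j g x) - 2 * g x * ((crd i x)\<^sup>2 - (crd j x)\<^sup>2))"
    unfolding Delta_def by (intro sum.cong) auto
  also have "\<dots> = Delta \<mu> i W g x * q x - 4 * crd i x * (crd i x * E g x) - 2 * g x * (of_nat CARD('n) * (crd i x)\<^sup>2)"
  proof -
    have split: "(\<Sum>j\<in>A. a j - b j - c j) = sum a A - sum b A - sum c A" for A and a b c :: "'n \<Rightarrow> complex"
      by (simp add: sum_subtractf)
    show ?thesis
      unfolding split unfolding sum_distrib_left[symmetric] sum_distrib_right[symmetric] sum_crd_X'[OF gh] sum_diff_sq Delta_def ..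
  qed
  also have "\<dots> = Delta \<mu> i W g x * q x"
    unfolding Eg k by (simp add: field_simps power2_eq_square)
  also have "\<dots> = Delta \<mu> i W g x * q1 \<mu> x"
    using hol_outside[OF Delta_hol[OF gh]] by (cases "x \<in> W") (auto simp: q_def restr_def)
  finally show "Delta \<mu> i W (\<lambda>x. g x * q1 \<mu> x) x = Delta \<mu> i W g x * q1 \<mu> x" unfolding gq .
qed

end

lemma openin_Int_sub: "openin (top_of_set C) W \<Longrightarrow> open U \<Longrightarrow> openin (top_of_set C) (W \<inter> U)"
  by (metis inf_assoc openin_open openin_open_Int open_Int)

lemma diff_op_Delta:
  fixes \<mu> :: "'n::finite \<Rightarrow> complex"
  shows "diff_op 2 cone_Q k (Delta \<mu> i)"
  unfolding diff_op_def sheaf_op_def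
proof (intro conjI allI impI ballI)
  fix W :: "(complex^'n) set" assume W: "openin (top_of_set cone_Q) W"
  interpret open_in_Q W by unfold_locales (rule W)
  show "Delta \<mu> i W f \<in> O_sec k W" if "f \<in> O_sec k W" for f by (rule Delta_O_sec[OF that])
  show "Delta \<mu> i W (\<lambda>x. a * f x + b * g x) = (\<lambda>x. a * Delta \<mu> i W f x + b * Delta \<mu> i W g x)"
    if "f \<in> O_sec k W" "g \<in> O_sec k W" for f g a b
    using Delta_linear that by (simp add: O_sec_iff)
  show "Delta \<mu> i W' (restr W' f) = restr W' (Delta \<mu> i W f)"
    if "f \<in> O_sec k W" "openin (top_of_set cone_Q) W' \<and> W' \<subseteq> W" for f W'
    using Delta_restr that by (simp add: O_sec_iff)
  show "foldr commutator_fun gs (Delta \<mu> i) W f = (\<lambda>x. 0)"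
    if gs: "length gs = 2 + 1 \<and> set gs \<subseteq> O_sec 0 W" and f: "f \<in> O_sec k W" for gs f
  proof -
    obtain g1 g2 g3 where "gs = [g1, g2, g3]"
      using gs by (auto simp: length_Suc_conv numeral_3_eq_3)
    then show ?thesis using commutator3_Delta gs f by (simp add: O_sec_iff)
  qed
qed

section \<open>The operators on \<open>X\<close>\<close>

lemma cone_X_two_nonzero:
  assumes "x \<in> cone_X \<mu>"
  obtains i j where "i \<noteq> j" "x $ i \<noteq> 0" "x $ j \<noteq> 0"
proof -
  have x: "x \<noteq> 0" "q0 x = 0" using assms by (auto simp: cone_X_iff)
  then obtain i where i: "x $ i \<noteq> 0" by (auto simp: vec_eq_iff)
  have "\<exists>j. j \<noteq> i \<and> x $ j \<noteq> 0"
  proof (rule ccontr)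
    assume "\<nexists>j. j \<noteq> i \<and> x $ j \<noteq> 0"
    then have "q0 x = (\<Sum>j\<in>{i}. (x $ j)\<^sup>2)"
      unfolding q0_def by (intro sum.mono_neutral_right) auto
    then show False using i x by simp
  qed
  then show thesis using that i by blast
qed

text \<open>Since \<open>q\<^sub>0\<close> and \<open>q\<^sub>1\<close> are diagonal, two of the coordinates of a point of the cone over \<open>X\<close> are
  square roots of quadratic polynomials in the others. So no implicit function theorem is needed.\<close>

lemma curve_tangent_X:
  fixes \<mu> :: "'n::finite \<Rightarrow> complex"
  assumes inj: "inj \<mu>" and x: "x \<in> cone_X \<mu>"
    and v0: "(\<Sum>l\<in>UNIV. x $ l * v $ l) = 0" and v1: "(\<Sum>l\<in>UNIV. \<mu> l * (x $ l * v $ l)) = 0"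
  shows "curve_tangent (cone_X \<mu>) x v"
proof -
  obtain i j where ij: "i \<noteq> j" "x $ i \<noteq> 0" "x $ j \<noteq> 0" by (rule cone_X_two_nonzero[OF x])
  have d: "\<mu> i - \<mu> j \<noteq> 0" using inj ij by (auto simp: inj_eq)
  \<comment> \<open>Eliminating one of the two squares from \<open>q0 = 0\<close> and
    \<open>q1 = 0\<close> expresses the square of coordinate \<open>a\<close> by the coordinates
    outside \<open>{i, j}\<close>, which move linearly.\<close>
  define P where "P = (\<lambda>a b (t::real). (\<Sum>l\<in>UNIV - {i, j}. (\<mu> b - \<mu> l) * (x $ l + t *\<^sub>R (v $ l))\<^sup>2) / (\<mu> a - \<mu> b))"
  \<comment> \<open>Dividing by the square of \<open>x $ a\<close> puts the argument of
    \<open>csqrt\<close> at 1 for \<open>t = 0\<close>, away from the cut, and selects the branch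
    that starts at \<open>x $ a\<close>.\<close>
  define r where "r = (\<lambda>a b t. x $ a * csqrt (P a b t / (x $ a)\<^sup>2))"
  define \<gamma> :: "real \<Rightarrow> complex^'n" where
    "\<gamma> = (\<lambda>t. \<chi> l. if l = i then r i j t else if l = j then r j i t else x $ l + t *\<^sub>R (v $ l))"
  have x0: "q0 x = 0" and x1: "q1 \<mu> x = 0" and xn: "x \<noteq> 0" using x by (auto simp: cone_X_iff)
  have lin: "(\<Sum>l\<in>UNIV. (c - \<mu> l) * g l) = 0"
    if "(\<Sum>l\<in>UNIV. g l) = 0" "(\<Sum>l\<in>UNIV. \<mu> l * g l) = 0" for c g
    using that by (simp add: left_diff_distrib sum_subtractf sum_distrib_left[symmetric])
  have rest: "(\<Sum>l\<in>UNIV - {i, j}. (\<mu> b - \<mu> l) * g l) = (\<mu> a - \<mu> b) * g a"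
    if "(\<Sum>l\<in>UNIV. g l) = 0" "(\<Sum>l\<in>UNIV. \<mu> l * g l) = 0" "(a, b) = (i, j) \<or> (a, b) = (j, i)" for a b g
    using lin[OF that(1,2), of "\<mu> b"] that(3) unfolding sum_UNIV_two[OF ij(1)]
    by (auto simp: algebra_simps add_eq_0_iff)
  have r0: "r a b 0 = x $ a" and rd: "(r a b has_vector_derivative v $ a) (at 0)"
    if ab: "(a, b) = (i, j) \<or> (a, b) = (j, i)" for a b
  proof -
    have dab: "\<mu> a - \<mu> b \<noteq> 0" and xa: "x $ a \<noteq> 0" using d ij ab by auto
    have P0: "P a b 0 = (x $ a)\<^sup>2"
      unfolding P_def using rest[of "\<lambda>l. (x $ l)\<^sup>2", OF _ _ ab] x0 x1 dab by (simp add: q0_def q1_def)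
    then show "r a b 0 = x $ a" using xa by (simp add: r_def)
    have "(P a b has_vector_derivative (\<Sum>l\<in>UNIV - {i, j}. (\<mu> b - \<mu> l) * (2 * (v $ l * x $ l))) / (\<mu> a - \<mu> b)) (at 0)"
      unfolding P_def power2_eq_square divide_inverse
      by (rule derivative_eq_intros refl has_vector_derivative_sum | simp)+
    moreover have "(\<Sum>l\<in>UNIV - {i, j}. (\<mu> b - \<mu> l) * (2 * (v $ l * x $ l))) = (\<mu> a - \<mu> b) * (2 * (x $ a * v $ a))"
      unfolding mult.commute[of "v $ _"] by (rule rest[OF _ _ ab]) (use v0 v1 in \<open>simp_all add: sum_distrib_left[symmetric] mult.left_commute[of _ 2]\<close>)
    ultimately have "(P a b has_vector_derivative 2 * (x $ a * v $ a)) (at 0)"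
      by (simp only: nonzero_mult_div_cancel_left[OF dab])
    then have "((\<lambda>t. P a b t / (x $ a)\<^sup>2) has_vector_derivative 2 * (x $ a * v $ a) / (x $ a)\<^sup>2) (at 0)"
      by (rule has_vector_derivative_divide)
    moreover have "(csqrt has_field_derivative inverse (2 * csqrt 1)) (at (P a b 0 / (x $ a)\<^sup>2))"
      using P0 xa has_field_derivative_csqrt[of 1] by simp
    ultimately have "(csqrt \<circ> (\<lambda>t. P a b t / (x $ a)\<^sup>2) has_vector_derivative
        2 * (x $ a * v $ a) / (x $ a)\<^sup>2 * inverse (2 * csqrt 1)) (at 0)"
      by (rule field_vector_diff_chain_at)
    from has_vector_derivative_mult_right[OF this, of "x $ a"]
    show "(r a b has_vector_derivative v $ a) (at 0)"
      using xa by (simp add: r_def[abs_def] o_def power2_eq_square field_simps)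
  qed
  have g0: "\<gamma> 0 = x" using r0[of i j] r0[of j i] by (auto simp: \<gamma>_def vec_eq_iff)
  have gd: "(\<gamma> has_vector_derivative v) (at 0)"
    unfolding has_vector_derivative_def
  proof (rule has_derivative_vec)
    fix l
    have "((\<lambda>t. x $ l + t *\<^sub>R (v $ l)) has_vector_derivative v $ l) (at 0)"
      by (auto intro!: derivative_eq_intros)
    then have "((\<lambda>t. \<gamma> t $ l) has_vector_derivative v $ l) (at 0)"
      using rd[of i j] rd[of j i] by (cases "l = i"; cases "l = j") (simp_all add: \<gamma>_def)
    then show "((\<lambda>t. \<gamma> t $ l) has_derivative (\<lambda>t. (t *\<^sub>R v) $ l)) (at 0)"
      by (simp add: has_vector_derivative_def)
  qed
  have "(\<gamma> \<longlongrightarrow> x) (at 0)"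
    using has_vector_derivative_continuous[OF gd] g0 by (simp add: isCont_def)
  then have "\<forall>\<^sub>F t in at 0. \<gamma> t \<noteq> 0"
    using xn by (rule tendsto_imp_eventually_ne)
  \<comment> \<open>Only the squares of the two special coordinates enter, so the equations hold for
    every \<open>t\<close>, whatever the branch of the root.\<close>
  moreover have "q0 (\<gamma> t) = 0 \<and> q1 \<mu> (\<gamma> t) = 0" for t
  proof -
    define S where "S = (\<lambda>f. \<Sum>l\<in>UNIV - {i, j}. f l * (x $ l + t *\<^sub>R (v $ l))\<^sup>2)"
    have sq: "(\<gamma> t $ i)\<^sup>2 = S (\<lambda>l. \<mu> j - \<mu> l) / (\<mu> i - \<mu> j)" "(\<gamma> t $ j)\<^sup>2 = S (\<lambda>l. \<mu> i - \<mu> l) / (\<mu> j - \<mu> i)"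
      using ij by (auto simp: \<gamma>_def r_def P_def S_def power_mult_distrib)
    have S: "S (\<lambda>l. c - \<mu> l) = c * S (\<lambda>l. 1) - S \<mu>" for c
      by (simp add: S_def left_diff_distrib sum_subtractf sum_distrib_left)
    have "(\<Sum>l\<in>UNIV - {i, j}. (\<gamma> t $ l)\<^sup>2) = S (\<lambda>l. 1)" "(\<Sum>l\<in>UNIV - {i, j}. \<mu> l * (\<gamma> t $ l)\<^sup>2) = S \<mu>"
      unfolding S_def by (auto intro!: sum.cong simp: \<gamma>_def)
    then have q: "q0 (\<gamma> t) = (\<gamma> t $ i)\<^sup>2 + (\<gamma> t $ j)\<^sup>2 + S (\<lambda>l. 1)"
      "q1 \<mu> (\<gamma> t) = \<mu> i * (\<gamma> t $ i)\<^sup>2 + \<mu> j * (\<gamma> t $ j)\<^sup>2 + S \<mu>"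
      unfolding q0_def q1_def sum_UNIV_two[OF ij(1)] by simp_all
    have "\<mu> j - \<mu> i \<noteq> 0" using d by auto
    then show ?thesis
      unfolding q sq S using d by (simp add: divide_simps) (simp add: algebra_simps)
  qed
  ultimately have "\<forall>\<^sub>F t in at 0. \<gamma> t \<in> cone_X \<mu>" by (simp add: cone_X_iff)
  with g0 gd show ?thesis unfolding curve_tangent_def by blast
qed

section \<open>Functions on Q that vanish on X\<close>

context open_in_Q
begin

lemma openin_X: "openin (top_of_set (cone_X \<mu>)) (W \<inter> cone_X \<mu>)"
proof -
  obtain U where U: "open U" "W = cone_Q \<inter> U" using W by (auto simp: openin_open)
  then have "W \<inter> cone_X \<mu> = cone_X \<mu> \<inter> U" using cone_X_subset_Q[of \<mu>] by blast
  then show ?thesis using U(1) by (auto simp: openin_open)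
qed

text \<open>\<open>a p r\<close> and \<open>a i l\<close> are the derivatives of \<open>q1\<close>
  along the two rotations, so \<open>v\<close> is tangent to both quadrics and is the velocity of a
  curve in X. On X the function \<open>h\<close> also has the extension 0, hence its derivative
  along \<open>v\<close> vanishes.\<close>

lemma vanish_on_X:
  assumes inj: "inj \<mu>" and h: "h \<in> hol W" and h0: "\<And>y. y \<in> W \<inter> cone_X \<mu> \<Longrightarrow> h y = 0"
    and x: "x \<in> W \<inter> cone_X \<mu>"
  shows "X p r (restr W (q1 \<mu>)) x * X i l h x = X i l (restr W (q1 \<mu>)) x * X p r h x"
proof -
  obtain V F where F: "local_ext W h x V F" using hol_ex[OF h] x by blast
  then have hF: "holo V F" "x \<in> V" by (auto simp: local_ext_def)
  define a where "a = (\<lambda>i j. 2 * (\<mu> j - \<mu> i) * (x $ i * x $ j))"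
  define v where "v = a p r *s rot i l x - a i l *s rot p r x"
  have s: "(\<Sum>m\<in>UNIV. c m * (x $ m * rot i j x $ m)) = (c j - c i) * (x $ i * x $ j)" for i j and c :: "'n \<Rightarrow> complex"
    by (simp add: rot_nth right_diff_distrib sum_subtractf if_distrib[of "\<lambda>c. _ * c"] cong: if_cong)
       (simp add: algebra_simps)
  have v: "(\<Sum>m\<in>UNIV. c m * (x $ m * v $ m)) = a p r * ((c l - c i) * (x $ i * x $ l)) - a i l * ((c r - c p) * (x $ p * x $ r))"
    for c :: "'n \<Rightarrow> complex"
    unfolding s[symmetric] v_def by (simp add: sum_distrib_left sum_subtractf algebra_simps)
  have "curve_tangent (cone_X \<mu>) x v"
  proof (rule curve_tangent_X[OF inj])
    show "(\<Sum>m\<in>UNIV. x $ m * v $ m) = 0" using v[of "\<lambda>_. 1"] by simp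
    show "(\<Sum>m\<in>UNIV. \<mu> m * (x $ m * v $ m)) = 0" unfolding v by (simp add: a_def algebra_simps)
  qed (use x in simp)
  then have t: "curve_tangent (W \<inter> cone_X \<mu>) x v"
    by (rule curve_tangent_openin[OF _ openin_X x])
  have "local_ext (W \<inter> cone_X \<mu>) h x V F" using F by (auto simp: local_ext_def)
  moreover have "local_ext (W \<inter> cone_X \<mu>) h x UNIV (\<lambda>_. 0)"
    using h0 by (auto simp: local_ext_def holo_const)
  ultimately have "fd F x v = fd (\<lambda>_. 0) x v"
    by (rule curve_tangent_deriv_unique[OF t]) (use x in simp)
  then have "fd F x v = 0" by (simp add: fd_eq[OF has_derivative_const])
  then have "a p r * fd F x (rot i l x) = a i l * fd F x (rot p r x)"
    unfolding v_def by (simp add: holo_fd_diff[OF hF] holo_fd_smult[OF hF])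
  moreover have "x \<in> W" using x by simp
  ultimately show ?thesis
    unfolding X_q1 unfolding X_op_lie lie_eq[OF field_rot F \<open>x \<in> W\<close>] by (simp add: a_def restr_def)
qed

lemma q1_O_sec: "restr W (q1 \<mu>) \<in> O_sec 2 W"
  unfolding O_sec_iff
proof
  show "restr W (q1 \<mu>) \<in> hol W" by (rule q1_hol)
  show "E (restr W (q1 \<mu>)) = (\<lambda>x. 2 * restr W (q1 \<mu>) x)"
    unfolding restr_q1
    by (simp add: lie_sum[OF field_id] lie_cmult[OF field_id] lie_mult[OF field_id] E_crd hol_cmult hol_mult crd_hol
        sum_distrib_left algebra_simps)
qed

text \<open>With \<open>Y = X\<^sub>p\<^sub>r\<close> transversal to \<open>X\<close> and \<open>\<tau> = Y q\<^sub>1\<close>, the function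
  \<open>\<tau> X\<^sub>i\<^sub>l f - (X\<^sub>i\<^sub>l q\<^sub>1) Y f\<close> again vanishes on \<open>X\<close>. This expresses \<open>\<tau>\<^sup>2 X\<^sub>i\<^sub>l\<^sup>2 f\<close> on \<open>X\<close> by derivatives
  containing \<open>Y\<close>, whose contributions cancel in the sum over \<open>l\<close> for the critical degree \<open>k\<close>.\<close>

lemma Delta_vanish_on_X:
  assumes inj: "inj \<mu>" and k: "k = - (of_nat CARD('n) - 4) / 2"
    and f: "f \<in> O_sec k W" and f0: "\<And>y. y \<in> W \<inter> cone_X \<mu> \<Longrightarrow> f y = 0"
    and x: "x \<in> W \<inter> cone_X \<mu>"
  shows "Delta \<mu> i W f x = 0"
proof -
  define q where "q = restr W (q1 \<mu>)"
  have fh: "f \<in> hol W" and Ef: "E f = (\<lambda>x. k * f x)" using f by (auto simp: O_sec_iff)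
  have qh: "q \<in> hol W" and Eq: "E q = (\<lambda>x. 2 * q x)" using q1_O_sec[of \<mu>] by (auto simp: O_sec_iff q_def)
  have qx: "q x = 0" using x by (auto simp: q_def restr_def cone_X_iff)
  have fx: "f x = 0" using f0 x by blast
  obtain p r where pr: "p \<noteq> r" "x $ p \<noteq> 0" "x $ r \<noteq> 0" using cone_X_two_nonzero x by blast
  define \<tau> where "\<tau> = X p r q"
  have th: "\<tau> \<in> hol W" and Et: "E \<tau> = (\<lambda>x. 2 * \<tau> x)"
    using X_O_sec[OF q1_O_sec[of \<mu>], of p r] by (auto simp: O_sec_iff q_def \<tau>_def)
  have tx: "\<tau> x \<noteq> 0"
    using pr x inj unfolding \<tau>_def q_def X_q1 by (auto simp: restr_def inj_eq)
  define y where "y = X p r f"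
  have yh: "y \<in> hol W" and Ey: "E y = (\<lambda>x. k * y x)"
    using X_O_sec[OF f, of p r] by (auto simp: O_sec_iff y_def)
  \<comment> \<open>Corrections that arise when \<open>X p r\<close> is moved past the coordinates
    \<open>crd l\<close>.\<close>
  define S where "S = (\<lambda>g. \<Sum>l\<in>UNIV - {i}. X p r (crd l) x * X i l g x)"
  have Xvan: "\<tau> z * X i l f z = X i l q z * y z" if "z \<in> W \<inter> cone_X \<mu>" for l z
    unfolding \<tau>_def y_def q_def by (rule vanish_on_X[OF inj fh f0 that])
  \<comment> \<open>The relation \<open>vanish_on_X\<close>, now for the function \<open>h\<close>
    which vanishes on X by its first use; Leibniz' rule brings in the second derivatives of
    \<open>f\<close>.\<close>
  have X2: "\<tau> x * (X i l \<tau> x * X i l f x + \<tau> x * X i l (X i l f) x - X i l (X i l q) x * y x - X i l q x * X i l y x)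
      = X i l q x * (X p r \<tau> x * X i l f x + \<tau> x * X p r (X i l f) x - X p r (X i l q) x * y x - X i l q x * X p r y x)" for l
  proof -
    define h where "h = (\<lambda>x. \<tau> x * X i l f x - X i l q x * y x)"
    have hh: "h \<in> hol W" unfolding h_def by (intro hol_diff hol_mult X_hol th fh qh yh)
    have Xh: "X a b h x = X a b \<tau> x * X i l f x + \<tau> x * X a b (X i l f) x - X a b (X i l q) x * y x - X i l q x * X a b y x" for a b
      unfolding h_def
      by (simp add: X_diff X_mult hol_mult X_hol th fh qh yh algebra_simps)
    have "\<tau> x * X i l h x = X i l q x * X p r h x"
      unfolding \<tau>_def q_def by (rule vanish_on_X[OF inj hh _ x]) (use Xvan in \<open>simp add: h_def\<close>)
    then show ?thesis unfolding Xh .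
  qed
  \<comment> \<open>Solve for the square and divide by \<open>\<mu> i - \<mu> l\<close>. Apart from
    the difference of squares, \<open>l\<close> enters each term through \<open>crd l\<close> times
    a derivative involving \<open>X i l\<close>, so summation over \<open>l\<close> leads back to
    the Euler field.\<close>
  have eq: "(\<tau> x)\<^sup>2 * (X i l (X i l f) x / (\<mu> i - \<mu> l)) =
      2 * crd i x * y x * (crd l x * X i l \<tau> x) - 2 * \<tau> x * y x * ((crd i x)\<^sup>2 - (crd l x)\<^sup>2)
      - 2 * \<tau> x * crd i x * (crd l x * X i l y x)
      - 2 * crd i x * X p r \<tau> x * (crd l x * X i l f x) - 2 * crd i x * \<tau> x * (crd l x * X p r (X i l f) x)
      + 2 * crd i x * y x * (crd l x * X p r (X i l q) x) + 2 * crd i x * X p r y x * (crd l x * X i l q x)"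
    if "l \<in> UNIV - {i}" for l
  proof -
    define m where "m = \<mu> i - \<mu> l"
    have ne: "i \<noteq> l" "m \<noteq> 0" using that inj by (auto simp: inj_eq m_def)
    have q: "X i l q x = - 2 * m * (crd i x * crd l x)" unfolding q_def X_q1 m_def by (simp add: algebra_simps)
    have qq: "X i l (X i l q) x = - 2 * m * ((crd i x)\<^sup>2 - (crd l x)\<^sup>2)"
      unfolding q_def XX_q1[OF ne(1)] m_def by (simp add: algebra_simps)
    have v: "\<tau> x * X i l f x = - 2 * m * (crd i x * crd l x) * y x" using Xvan[OF x, of l] by (simp add: q)
    have "m * ((\<tau> x)\<^sup>2 * (X i l (X i l f) x / m)) = (\<tau> x)\<^sup>2 * X i l (X i l f) x" using ne by simp
    also have "\<dots> = m * (2 * crd i x * y x * (crd l x * X i l \<tau> x) - 2 * \<tau> x * y x * ((crd i x)\<^sup>2 - (crd l x)\<^sup>2)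
      - 2 * \<tau> x * crd i x * (crd l x * X i l y x)
      - 2 * crd i x * X p r \<tau> x * (crd l x * X i l f x) - 2 * crd i x * \<tau> x * (crd l x * X p r (X i l f) x)
      + 2 * crd i x * y x * (crd l x * X p r (X i l q) x) + 2 * crd i x * X p r y x * (crd l x * X i l q x))"
      using X2[of l] v unfolding q qq by algebra
    finally show ?thesis using ne(2) unfolding m_def[symmetric] by simp
  qed
  have split: "(\<Sum>j\<in>A. a j - b j - c j - d j - e j + f j + g j)
      = sum a A - sum b A - sum c A - sum d A - sum e A + sum f A + sum g A"
    for A and a b c d e f g :: "'n \<Rightarrow> complex"
    by (simp add: sum_subtractf sum.distrib)
  \<comment> \<open>Differentiate the identity \<open>sum_crd_X'\<close> along \<open>X p r\<close>.
    Since \<open>g x = 0\<close>, only the derivative of \<open>g\<close> survives on the right, and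
    \<open>S g\<close> collects the derivatives of the coordinates.\<close>
  have u: "(\<Sum>l\<in>UNIV - {i}. crd l x * X p r (X i l g) x) = c * (crd i x * X p r g x) - S g"
    if g: "g \<in> O_sec c W" "g x = 0" for g c
  proof -
    have gh: "g \<in> hol W" and Eg: "E g = (\<lambda>x. c * g x)" using g by (auto simp: O_sec_iff)
    have "(\<lambda>x. \<Sum>l\<in>UNIV - {i}. crd l x * X i l g x) = (\<lambda>x. c * (crd i x * g x))"
      using sum_crd_X'[OF gh, where i=i] by (simp add: Eg mult.left_commute)
    then have "X p r (\<lambda>x. \<Sum>l\<in>UNIV - {i}. crd l x * X i l g x) x = X p r (\<lambda>x. c * (crd i x * g x)) x" by simp
    then show ?thesis
      using g(2)
      by (simp add: X_sum X_mult X_cmult hol_mult X_hol crd_hol gh S_def sum.distrib eq_diff_eq)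
  qed
  \<comment> \<open>This makes the two contributions of \<open>S\<close> cancel, as one enters as
    \<open>\<tau> x * S f\<close> and the other as \<open>S q * y x\<close>.\<close>
  have St: "\<tau> x * S f = S q * y x"
    unfolding S_def sum_distrib_left sum_distrib_right
    by (intro sum.cong refl) (use Xvan[OF x] in \<open>simp add: mult.left_commute mult.assoc\<close>)
  have "(\<tau> x)\<^sup>2 * Delta \<mu> i W f x = (\<Sum>l\<in>UNIV - {i}. (\<tau> x)\<^sup>2 * (X i l (X i l f) x / (\<mu> i - \<mu> l)))"
    by (simp add: Delta_def sum_distrib_left)
  also have "\<dots> = (\<Sum>l\<in>UNIV - {i}. 2 * crd i x * y x * (crd l x * X i l \<tau> x) - 2 * \<tau> x * y x * ((crd i x)\<^sup>2 - (crd l x)\<^sup>2)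
      - 2 * \<tau> x * crd i x * (crd l x * X i l y x)
      - 2 * crd i x * X p r \<tau> x * (crd l x * X i l f x) - 2 * crd i x * \<tau> x * (crd l x * X p r (X i l f) x)
      + 2 * crd i x * y x * (crd l x * X p r (X i l q) x) + 2 * crd i x * X p r y x * (crd l x * X i l q x))"
    by (rule sum.cong[OF refl eq])
  also have "\<dots> = 2 * crd i x * y x * (crd i x * E \<tau> x) - 2 * \<tau> x * y x * (of_nat CARD('n) * (crd i x)\<^sup>2)
      - 2 * \<tau> x * crd i x * (crd i x * E y x)
      - 2 * crd i x * X p r \<tau> x * (crd i x * E f x) - 2 * crd i x * \<tau> x * (k * (crd i x * y x) - S f)
      + 2 * crd i x * y x * (2 * (crd i x * \<tau> x) - S q) + 2 * crd i x * X p r y x * (crd i x * E q x)"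
    unfolding split
    unfolding sum_distrib_left[symmetric] sum_crd_X'[OF th] sum_crd_X'[OF yh] sum_crd_X'[OF fh] sum_crd_X'[OF qh]
      sum_diff_sq u[OF f fx] u[OF q1_O_sec[of \<mu>, folded q_def] qx] y_def[symmetric] \<tau>_def[symmetric] ..
  \<comment> \<open>The degree 2 of \<open>\<tau>\<close> and of \<open>q\<close> contributes 4
    each, the squares \<open>- 2 * N\<close>, and the degree of \<open>y\<close> and of
    \<open>f\<close> \<open>- 2 * k\<close> each: in total \<open>8 - 2 * N - 4 * k\<close>.\<close>
  also have "\<dots> = 2 * \<tau> x * y x * (crd i x)\<^sup>2 * (4 - of_nat CARD('n) - 2 * k)"
    unfolding Et Ey Ef Eq fx qx using St by algebra
  also have "\<dots> = 0" unfolding k by simp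
  finally show ?thesis using tx by simp
qed

end

subsection \<open>Homogeneity and local extensions\<close>

definition conic :: "(complex^'n) set \<Rightarrow> bool" where
  "conic C \<longleftrightarrow> (\<forall>c x. c \<noteq> 0 \<longrightarrow> x \<in> C \<longrightarrow> c *s x \<in> C)"

lemma conicD: "conic C \<Longrightarrow> c \<noteq> 0 \<Longrightarrow> x \<in> C \<Longrightarrow> c *s x \<in> C"
  by (simp add: conic_def)

lemma conic_cone_Q: "conic cone_Q"
  by (simp add: conic_def cone_Q_smult)

lemma conic_cone_X: "conic (cone_X \<mu>)"
  by (simp add: conic_def cone_X_smult)

lemma O_sec_conic:
  assumes "conic C" "openin (top_of_set C) W"
  shows "f \<in> O_sec k W \<longleftrightarrow> f \<in> hol W \<and> lie W (\<lambda>x. x) f = (\<lambda>x. k * f x)"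
  by (rule O_sec_iff_gen[OF assms(2)]) (use assms(1) in \<open>auto simp: conic_def\<close>)

lemma lin_field_id_conic: "conic C \<Longrightarrow> openin (top_of_set C) W \<Longrightarrow> lin_field W (\<lambda>x. x)"
  by (rule lin_field_id) (auto simp: conic_def)

lemma O_sec_mult:
  assumes C: "conic C" "openin (top_of_set C) W" and f: "f \<in> O_sec a W" and g: "g \<in> O_sec b W"
  shows "(\<lambda>x. f x * g x) \<in> O_sec (a + b) W"
  using f g unfolding O_sec_conic[OF C]
  by (simp add: hol_mult lie_mult[OF lin_field_id_conic[OF C]] algebra_simps)

lemma O_sec_linear:
  assumes C: "conic C" "openin (top_of_set C) W" and f: "f \<in> O_sec k W" and g: "g \<in> O_sec k W"
  shows "(\<lambda>x. a * f x + b * g x) \<in> O_sec k W"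
  using f g unfolding O_sec_conic[OF C]
  by (simp add: hol_linear lie_linear[OF lin_field_id_conic[OF C]] algebra_simps)

lemma O_sec_restr:
  assumes C: "conic C" "openin (top_of_set C) W" and W': "openin (top_of_set C) W'" "W' \<subseteq> W" and f: "f \<in> O_sec k W"
  shows "restr W' f \<in> O_sec k W'"
  using f unfolding O_sec_conic[OF C] O_sec_conic[OF C(1) W'(1)]
  using lie_restr[OF lin_field_id_conic[OF C] lin_field_id_conic[OF C(1) W'(1)] W'(2)] hol_restr[OF _ W'(2)]
  by (auto simp: restr_def fun_eq_iff)

text \<open>A local extension of \<open>g\<close> also extends \<open>f\<close>, because
  \<open>W\<close> lies in \<open>D\<close>, and the Euler derivative at \<open>x\<close> is
  computed from it either way. With \<open>D = cone_Q\<close> this recognizes sections over X by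
  their lifts.\<close>

lemma O_sec_local:
  assumes C: "conic C" "openin (top_of_set C) W" and D: "conic D" and CD: "C \<subseteq> D"
    and out: "\<And>x. x \<notin> W \<Longrightarrow> f x = 0"
    and loc: "\<And>x. x \<in> W \<Longrightarrow> \<exists>W' g. openin (top_of_set D) W' \<and> x \<in> W' \<and> g \<in> O_sec k W' \<and>
        (\<forall>y\<in>W' \<inter> W. f y = g y)"
  shows "f \<in> O_sec k W"
proof -
  have *: "\<exists>V F. local_ext W f x V F \<and> fd F x x = k * f x" if x: "x \<in> W" for x
  proof -
    obtain W' g where W': "openin (top_of_set D) W'" "x \<in> W'" "g \<in> O_sec k W'" "\<And>y. y \<in> W' \<inter> W \<Longrightarrow> f y = g y"
      using loc[OF x] by blast
    obtain U where U: "open U" "W' = D \<inter> U" using W'(1) by (auto simp: openin_open)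
    have g: "g \<in> hol W'" "lie W' (\<lambda>x. x) g x = k * g x" using W'(3) O_sec_conic[OF D W'(1)] by auto
    obtain V G where G: "local_ext W' g x V G" using hol_ex[OF g(1) W'(2)] by blast
    have "W \<subseteq> D" using C(2) CD openin_imp_subset by blast
    then have "local_ext W f x (V \<inter> U) G"
      using G U W' by (auto simp: local_ext_def intro: holo_subset holo_open)
    moreover have "fd G x x = k * f x"
      using lie_eq[OF lin_field_id_conic[OF D W'(1)] G W'(2)] g(2) W'(4) x W'(2) by simp
    ultimately show ?thesis by blast
  qed
  have h: "f \<in> hol W" using * out unfolding hol_def holo_cone_def by blast
  moreover have "lie W (\<lambda>x. x) f x = k * f x" for x
  proof (cases "x \<in> W")
    case True
    then show ?thesis using * lie_eq[OF lin_field_id_conic[OF C]] by metis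
  qed (simp add: lie_outside out)
  ultimately show ?thesis by (simp add: O_sec_conic[OF C] fun_eq_iff)
qed

text \<open>Euler's equation is infinitesimal; along a complex ray it becomes
  \<open>c * h' = k * h\<close>, which can be integrated.\<close>

lemma ray_deriv:
  assumes C: "conic C" "openin (top_of_set C) W" and f: "f \<in> O_sec k W" and c: "c *s x \<in> W" "c \<noteq> 0"
  shows "((\<lambda>c. f (c *s x)) has_field_derivative k * f (c *s x) / c) (at c)"
proof -
  have fh: "f \<in> hol W" and Ef: "lie W (\<lambda>x. x) f (c *s x) = k * f (c *s x)" using f O_sec_conic[OF C] by auto
  obtain V F where F: "local_ext W f (c *s x) V F" using hol_ex[OF fh c(1)] by blast
  then have hF: "holo V F" "c *s x \<in> V" by (auto simp: local_ext_def)
  obtain U where U: "open U" "W = C \<inter> U" using C(2) by (auto simp: openin_open)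
  have "c * fd F (c *s x) x = k * f (c *s x)"
    using Ef lie_eq[OF lin_field_id_conic[OF C] F c(1)] holo_fd_smult[OF hF] by simp
  then have e: "fd F (c *s x) x = k * f (c *s x) / c" using c(2) by (simp add: field_simps)
  have "inverse c *s (c *s x) \<in> C" by (rule conicD[OF C(1)]) (use c U in auto)
  then have x: "x \<in> C" using c by simp
  have op: "open ((\<lambda>z. z *s x) -` (V \<inter> U) \<inter> {z. z \<noteq> 0})"
    by (intro open_Int open_vimage continuous_intros holo_open[OF hF(1)] U open_Collect_neq)
  show ?thesis
  proof (rule has_field_derivative_transform_within_open[OF _ op])
    show "((\<lambda>z. F (z *s x)) has_field_derivative k * f (c *s x) / c) (at c)"
      using holo_line_deriv[OF hF(1), of 0 c x] hF(2) e by simp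
    show "c \<in> (\<lambda>z. z *s x) -` (V \<inter> U) \<inter> {z. z \<noteq> 0}" using c hF U by auto
    fix z assume "z \<in> (\<lambda>z. z *s x) -` (V \<inter> U) \<inter> {z. z \<noteq> 0}"
    then have "z *s x \<in> V \<inter> W" using C(1) x U by (auto simp: conic_def)
    then show "F (z *s x) = f (z *s x)" using F by (auto simp: local_ext_def)
  qed
qed

lemma not_nonpos_Reals_near_1:
  fixes c :: complex
  shows "norm (c - 1) < 1 \<Longrightarrow> c \<notin> \<real>\<^sub>\<le>\<^sub>0"
proof
  assume c: "norm (c - 1) < 1" and "c \<in> \<real>\<^sub>\<le>\<^sub>0"
  then have "Re c \<le> 0" by (simp add: complex_nonpos_Reals_iff)
  moreover have "\<bar>Re (c - 1)\<bar> < 1" using c abs_Re_le_cmod[of "c - 1"] by linarith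
  ultimately show False by simp
qed

text \<open>\<open>exp (- k * Ln c) * f (c *s x)\<close> has derivative zero. The disc about 1 is
  convex and avoids the cut of \<open>Ln\<close>, so complex powers are unambiguous there.\<close>

lemma O_sec_homogeneous_near_1:
  assumes C: "conic C" "openin (top_of_set C) W" and f: "f \<in> O_sec k W"
    and d: "0 < d" "d \<le> 1" and sub: "\<And>c. norm (c - 1) < d \<Longrightarrow> c *s x \<in> W" and c: "norm (c - 1) < d"
  shows "f (c *s x) = exp (k * Ln c) * f x"
proof -
  define h where "h = (\<lambda>c. exp (- k * Ln c) * f (c *s x))"
  have nz: "z \<notin> \<real>\<^sub>\<le>\<^sub>0" if "norm (z - 1) < d" for z :: complex
    by (rule not_nonpos_Reals_near_1) (use that d in linarith)
  have "\<exists>e. \<forall>z\<in>ball 1 d. h z = e"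
  proof (rule has_field_derivative_zero_constant[OF convex_ball])
    fix z :: complex assume "z \<in> ball 1 d"
    then have z: "norm (z - 1) < d" by (simp add: dist_norm norm_minus_commute)
    have z0: "z \<noteq> 0" using nz[OF z] by auto
    have "(h has_field_derivative exp (- k * Ln z) * (k * f (z *s x) / z) + exp (- k * Ln z) * (- k * (1 / z)) * f (z *s x)) (at z)"
      unfolding h_def
      by (rule derivative_eq_intros refl ray_deriv[OF C f sub[OF z] z0] | simp add: nz[OF z] z0 | simp add: divide_inverse mult_ac)+
    then show "(h has_field_derivative 0) (at z within ball 1 d)"
      by (simp add: field_simps has_field_derivative_at_within)
  qed
  then have "h c = h 1" using c d by (auto simp: dist_norm norm_minus_commute)
  then show ?thesis by (simp add: h_def exp_minus field_simps)
qed

text \<open>A lift of \<open>f\<close> to Q near \<open>x\<close>. The inclusion in \<open>W\<close>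
  ensures that \<open>g\<close> is compared with \<open>f\<close> only where \<open>f\<close> is a
  section.\<close>

definition ext_Q ::
  "('n::finite \<Rightarrow> complex) \<Rightarrow> complex \<Rightarrow> (complex^'n) set \<Rightarrow> (complex^'n \<Rightarrow> complex) \<Rightarrow> complex^'n \<Rightarrow>
   (complex^'n) set \<Rightarrow> (complex^'n \<Rightarrow> complex) \<Rightarrow> bool" where
  "ext_Q \<mu> k W f x W' g \<longleftrightarrow> openin (top_of_set cone_Q) W' \<and> x \<in> W' \<and> W' \<inter> cone_X \<mu> \<subseteq> W \<and>
     g \<in> O_sec k W' \<and> (\<forall>y\<in>W' \<inter> cone_X \<mu>. g y = f y)"

text \<open>An arbitrary extension \<open>F\<close> need not satisfy Euler's equation. It is used
  only on the slice where coordinate \<open>m\<close> equals \<open>x $ m\<close>: the point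
  \<open>\<phi> y *s y\<close> lies there, and \<open>exp (- k * Ln (\<phi> y))\<close> restores the
  degree \<open>k\<close>.\<close>

lemma ext_Q_exists:
  fixes \<mu> :: "'n::finite \<Rightarrow> complex"
  assumes W: "openin (top_of_set (cone_X \<mu>)) W" and f: "f \<in> O_sec k W" and x: "x \<in> W"
  obtains W' g where "ext_Q \<mu> k W f x W' g"
proof -
  obtain U where U: "open U" "W = cone_X \<mu> \<inter> U" using W by (auto simp: openin_open)
  have "f \<in> hol W" using f O_sec_conic[OF conic_cone_X W] by blast
  then obtain V F where F: "local_ext W f x V F" using hol_ex x by blast
  then have hF: "holo V F" "x \<in> V" and Ff: "\<And>y. y \<in> V \<inter> W \<Longrightarrow> F y = f y" by (auto simp: local_ext_def)
  obtain m where m: "x $ m \<noteq> 0" using x U by (auto simp: cone_X_iff vec_eq_iff)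
  have "open (V \<inter> U)" using U holo_open[OF hF(1)] by auto
  then obtain e where e: "e > 0" "ball x e \<subseteq> V \<inter> U"
    using x U hF(2) open_contains_ball by blast
  \<comment> \<open>Chosen so that \<open>c *s y\<close> moves by at most \<open>e / 2\<close> for
    \<open>norm (c - 1) < d\<close> and \<open>y\<close> in the half ball; the cap keeps
    \<open>c\<close> in the domain of \<open>Ln\<close>.\<close>
  define d where "d = min (1/2) (e / (2 * (norm x + e)))"
  have xe: "norm x + e > 0" using e norm_ge_zero[of x] by linarith
  have d: "0 < d" "d \<le> 1" using e xe by (auto simp: d_def)
  have "d * (norm x + e) \<le> e / (2 * (norm x + e)) * (norm x + e)"
    using xe by (intro mult_right_mono) (auto simp: d_def)
  also have "\<dots> = e / 2"
  proof -
    have "e / (2 * s) * s = e / 2" if "s > 0" for s :: real using that by simp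
    from this[OF xe] show ?thesis .
  qed
  finally have de: "d * (norm x + e) \<le> e / 2" .
  have near: "c *s y \<in> ball x e" if y: "y \<in> ball x (e/2)" and c: "norm (c - 1) < d" for c y
  proof -
    have "norm y \<le> norm x + e"
      using y e norm_triangle_ineq2[of y x] by (simp add: dist_norm norm_minus_commute)
    then have "norm (c - 1) * norm y \<le> d * (norm x + e)"
      using c d by (intro mult_mono) auto
    then have "norm ((c - 1) *s y) \<le> e / 2" using de unfolding norm_smult by linarith
    moreover have "c *s y - x = (c - 1) *s y + (y - x)" by (simp add: vec_eq_iff algebra_simps)
    ultimately have "norm (c *s y - x) < e"
      using y norm_triangle_ineq[of "(c - 1) *s y" "y - x"] by (simp add: dist_norm norm_minus_commute)
    then show ?thesis by (simp add: dist_norm norm_minus_commute)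
  qed
  define \<phi> where "\<phi> = (\<lambda>y::complex^'n. x $ m / y $ m)"
  define V' where "V' = ball x (e/2) \<inter> {y. norm (x $ m - y $ m) < d * norm (y $ m)}"
  have oV: "open V'"
    unfolding V'_def by (intro open_Int open_ball open_Collect_less continuous_intros)
  have xV: "x \<in> V'" using e d m by (simp add: V'_def)
  have V'm: "y $ m \<noteq> 0" and V'\<phi>: "norm (\<phi> y - 1) < d" if "y \<in> V'" for y
  proof -
    show 1: "y $ m \<noteq> 0" using that norm_ge_zero[of "x $ m - y $ m"] by (auto simp: V'_def)
    then have "\<phi> y - 1 = (x $ m - y $ m) / y $ m" by (simp add: \<phi>_def field_simps)
    then show "norm (\<phi> y - 1) < d" using that 1 by (simp add: V'_def norm_divide divide_less_eq)
  qed
  have V'n: "\<phi> y \<notin> \<real>\<^sub>\<le>\<^sub>0" if "y \<in> V'" for y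
    by (rule not_nonpos_Reals_near_1) (use V'\<phi>[OF that] d in linarith)
  have V'0: "\<phi> y \<noteq> 0" if "y \<in> V'" for y using V'n[OF that] by auto
  have V'V: "\<phi> y *s y \<in> ball x e" if "y \<in> V'" for y
    using near[OF _ V'\<phi>[OF that]] that by (simp add: V'_def)
  define G where "G = (\<lambda>y. exp (- k * Ln (\<phi> y)) * F (\<phi> y *s y))"
  have h\<phi>: "holo V' \<phi>" unfolding \<phi>_def by (intro holo_divide holo_const holo_nth oV V'm)
  have hL: "holo V' (\<lambda>y. Ln (\<phi> y))"
    by (rule holo_compose_field[OF h\<phi>, where g'=inverse]) (auto intro!: has_field_derivative_Ln simp: V'n)
  have hE: "holo V' (\<lambda>y. exp (- k * Ln (\<phi> y)))"
    by (rule holo_compose_field[OF holo_mult[OF holo_const[OF oV] hL], where g'=exp]) (auto intro!: DERIV_exp)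
  have hG: "holo V' G"
    unfolding G_def
  proof (intro holo_mult hE holo_compose[OF hF(1)])
    show "holo V' (\<lambda>y. (\<phi> y *s y) $ i)" for i using holo_mult[OF h\<phi> holo_nth[OF oV]] by simp
    show "\<phi> y *s y \<in> V" if "y \<in> V'" for y using V'V[OF that] e by blast
  qed
  have EG: "fd G y y = k * G y" if y: "y \<in> V'" for y
  proof -
    have 1: "((\<lambda>z. G (y + z *s y)) has_field_derivative fd G y y) (at 0)"
      using holo_line_deriv[OF hG, of y 0 y] y by simp
    \<comment> \<open>Along the ray through \<open>y\<close> the normalized point does not move;
      only the power factor varies.\<close>
    have ex: "G (y + z *s y) = exp (- k * Ln (\<phi> y / (1 + z))) * F (\<phi> y *s y)" if "1 + z \<noteq> 0" for z
    proof -
      have "\<phi> (y + z *s y) = \<phi> y / (1 + z)"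
        using that V'm[OF y] by (simp add: \<phi>_def field_simps)
      moreover have "(\<phi> y / (1 + z)) *s (y + z *s y) = \<phi> y *s y"
      proof -
        have "y + z *s y = (1 + z) *s y" by (simp add: vec_eq_iff algebra_simps)
        then show ?thesis
          by (simp only: vector_smult_assoc times_divide_eq_left nonzero_mult_div_cancel_right[OF that])
      qed
      ultimately show ?thesis by (simp add: G_def)
    qed
    have "((\<lambda>z. exp (- k * Ln (\<phi> y / (1 + z))) * F (\<phi> y *s y)) has_field_derivative k * G y) (at 0)"
      by (rule derivative_eq_intros refl | simp add: V'n[OF y])+ (simp add: G_def V'0[OF y])
    then have "((\<lambda>z. G (y + z *s y)) has_field_derivative k * G y) (at 0)"
    proof (rule has_field_derivative_transform_within_open[where S="{z. z \<noteq> -1}"])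
      show "open {z::complex. z \<noteq> - 1}" by (intro open_Collect_neq continuous_intros)
      show "exp (- k * Ln (\<phi> y / (1 + z))) * F (\<phi> y *s y) = G (y + z *s y)" if "z \<in> {z. z \<noteq> - 1}" for z
        using ex[of z] that by (auto simp: add_eq_0_iff)
    qed simp
    with 1 show ?thesis by (rule DERIV_unique)
  qed
  define W' where "W' = cone_Q \<inter> V'"
  have W': "openin (top_of_set cone_Q) W'" unfolding W'_def using oV by auto
  have "restr W' G \<in> O_sec k W'"
    unfolding O_sec_conic[OF conic_cone_Q W']
  proof
    show "restr W' G \<in> hol W'" by (rule hol_restr_holo[OF hG]) (simp add: W'_def)
    show "lie W' (\<lambda>x. x) (restr W' G) = (\<lambda>x. k * restr W' G x)"
    proof
      fix y show "lie W' (\<lambda>x. x) (restr W' G) y = k * restr W' G y"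
      proof (cases "y \<in> W'")
        case True
        then have "y \<in> V'" by (simp add: W'_def)
        then show ?thesis
          using lie_restr_holo[OF lin_field_id_conic[OF conic_cone_Q W'] hG _ True] EG True by (simp add: restr_def)
      qed (simp add: lie_outside restr_def)
    qed
  qed
  moreover have "y \<in> W \<and> restr W' G y = f y" if "y \<in> W' \<inter> cone_X \<mu>" for y
  proof
    have y: "y \<in> V'" "y \<in> cone_X \<mu>" using that by (auto simp: W'_def)
    then have yb: "y \<in> ball x (e/2)" by (simp add: V'_def)
    have inW: "c *s y \<in> W" if "norm (c - 1) < d" for c
    proof -
      have "c \<noteq> 0" using not_nonpos_Reals_near_1[of c] that d by auto
      then show ?thesis using near[OF yb that] e U cone_X_smult[OF _ y(2)] by auto
    qed
    show "y \<in> W" using inW[of 1] d by simp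
    have "f (\<phi> y *s y) = exp (k * Ln (\<phi> y)) * f y"
      by (rule O_sec_homogeneous_near_1[OF conic_cone_X W f d inW V'\<phi>[OF y(1)]])
    moreover have "F (\<phi> y *s y) = f (\<phi> y *s y)"
      using Ff[of "\<phi> y *s y"] inW[OF V'\<phi>[OF y(1)]] V'V[OF y(1)] e by blast
    ultimately show "restr W' G y = f y" using that by (simp add: restr_def G_def exp_minus)
  qed
  moreover have "x \<in> W'" using x U xV cone_X_subset_Q by (auto simp: W'_def)
  ultimately have "ext_Q \<mu> k W f x W' (restr W' G)"
    unfolding ext_Q_def using W' by blast
  then show thesis by (rule that)
qed

lemma ext_Q_shrink:
  assumes e: "ext_Q \<mu> k W f x W' g" and W'': "openin (top_of_set cone_Q) W''" "W'' \<subseteq> W'" "y \<in> W''"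
  shows "ext_Q \<mu> k W f y W'' (restr W'' g)"
proof -
  have W': "openin (top_of_set cone_Q) W'" "g \<in> O_sec k W'" using e by (auto simp: ext_Q_def)
  show ?thesis
    using e W'' O_sec_restr[OF conic_cone_Q W'(1) W''(1,2) W'(2)] by (auto simp: ext_Q_def restr_def)
qed

lemma ext_Q_common:
  assumes "ext_Q \<mu> k W f x W1 g1" "ext_Q \<mu> k' W' f' x W2 g2"
  shows "ext_Q \<mu> k W f x (W1 \<inter> W2) (restr (W1 \<inter> W2) g1)"
    and "ext_Q \<mu> k' W' f' x (W1 \<inter> W2) (restr (W1 \<inter> W2) g2)"
  using assms ext_Q_shrink[OF assms(1), of "W1 \<inter> W2" x] ext_Q_shrink[OF assms(2), of "W1 \<inter> W2" x]
  by (auto simp: ext_Q_def intro: openin_Int)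

lemma ext_Q_point: "ext_Q \<mu> k W f x W' g \<Longrightarrow> y \<in> W' \<Longrightarrow> ext_Q \<mu> k W f y W' g"
  by (auto simp: ext_Q_def)

subsection \<open>The induced operators\<close>

lemma sheaf_op_restr:
  assumes "sheaf_op C k D" "openin (top_of_set C) W" "f \<in> O_sec k W" "openin (top_of_set C) W'" "W' \<subseteq> W"
  shows "D W' (restr W' f) = restr W' (D W f)"
  using assms by (simp add: sheaf_op_def)

lemma sheaf_op_O_sec:
  assumes "sheaf_op C k D" "openin (top_of_set C) W" "f \<in> O_sec k W"
  shows "D W f \<in> O_sec k W"
  using assms by (simp add: sheaf_op_def)

text \<open>The single fields \<open>X i j\<close> do not act on X, so the value is taken from a
  lift, separately at each point; thus only local lifts are required.\<close>

definition Delta_X :: "('n::finite \<Rightarrow> complex) \<Rightarrow> complex \<Rightarrow> 'n \<Rightarrow> 'n operator" where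
  "Delta_X \<mu> k i W f = (\<lambda>x. if x \<in> W then THE d. \<exists>W' g. ext_Q \<mu> k W f x W' g \<and> d = Delta \<mu> i W' g x else 0)"

locale critical_degree =
  fixes \<mu> :: "'n::finite \<Rightarrow> complex" and k :: complex
  assumes inj: "inj \<mu>" and k: "k = - (of_nat CARD('n) - 4) / 2"
begin

text \<open>On a common neighbourhood two lifts differ by a section that vanishes on X, to which
  \<open>Delta_vanish_on_X\<close> applies.\<close>

lemma Delta_ext_unique:
  assumes e: "ext_Q \<mu> k W f x W1 g1" "ext_Q \<mu> k W f x W2 g2" and x: "x \<in> cone_X \<mu>"
  shows "Delta \<mu> i W1 g1 x = Delta \<mu> i W2 g2 x"
proof -
  define W3 where "W3 = W1 \<inter> W2"
  have e3: "ext_Q \<mu> k W f x W3 (restr W3 g1)" "ext_Q \<mu> k W f x W3 (restr W3 g2)"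
    using ext_Q_common[OF e] by (auto simp: W3_def)
  then have W3: "openin (top_of_set cone_Q) W3" "x \<in> W3" by (auto simp: ext_Q_def)
  interpret open_in_Q W3 by unfold_locales (rule W3)
  have s: "restr W3 g1 \<in> O_sec k W3" "restr W3 g2 \<in> O_sec k W3" using e3 by (auto simp: ext_Q_def)
  then have h: "restr W3 g1 \<in> hol W3" "restr W3 g2 \<in> hol W3" by (auto simp: O_sec_iff)
  have "Delta \<mu> i W3 (\<lambda>x. 1 * restr W3 g1 x + (-1) * restr W3 g2 x) x = 0"
  proof (rule Delta_vanish_on_X[OF inj k])
    show "(\<lambda>x. 1 * restr W3 g1 x + (-1) * restr W3 g2 x) \<in> O_sec k W3"
      by (rule O_sec_linear[OF conic_cone_Q W3(1) s])
    show "1 * restr W3 g1 y + (-1) * restr W3 g2 y = 0" if "y \<in> W3 \<inter> cone_X \<mu>" for y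
      using e3 that by (auto simp: ext_Q_def)
  qed (use W3 x in auto)
  then have eq: "Delta \<mu> i W3 (restr W3 g1) x = Delta \<mu> i W3 (restr W3 g2) x"
    unfolding Delta_linear[OF h] by simp
  have "Delta \<mu> i W3 (restr W3 g) x = Delta \<mu> i W' g x"
    if "ext_Q \<mu> k W f x W' g" "W3 \<subseteq> W'" for W' g
  proof -
    have W': "openin (top_of_set cone_Q) W'" using that by (auto simp: ext_Q_def)
    interpret W': open_in_Q W' by unfold_locales (rule W')
    have "g \<in> hol W'" using that W'.O_sec_iff by (auto simp: ext_Q_def)
    then show ?thesis using W'.Delta_restr[OF W3(1) that(2)] W3(2) by (simp add: restr_def)
  qed
  from this[OF e(1)] this[OF e(2)] eq show ?thesis by (simp add: W3_def)
qed

lemma Delta_X_eq: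
  assumes e: "ext_Q \<mu> k W f x W' g" and x: "x \<in> cone_X \<mu>"
  shows "Delta_X \<mu> k i W f x = Delta \<mu> i W' g x"
proof -
  have "x \<in> W" using e x by (auto simp: ext_Q_def)
  moreover have "(THE d. \<exists>W' g. ext_Q \<mu> k W f x W' g \<and> d = Delta \<mu> i W' g x) = Delta \<mu> i W' g x"
    using e Delta_ext_unique[OF _ _ x] by (intro the_equality) blast+
  ultimately show ?thesis by (simp add: Delta_X_def)
qed

lemma Delta_X_outside: "x \<notin> W \<Longrightarrow> Delta_X \<mu> k i W f x = 0"
  by (simp add: Delta_X_def)

text \<open>Lifts go to lifts, so compositions of induced operators, and with them commutativity,
  can be computed on Q.\<close>

lemma ext_Q_Delta:
  assumes e: "ext_Q \<mu> k W f x W' g"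
  shows "ext_Q \<mu> k W (Delta_X \<mu> k i W f) x W' (Delta \<mu> i W' g)"
proof -
  have W': "openin (top_of_set cone_Q) W'" "g \<in> O_sec k W'" using e by (auto simp: ext_Q_def)
  interpret open_in_Q W' by unfold_locales (rule W')
  have "Delta \<mu> i W' g y = Delta_X \<mu> k i W f y" if "y \<in> W' \<inter> cone_X \<mu>" for y
    using Delta_X_eq[OF ext_Q_point[OF e], of y i] that by simp
  then show ?thesis using e Delta_O_sec[OF W'(2)] by (auto simp: ext_Q_def)
qed

lemma O_sec_from_ext:
  assumes W: "openin (top_of_set (cone_X \<mu>)) W" and out: "\<And>x. x \<notin> W \<Longrightarrow> f x = 0"
    and ext: "\<And>x. x \<in> W \<Longrightarrow> \<exists>W' g. ext_Q \<mu> m W f x W' g"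
  shows "f \<in> O_sec m W"
proof (rule O_sec_local[OF conic_cone_X W conic_cone_Q cone_X_subset_Q out])
  fix x assume "x \<in> W"
  then obtain W' g where e: "ext_Q \<mu> m W f x W' g" using ext by blast
  moreover have "W \<subseteq> cone_X \<mu>" using W openin_imp_subset by blast
  ultimately show "\<exists>W' g. openin (top_of_set cone_Q) W' \<and> x \<in> W' \<and> g \<in> O_sec m W' \<and> (\<forall>y\<in>W' \<inter> W. f y = g y)"
    unfolding ext_Q_def by (intro exI[of _ W'] exI[of _ g]) auto
qed

lemma Delta_X_O_sec:
  assumes W: "openin (top_of_set (cone_X \<mu>)) W" and f: "f \<in> O_sec k W"
  shows "Delta_X \<mu> k i W f \<in> O_sec k W"
proof (rule O_sec_from_ext[OF W Delta_X_outside])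
  fix x assume "x \<in> W"
  then obtain W' g where "ext_Q \<mu> k W f x W' g" by (rule ext_Q_exists[OF W f])
  then show "\<exists>W' g. ext_Q \<mu> k W (Delta_X \<mu> k i W f) x W' g" using ext_Q_Delta by blast
qed

lemma Delta_X_linear:
  assumes W: "openin (top_of_set (cone_X \<mu>)) W" and f: "f \<in> O_sec k W" and g: "g \<in> O_sec k W"
  shows "Delta_X \<mu> k i W (\<lambda>x. a * f x + b * g x) = (\<lambda>x. a * Delta_X \<mu> k i W f x + b * Delta_X \<mu> k i W g x)"
proof
  fix x
  show "Delta_X \<mu> k i W (\<lambda>x. a * f x + b * g x) x = a * Delta_X \<mu> k i W f x + b * Delta_X \<mu> k i W g x"
  proof (cases "x \<in> W")
    case x: True
    then have xX: "x \<in> cone_X \<mu>" using W openin_imp_subset by blast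
    obtain W1 f1 W2 g1 where e0: "ext_Q \<mu> k W f x W1 f1" "ext_Q \<mu> k W g x W2 g1"
      using ext_Q_exists[OF W f x] ext_Q_exists[OF W g x] by metis
    then obtain W3 f3 g3 where e: "ext_Q \<mu> k W f x W3 f3" "ext_Q \<mu> k W g x W3 g3"
      using ext_Q_common[OF e0] by blast
    then have W3: "openin (top_of_set cone_Q) W3" "f3 \<in> O_sec k W3" "g3 \<in> O_sec k W3" by (auto simp: ext_Q_def)
    interpret open_in_Q W3 by unfold_locales (rule W3)
    have "ext_Q \<mu> k W (\<lambda>x. a * f x + b * g x) x W3 (\<lambda>x. a * f3 x + b * g3 x)"
      using e O_sec_linear[OF conic_cone_Q W3] by (auto simp: ext_Q_def)
    then show ?thesis
      using Delta_linear W3(2,3) O_sec_iff by (simp add: Delta_X_eq[OF _ xX] Delta_X_eq[OF e(1) xX] Delta_X_eq[OF e(2) xX])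
  qed (simp add: Delta_X_outside)
qed

lemma Delta_X_restr:
  assumes W: "openin (top_of_set (cone_X \<mu>)) W" and f: "f \<in> O_sec k W"
    and W': "openin (top_of_set (cone_X \<mu>)) W'" "W' \<subseteq> W"
  shows "Delta_X \<mu> k i W' (restr W' f) = restr W' (Delta_X \<mu> k i W f)"
proof
  fix x show "Delta_X \<mu> k i W' (restr W' f) x = restr W' (Delta_X \<mu> k i W f) x"
  proof (cases "x \<in> W'")
    case x: True
    then have xX: "x \<in> cone_X \<mu>" using W' openin_imp_subset by blast
    obtain U where U: "open U" "W' = cone_X \<mu> \<inter> U" using W'(1) by (auto simp: openin_open)
    obtain W1 g1 where e: "ext_Q \<mu> k W f x W1 g1" using ext_Q_exists[OF W f] x W'(2) by blast
    define W2 where "W2 = W1 \<inter> U"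
    have "openin (top_of_set cone_Q) W2" "x \<in> W2"
      using e U x openin_Int_sub[of cone_Q W1 U] by (auto simp: W2_def ext_Q_def)
    then have e2: "ext_Q \<mu> k W f x W2 (restr W2 g1)"
      by (intro ext_Q_shrink[OF e]) (auto simp: W2_def)
    then have "ext_Q \<mu> k W' (restr W' f) x W2 (restr W2 g1)"
      using U by (auto simp: ext_Q_def W2_def restr_def)
    then show ?thesis using Delta_X_eq[OF e2 xX] Delta_X_eq[OF _ xX] x by (simp add: restr_def)
  qed (simp add: Delta_X_outside restr_def)
qed

lemma Delta_X_commute:
  assumes W: "openin (top_of_set (cone_X \<mu>)) W" and f: "f \<in> O_sec k W"
  shows "Delta_X \<mu> k i W (Delta_X \<mu> k j W f) = Delta_X \<mu> k j W (Delta_X \<mu> k i W f)"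
proof
  fix x show "Delta_X \<mu> k i W (Delta_X \<mu> k j W f) x = Delta_X \<mu> k j W (Delta_X \<mu> k i W f) x"
  proof (cases "x \<in> W")
    case x: True
    then have xX: "x \<in> cone_X \<mu>" using W openin_imp_subset by blast
    obtain W1 g where e: "ext_Q \<mu> k W f x W1 g" using ext_Q_exists[OF W f] x by blast
    then have W1: "openin (top_of_set cone_Q) W1" "g \<in> O_sec k W1" by (auto simp: ext_Q_def)
    interpret open_in_Q W1 by unfold_locales (rule W1)
    show ?thesis
      unfolding Delta_X_eq[OF ext_Q_Delta[OF e] xX]
      using Delta_commute[OF _ inj] W1(2) O_sec_iff by simp
  qed (simp add: Delta_X_outside)
qed

text \<open>A pointwise relation that is stable under commutators with a function and its lift;
  through it the vanishing of threefold commutators passes from Q to X.\<close>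

definition compat :: "(complex^'n) set \<Rightarrow> complex^'n \<Rightarrow> (complex^'n) set \<Rightarrow> 'n operator \<Rightarrow> 'n operator \<Rightarrow> bool" where
  "compat W x W' D P \<longleftrightarrow> (\<forall>f g. ext_Q \<mu> k W f x W' g \<longrightarrow> D W f x = P W' g x)"

lemma ext_Q_mult:
  assumes "ext_Q \<mu> 0 W h x W' h'" "ext_Q \<mu> k W f x W' g"
  shows "ext_Q \<mu> k W (\<lambda>x. h x * f x) x W' (\<lambda>x. h' x * g x)"
  using assms O_sec_mult[OF conic_cone_Q, of W' h' 0 g k] by (auto simp: ext_Q_def)

lemma compat_commutator:
  assumes "compat W x W' D P" "ext_Q \<mu> 0 W h x W' h'" "x \<in> cone_X \<mu>"
  shows "compat W x W' (commutator_fun h D) (commutator_fun h' P)"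
proof -
  have "h x = h' x" using assms(2,3) by (auto simp: ext_Q_def)
  then show ?thesis
    using assms(1) ext_Q_mult[OF assms(2)] unfolding compat_def commutator_fun_def by simp
qed

lemma diff_op_Delta_X: "diff_op 2 (cone_X \<mu>) k (Delta_X \<mu> k i)"
  unfolding diff_op_def sheaf_op_def
proof (intro conjI allI impI ballI)
  fix W :: "(complex^'n) set" assume W: "openin (top_of_set (cone_X \<mu>)) W"
  show "Delta_X \<mu> k i W f \<in> O_sec k W" if "f \<in> O_sec k W" for f by (rule Delta_X_O_sec[OF W that])
  show "Delta_X \<mu> k i W (\<lambda>x. a * f x + b * g x) = (\<lambda>x. a * Delta_X \<mu> k i W f x + b * Delta_X \<mu> k i W g x)"
    if "f \<in> O_sec k W" "g \<in> O_sec k W" for f g a b by (rule Delta_X_linear[OF W that])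
  show "Delta_X \<mu> k i W' (restr W' f) = restr W' (Delta_X \<mu> k i W f)"
    if "f \<in> O_sec k W" "openin (top_of_set (cone_X \<mu>)) W' \<and> W' \<subseteq> W" for f W'
    using Delta_X_restr[OF W] that by blast
  show "foldr commutator_fun gs (Delta_X \<mu> k i) W f = (\<lambda>x. 0)"
    if gs: "length gs = 2 + 1 \<and> set gs \<subseteq> O_sec 0 W" and f: "f \<in> O_sec k W" for gs f
  proof
    fix x
    obtain g1 g2 g3 where g: "gs = [g1, g2, g3]" "g1 \<in> O_sec 0 W" "g2 \<in> O_sec 0 W" "g3 \<in> O_sec 0 W"
      using gs by (auto simp: length_Suc_conv numeral_3_eq_3)
    show "foldr commutator_fun gs (Delta_X \<mu> k i) W f x = 0"
    proof (cases "x \<in> W")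
      case x: True
      then have xX: "x \<in> cone_X \<mu>" using W openin_imp_subset by blast
      obtain W1 h1 W2 h2 W3 h3 W4 h where e0: "ext_Q \<mu> 0 W g1 x W1 h1" "ext_Q \<mu> 0 W g2 x W2 h2"
        "ext_Q \<mu> 0 W g3 x W3 h3" "ext_Q \<mu> k W f x W4 h"
        using ext_Q_exists[OF W _ x] g(2-4) f by metis
      \<comment> \<open>All lifts are brought to one neighbourhood, since \<open>compat\<close>
        refers to a fixed \<open>W'\<close>.\<close>
      define W' where "W' = W1 \<inter> W2 \<inter> W3 \<inter> W4"
      have W': "openin (top_of_set cone_Q) W'" "x \<in> W'"
        using e0 unfolding ext_Q_def W'_def by (blast intro: openin_Int)+
      have sub: "W' \<subseteq> W1" "W' \<subseteq> W2" "W' \<subseteq> W3" "W' \<subseteq> W4" by (auto simp: W'_def)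
      obtain h1 h2 h3 h where e: "ext_Q \<mu> 0 W g1 x W' h1" "ext_Q \<mu> 0 W g2 x W' h2"
        "ext_Q \<mu> 0 W g3 x W' h3" "ext_Q \<mu> k W f x W' h"
        using e0[THEN ext_Q_shrink, OF W'(1) _ W'(2)] sub by blast
      interpret open_in_Q W' by unfold_locales (rule W')
      have "compat W x W' (Delta_X \<mu> k i) (Delta \<mu> i)"
        unfolding compat_def using Delta_X_eq[OF _ xX] by blast
      then have "compat W x W' (commutator_fun g1 (commutator_fun g2 (commutator_fun g3 (Delta_X \<mu> k i))))
          (commutator_fun h1 (commutator_fun h2 (commutator_fun h3 (Delta \<mu> i))))"
        using compat_commutator[OF _ _ xX] e by blast
      then have "foldr commutator_fun gs (Delta_X \<mu> k i) W f x
          = commutator_fun h1 (commutator_fun h2 (commutator_fun h3 (Delta \<mu> i))) W' h x"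
        using e(4) g(1) unfolding compat_def by simp
      also have "\<dots> = 0"
        using commutator3_Delta[of h h1 h2 h3] e O_sec_iff by (simp add: ext_Q_def)
      finally show ?thesis .
    next
      case False
      have "g x = 0" if "g \<in> O_sec m W" for g m using that False by (simp add: O_sec_def)
      then show ?thesis using g(2-4) False by (simp add: g(1) commutator_fun_def Delta_X_outside)
    qed
  qed
qed

lemma ext_Q_restr:
  assumes W: "openin (top_of_set cone_Q) W" and f: "f \<in> O_sec k W" and x: "x \<in> W \<inter> cone_X \<mu>"
  shows "ext_Q \<mu> k (W \<inter> cone_X \<mu>) (restr (W \<inter> cone_X \<mu>) f) x W f"
  using assms by (auto simp: ext_Q_def restr_def)

lemma induces_Delta_X: "induces_on_X \<mu> k (Delta \<mu> i) (Delta_X \<mu> k i)"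
  unfolding induces_on_X_def
proof (intro allI impI ballI ext)
  fix W :: "(complex^'n) set" and f x assume W: "openin (top_of_set cone_Q) W" and f: "f \<in> O_sec k W"
  show "Delta_X \<mu> k i (W \<inter> cone_X \<mu>) (restr (W \<inter> cone_X \<mu>) f) x = restr (W \<inter> cone_X \<mu>) (Delta \<mu> i W f) x"
    using Delta_X_eq[OF ext_Q_restr[OF W f]] by (cases "x \<in> W \<inter> cone_X \<mu>") (auto simp: restr_def Delta_X_outside)
qed

text \<open>A map compatible with restriction is determined on small open sets, and there every
  section comes from Q, where the value is prescribed.\<close>

lemma Delta_X_unique:
  assumes D: "sheaf_op (cone_X \<mu>) k D" and ind: "induces_on_X \<mu> k (Delta \<mu> i) D"
  shows "ops_agree (cone_X \<mu>) k D (Delta_X \<mu> k i)"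
  unfolding ops_agree_def
proof (intro allI impI ballI ext)
  fix W :: "(complex^'n) set" and f x assume WX: "openin (top_of_set (cone_X \<mu>)) W" and f: "f \<in> O_sec k W"
  show "D W f x = Delta_X \<mu> k i W f x"
  proof (cases "x \<in> W")
    case x: True
    then have xX: "x \<in> cone_X \<mu>" using WX openin_imp_subset by blast
    obtain W1 g where e: "ext_Q \<mu> k W f x W1 g" using ext_Q_exists[OF WX f] x by blast
    then have W1: "openin (top_of_set cone_Q) W1" "g \<in> O_sec k W1" "x \<in> W1" by (auto simp: ext_Q_def)
    interpret open_in_Q W1 by unfold_locales (rule W1)
    define W2 where "W2 = W1 \<inter> cone_X \<mu>"
    have W2: "openin (top_of_set (cone_X \<mu>)) W2" "W2 \<subseteq> W" "x \<in> W2"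
      using e xX openin_X[of \<mu>] by (auto simp: W2_def ext_Q_def)
    have "restr W2 f = restr W2 g" using e by (auto simp: restr_def fun_eq_iff W2_def ext_Q_def)
    moreover have "D W2 (restr W2 f) = restr W2 (D W f)" 
      by (rule sheaf_op_restr[OF D WX f W2(1,2)])
    moreover have "D W2 (restr W2 g) = restr W2 (Delta \<mu> i W1 g)"
      using ind W1 unfolding induces_on_X_def W2_def by blast
    ultimately have "restr W2 (D W f) x = restr W2 (Delta \<mu> i W1 g) x" by simp
    then show ?thesis using Delta_X_eq[OF e xX] W2 by (simp add: restr_def)
  next
    case False
    have "D W f \<in> O_sec k W" by (rule sheaf_op_O_sec[OF D WX f])
    then show ?thesis using False by (simp add: O_sec_def Delta_X_outside)
  qed
qed

lemma divisible_q1_Delta: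
  assumes W: "openin (top_of_set cone_Q) W" and d: "divisible_q1 \<mu> k W f"
  shows "divisible_q1 \<mu> k W (Delta \<mu> i W f)"
proof -
  interpret open_in_Q W by unfold_locales (rule W)
  obtain g where g: "g \<in> O_sec (k - 2) W" "f = (\<lambda>x. g x * q1 \<mu> x)" using d by (auto simp: divisible_q1_def)
  then show ?thesis
    unfolding divisible_q1_def using Delta_q1[OF inj g(1) k] Delta_O_sec[OF g(1)] by blast
qed

lemma ops_commute_Delta: "ops_commute cone_Q k (Delta \<mu> i) (Delta \<mu> j)"
  unfolding ops_commute_def
proof (intro allI impI ballI)
  fix W :: "(complex^'n) set" and f assume W: "openin (top_of_set cone_Q) W" and f: "f \<in> O_sec k W"
  interpret open_in_Q W by unfold_locales (rule W)
  show "Delta \<mu> i W (Delta \<mu> j W f) = Delta \<mu> j W (Delta \<mu> i W f)"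
    using Delta_commute[OF _ inj] f O_sec_iff by blast
qed

lemma ops_commute_Delta_X: "ops_commute (cone_X \<mu>) k (Delta_X \<mu> k i) (Delta_X \<mu> k j)"
  unfolding ops_commute_def using Delta_X_commute by blast

end

section \<open>The canonical bundle\<close>

subsection \<open>Determinants of lists of vectors\<close>

text \<open>Matrix rows are indexed by the type \<open>'n\<close>, whereas forms take lists. Another
  numbering would change \<open>det_list\<close> on lists of length \<open>CARD('n)\<close> by a
  sign only.\<close>

definition row_index :: "'n::finite \<Rightarrow> nat" where
  "row_index = (SOME f. bij_betw f UNIV {..<CARD('n)})"

lemma bij_row_index: "bij_betw (row_index :: 'n::finite \<Rightarrow> nat) UNIV {..<CARD('n)}"
proof -
  have "\<exists>h. bij_betw h (UNIV :: 'n set) {..<CARD('n)}"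
    using ex_bij_betw_finite_nat[of "UNIV :: 'n set"] by (simp add: atLeast0LessThan)
  then show ?thesis unfolding row_index_def by (rule someI_ex)
qed

definition det_list :: "(complex^'n) list \<Rightarrow> complex" where
  "det_list vs = det (\<chi> a. vs ! row_index a)"

lemma row_index_less: "row_index (a::'n::finite) < CARD('n)"
  using bij_row_index bij_betwE by blast

lemma row_index_inj: "row_index a = row_index b \<longleftrightarrow> a = b"
  using bij_row_index bij_betw_imp_inj_on inj_eq by metis

lemma row_index_surj: "m < CARD('n) \<Longrightarrow> \<exists>a::'n::finite. row_index a = m"
  using bij_row_index[where 'n='n] unfolding bij_betw_def by (metis imageE lessThan_iff)

lemma det_list_update_linear:
  fixes vs :: "(complex^'n) list"
  assumes "length vs = CARD('n)" "m < CARD('n)"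
  shows "det_list (vs[m := a *s v + b *s w]) = a * det_list (vs[m := v]) + b * det_list (vs[m := w])"
proof -
  obtain k :: 'n where k: "row_index k = m" using row_index_surj assms(2) by blast
  have e: "det_list (vs[m := u]) = det (\<chi> i. if i = k then u else vs ! row_index i)" for u
    unfolding det_list_def
    by (intro arg_cong[of _ _ det] Cart_lambda_cong)
       (use assms k in \<open>auto simp: nth_list_update row_index_inj row_index_less\<close>)
  show ?thesis
    unfolding e using det_row_add[of k "\<lambda>_. a *s v" "\<lambda>_. b *s w"] det_row_mul[of k a "\<lambda>_. v"] det_row_mul[of k b "\<lambda>_. w"]
    by simp
qed

lemma det_list_equal_rows:
  fixes vs :: "(complex^'n) list"
  assumes "m < CARD('n)" "m' < CARD('n)" "m \<noteq> m'" "vs ! m = vs ! m'"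
  shows "det_list vs = 0"
proof -
  obtain a b :: 'n where ab: "row_index a = m" "row_index b = m'" using row_index_surj assms(1,2) by metis
  then have "a \<noteq> b" using assms(3) by auto
  moreover have "row a (\<chi> a. vs ! row_index a) = row b (\<chi> a. vs ! row_index a)"
    using ab assms(4) by (simp add: row_def vec_eq_iff)
  ultimately show ?thesis unfolding det_list_def by (rule det_identical_rows)
qed

text \<open>Phrased with a common annihilator \<open>z\<close>: vanishing is later shown by a
  combination of gradients, nonvanishing by eliminating the coordinates of \<open>z\<close>.\<close>

lemma det_list_eq_0_iff:
  fixes vs :: "(complex^'n) list"
  assumes "length vs = CARD('n)"
  shows "det_list vs = 0 \<longleftrightarrow> (\<exists>z. z \<noteq> 0 \<and> (\<forall>v\<in>set vs. (\<Sum>l\<in>UNIV. v $ l * z $ l) = 0))"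
proof -
  define A :: "complex^'n^'n" where "A = (\<chi> a. vs ! row_index a)"
  have "A *v z = 0 \<longleftrightarrow> (\<forall>v\<in>set vs. (\<Sum>l\<in>UNIV. v $ l * z $ l) = 0)" for z
  proof -
    have "A *v z = 0 \<longleftrightarrow> (\<forall>a. (\<Sum>l\<in>UNIV. (vs ! row_index (a::'n)) $ l * z $ l) = 0)"
      by (simp add: A_def matrix_vector_mult_def vec_eq_iff)
    also have "\<dots> \<longleftrightarrow> (\<forall>m<length vs. (\<Sum>l\<in>UNIV. (vs ! m) $ l * z $ l) = 0)"
      using row_index_surj row_index_less assms by metis
    finally show ?thesis by (simp add: all_set_conv_all_nth)
  qed
  moreover have "det A \<noteq> 0 \<longleftrightarrow> (\<forall>z. A *v z = 0 \<longrightarrow> z = 0)"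
    by (metis invertible_det_nz invertible_left_inverse matrix_left_invertible_ker)
  ultimately show ?thesis unfolding det_list_def A_def by blast
qed

lemma det_list_scale:
  fixes vs :: "(complex^'n) list"
  assumes "length us + length vs = CARD('n)"
  shows "det_list (map ((*s) c) us @ vs) = c ^ length us * det_list (us @ vs)"
proof -
  define e where "e = (\<lambda>m. if m < length us then c else 1)"
  have "det_list (map ((*s) c) us @ vs) = det (\<chi> a::'n. e (row_index a) *s ((us @ vs) ! row_index a))"
    unfolding det_list_def
    by (intro arg_cong[of _ _ det] Cart_lambda_cong) (auto simp: nth_append e_def)
  also have "\<dots> = prod (\<lambda>a::'n. e (row_index a)) UNIV * det_list (us @ vs)"
    unfolding det_list_def by (rule det_rows_mul)
  also have "prod (\<lambda>a::'n. e (row_index a)) UNIV = prod e {..<CARD('n)}"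
    using prod.reindex_bij_betw[OF bij_row_index[where 'n='n]] .
  also have "\<dots> = prod e {..<length us}"
    by (rule prod.mono_neutral_right) (use assms in \<open>auto simp: e_def\<close>)
  also have "\<dots> = c ^ length us" by (simp add: e_def)
  finally show ?thesis .
qed

lemma holo_det_list:
  fixes R :: "complex^'n \<Rightarrow> (complex^'n) list"
  assumes "open V" "\<And>m l. m < CARD('n) \<Longrightarrow> holo V (\<lambda>y. (R y ! m) $ l)"
  shows "holo V (\<lambda>y. det_list (R y))"
  unfolding det_list_def det_def vec_lambda_beta
  by (intro holo_sum holo_mult holo_const holo_prod assms row_index_less)

subsection \<open>Alternating forms\<close>

lemma alternating_formD:
  assumes "alternating_form T p \<phi>" "length vs = p" "set vs \<subseteq> T"
  shows "i < p \<Longrightarrow> v \<in> T \<Longrightarrow> w \<in> T \<Longrightarrow> \<phi> (vs[i := a *s v + b *s w]) = a * \<phi> (vs[i := v]) + b * \<phi> (vs[i := w])"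
    and "i < p \<Longrightarrow> j < p \<Longrightarrow> i \<noteq> j \<Longrightarrow> vs ! i = vs ! j \<Longrightarrow> \<phi> vs = 0"
proof -
  show "i < p \<Longrightarrow> v \<in> T \<Longrightarrow> w \<in> T \<Longrightarrow> \<phi> (vs[i := a *s v + b *s w]) = a * \<phi> (vs[i := v]) + b * \<phi> (vs[i := w])"
    using assms unfolding alternating_form_def by blast
  show "i < p \<Longrightarrow> j < p \<Longrightarrow> i \<noteq> j \<Longrightarrow> vs ! i = vs ! j \<Longrightarrow> \<phi> vs = 0"
    using assms unfolding alternating_form_def by (metis linorder_neqE_nat)
qed

definition lin_closed :: "(complex^'n) set \<Rightarrow> bool" where
  "lin_closed T \<longleftrightarrow> 0 \<in> T \<and> (\<forall>v\<in>T. \<forall>w\<in>T. \<forall>a b. a *s v + b *s w \<in> T)"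

lemma lin_closed_sum:
  assumes "lin_closed T" "\<And>m. m \<in> M \<Longrightarrow> u m \<in> T"
  shows "(\<Sum>m\<in>M. a m *s u m) \<in> T"
  using assms(2)
proof (induction M rule: infinite_finite_induct)
  case (insert m M)
  have "a m *s u m + 1 *s (\<Sum>m\<in>M. a m *s u m) \<in> T"
    using insert assms(1) unfolding lin_closed_def by blast
  then show ?case using insert by simp
qed (use assms(1) in \<open>auto simp: lin_closed_def\<close>)

lemma set_update_subset: "set vs \<subseteq> T \<Longrightarrow> v \<in> T \<Longrightarrow> set (vs[i := v]) \<subseteq> T"
  using set_update_subset_insert by fastforce

lemma alternating_form_sum:
  assumes \<phi>: "alternating_form T p \<phi>" and T: "lin_closed T" and vs: "length vs = p" "set vs \<subseteq> T" and i: "i < p"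
    and u: "\<And>m. m \<in> M \<Longrightarrow> u m \<in> T"
  shows "\<phi> (vs[i := \<Sum>m\<in>M. a m *s u m]) = (\<Sum>m\<in>M. a m * \<phi> (vs[i := u m]))"
proof -
  have T0: "0 \<in> T" using T by (simp add: lin_closed_def)
  have z: "\<phi> (vs[i := 0]) = 0"
    using alternating_formD(1)[OF \<phi> vs i T0 T0, of 0 0] by simp
  show ?thesis using u
  proof (induction M rule: infinite_finite_induct)
    case (insert m M)
    have "(\<Sum>m\<in>M. a m *s u m) \<in> T" by (rule lin_closed_sum[OF T]) (use insert in auto)
    then show ?case
      using alternating_formD(1)[OF \<phi> vs i, of "u m" "\<Sum>m\<in>M. a m *s u m" "a m" 1] insert by simp
  qed (auto simp: z)
qed

lemma alternating_form_swap:
  assumes \<phi>: "alternating_form T p \<phi>" and T: "lin_closed T" and vs: "length vs = p" "set vs \<subseteq> T"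
    and ab: "a < p" "b < p" "a \<noteq> b"
  shows "\<phi> (vs[a := vs ! b, b := vs ! a]) = - \<phi> vs"
proof -
  define u w where "u = vs ! a" and "w = vs ! b"
  have uw: "u \<in> T" "w \<in> T" using vs ab by (auto simp: u_def w_def)
  then have uwT: "1 *s u + 1 *s w \<in> T" using T unfolding lin_closed_def by blast
  have l: "\<phi> (us[c := 1 *s u + 1 *s w]) = \<phi> (us[c := u]) + \<phi> (us[c := w])"
    if "c < p" "length us = p" "set us \<subseteq> T" for us c
    using alternating_formD(1)[OF \<phi> that(2,3,1) uw, of 1 1] by simp
  have eq: "\<phi> (vs[a := s, b := s]) = 0" if "s \<in> T" for s
    using alternating_formD(2)[OF \<phi> _ set_update_subset[OF set_update_subset[OF vs(2) that] that] ab, of a b] vs(1) ab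
    by simp
  have sub: "set (vs[a := s]) \<subseteq> T" "set (vs[b := s]) \<subseteq> T" if "s \<in> T" for s
    by (rule set_update_subset[OF vs(2) that])+
  have "0 = \<phi> (vs[a := 1 *s u + 1 *s w, b := 1 *s u + 1 *s w])" using eq[OF uwT] by simp
  also have "\<dots> = \<phi> ((vs[a := 1 *s u + 1 *s w])[b := u]) + \<phi> ((vs[a := 1 *s u + 1 *s w])[b := w])"
    by (rule l) (use ab vs sub[OF uwT] in auto)
  also have "\<dots> = \<phi> ((vs[b := u])[a := 1 *s u + 1 *s w]) + \<phi> ((vs[b := w])[a := 1 *s u + 1 *s w])"
    using ab by (simp add: list_update_swap)
  also have "\<dots> = \<phi> (vs[b := u, a := u]) + \<phi> (vs[b := u, a := w]) + (\<phi> (vs[b := w, a := u]) + \<phi> (vs[b := w, a := w]))"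
    using l[OF ab(1), of "vs[b := u]"] l[OF ab(1), of "vs[b := w]"] vs sub uw by simp
  also have "\<dots> = \<phi> (vs[a := w, b := u]) + \<phi> vs"
    using eq[OF uw(1)] eq[OF uw(2)] ab by (simp add: list_update_swap[OF ab(3), symmetric]) (simp add: u_def w_def list_update_swap[OF ab(3)])
  finally show ?thesis by (simp add: u_def w_def eq_neg_iff_add_eq_0)
qed

text \<open>Transpositions only change the sign, to which vanishing is insensitive.\<close>

lemma alternating_form_permute:
  assumes \<phi>: "alternating_form T p \<phi>" and T: "lin_closed T" and vs: "length vs = p" "set vs \<subseteq> T"
    and 0: "\<phi> vs = 0" and \<pi>: "\<pi> permutes {..<p}"
  shows "\<phi> (permute_list \<pi> vs) = 0"
  using finite_lessThan \<pi>
proof (induction rule: permutes_rev_induct)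
  case id
  then show ?case using 0 by simp
next
  case (swap a b \<pi>)
  define us where "us = permute_list \<pi> vs"
  have us: "length us = p" "set us \<subseteq> T" using vs swap by (simp_all add: us_def)
  have tr: "Transposition.transpose a b permutes {..<length vs}"
    using swap(1,2) vs(1) by (simp add: permutes_swap_id)
  have "permute_list (\<pi> \<circ> Transposition.transpose a b) vs = permute_list (Transposition.transpose a b) us"
    unfolding us_def by (rule permute_list_compose[OF tr])
  also have "\<dots> = us[a := us ! b, b := us ! a]"
    by (rule nth_equalityI)
       (use swap us in \<open>auto simp: permute_list_def nth_list_update Transposition.transpose_def\<close>)
  finally have e: "permute_list (\<pi> \<circ> Transposition.transpose a b) vs = us[a := us ! b, b := us ! a]" .
  show ?case
    unfolding e using alternating_form_swap[OF \<phi> T us, of a b] swap by (simp add: us_def)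
qed

text \<open>Multilinear expansion reduces to lists from the spanning set; such a list contains
  \<open>x\<close>, has a repetition, or is a permutation of \<open>bs\<close>.\<close>

lemma alternating_form_eq_0:
  assumes \<phi>: "alternating_form T p \<phi>" and T: "lin_closed T" and bs: "length bs = p" "set bs \<subseteq> T" and x: "x \<in> T"
    and \<phi>x: "\<And>vs. length vs = p \<Longrightarrow> set vs \<subseteq> T \<Longrightarrow> x \<in> set vs \<Longrightarrow> \<phi> vs = 0"
    and span: "\<And>v. v \<in> T \<Longrightarrow> \<exists>a. v = (\<Sum>b\<in>insert x (set bs). a b *s b)"
    and 0: "\<phi> bs = 0" and vs: "length vs = p" "set vs \<subseteq> T"
  shows "\<phi> vs = 0"
proof -
  define B where "B = insert x (set bs)"
  have B: "B \<subseteq> T" "finite B" using bs x by (auto simp: B_def)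
  have base: "\<phi> us = 0" if us: "length us = p" "set us \<subseteq> B" for us
  proof -
    have usT: "set us \<subseteq> T" using us B by blast
    consider "x \<in> set us" | "\<not> distinct us" | "distinct us" "set us \<subseteq> set bs"
      using us by (auto simp: B_def)
    then show ?thesis
    proof cases
      case 1
      then show ?thesis using \<phi>x us usT by blast
    next
      case 2
      then obtain i j where "i < p" "j < p" "i \<noteq> j" "us ! i = us ! j"
        using us(1) by (auto simp: distinct_conv_nth)
      then show ?thesis using alternating_formD(2)[OF \<phi> us(1) usT] by blast
    next
      case 3
      \<comment> \<open>\<open>us\<close> has \<open>p\<close> distinct entries, all from a list
        with \<open>p\<close> places, so \<open>bs\<close> has no repetitions and is a permutation
        of \<open>us\<close>.\<close>
      have "card (set us) = p" using 3(1) us(1) by (simp add: distinct_card)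
      then have us_bs: "set us = set bs"
        using card_seteq[OF _ 3(2)] card_length[of bs] bs(1) by simp
      then have "distinct bs" using \<open>card (set us) = p\<close> bs(1) by (simp add: card_distinct)
      then have "mset us = mset bs" using 3(1) us_bs by (simp add: set_eq_iff_mset_eq_distinct)
      then obtain \<pi> where "\<pi> permutes {..<length bs}" "permute_list \<pi> bs = us" by (rule mset_eq_permutation)
      then show ?thesis using alternating_form_permute[OF \<phi> T bs 0] bs(1) by blast
    qed
  qed
  \<comment> \<open>Induction on the number \<open>n\<close> of leading entries that are arbitrary
    tangent vectors; the later ones already lie in \<open>B\<close>.\<close>
  have "n \<le> p \<Longrightarrow> \<phi> us = 0" if "length us = p" "set us \<subseteq> T" "set (drop n us) \<subseteq> B" for n us
    using that
  proof (induction n arbitrary: us)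
    case 0
    then show ?case using base by simp
  next
    case (Suc n)
    have n: "n < p" using Suc.prems by simp
    then have "us ! n \<in> T" using Suc.prems by (metis nth_mem subsetD)
    then obtain a where a: "us ! n = (\<Sum>b\<in>B. a b *s b)" using span unfolding B_def by blast
    have "\<phi> (us[n := \<Sum>b\<in>B. a b *s b]) = (\<Sum>b\<in>B. a b * \<phi> (us[n := b]))"
      by (rule alternating_form_sum[OF \<phi> T Suc.prems(2,3) n]) (use B in blast)
    also have "\<dots> = 0"
    proof (intro sum.neutral ballI)
      fix b assume b: "b \<in> B"
      have "set (us[n := b]) \<subseteq> T" using set_update_subset[OF Suc.prems(3), of b n] b B by blast
      moreover have "drop n (us[n := b]) = b # drop (Suc n) us"
        using n Suc.prems by (simp add: drop_update_cancel Cons_nth_drop_Suc[symmetric])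
      ultimately have "\<phi> (us[n := b]) = 0" using Suc.IH[of "us[n := b]"] Suc.prems b n by simp
      then show "a b * \<phi> (us[n := b]) = 0" by simp
    qed
    finally show ?case unfolding a[symmetric] by simp
  qed
  from this[of vs p] show ?thesis using vs by simp
qed

lemma alternating_form_linear:
  assumes "alternating_form T p \<phi>" "alternating_form T p \<psi>"
  shows "alternating_form T p (\<lambda>vs. a * \<phi> vs + b * \<psi> vs)"
  using assms unfolding alternating_form_def by (simp add: algebra_simps)

lemma alternating_form_subset: "alternating_form UNIV p \<phi> \<Longrightarrow> alternating_form T p \<phi>"
  unfolding alternating_form_def by blast

text \<open>The arguments are made variable one at a time: expanding the next one in coordinate
  vectors gives holomorphic coefficients times values in which that argument is constant.\<close>

lemma holo_form_varying:
  fixes \<Omega> :: "'n::finite form"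
  assumes V: "open V" and \<Omega>: "\<And>vs. length vs = p \<Longrightarrow> holo V (\<lambda>y. \<Omega> y vs)"
    and alt: "\<And>y. y \<in> V \<Longrightarrow> alternating_form UNIV p (\<Omega> y)"
    and b: "\<And>l i. l \<in> set ls \<Longrightarrow> holo V (\<lambda>y. b l y $ i)" and ls: "length ls = p"
  shows "holo V (\<lambda>y. \<Omega> y (map (\<lambda>l. b l y) ls))"
proof -
  have "n \<le> p \<Longrightarrow> holo V (\<lambda>y. \<Omega> y (map (\<lambda>l. b l y) (take n ls) @ drop n us))" if "length us = p" for n us
    using that
  proof (induction n arbitrary: us)
    case 0
    then show ?case using \<Omega> by simp
  next
    case (Suc n)
    have n: "n < p" using Suc.prems by simp
    define A where "A = (\<lambda>y us. map (\<lambda>l. b l y) (take n ls) @ drop n us)"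
    have A: "length (A y us) = p" if "length us = p" for y us using n ls that by (simp add: A_def)
    have up: "(A y us)[n := v] = A y (us[n := v])" if "length us = p" for y us v
      using n ls that by (simp add: A_def list_update_append drop_update_swap min_def)
    have e: "map (\<lambda>l. b l y) (take (Suc n) ls) @ drop (Suc n) us = (A y us)[n := b (ls ! n) y]" for y
      using n ls Suc.prems
      by (simp add: A_def list_update_append take_Suc_conv_app_nth min_def Cons_nth_drop_Suc[symmetric, of n us])
    have "lin_closed UNIV" by (simp add: lin_closed_def)
    then have "\<Omega> y ((A y us)[n := b (ls ! n) y]) = (\<Sum>i\<in>UNIV. b (ls ! n) y $ i * \<Omega> y (A y (us[n := axis i 1])))"
      if "y \<in> V" for y
      using alternating_form_sum[OF alt[OF that] _ A[OF Suc.prems(2)] _ n, where M=UNIV and u="\<lambda>i. axis i 1" and a="\<lambda>i. b (ls ! n) y $ i"]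
      by (simp add: vec_expand_axis[symmetric] up Suc.prems)
    moreover have "holo V (\<lambda>y. \<Sum>i\<in>UNIV. b (ls ! n) y $ i * \<Omega> y (A y (us[n := axis i 1])))"
    proof (intro holo_sum holo_mult V)
      show "holo V (\<lambda>y. b (ls ! n) y $ i)" for i using b n ls by simp
      show "holo V (\<lambda>y. \<Omega> y (A y (us[n := axis i 1])))" for i
        using Suc.IH[of "us[n := axis i 1]"] Suc.prems n by (simp add: A_def)
    qed
    ultimately show ?case unfolding e using holo_transform by fastforce
  qed
  from this[of "replicate p 0" p] show ?thesis using ls by simp
qed

subsection \<open>The tangent spaces of the cone over \<open>X\<close>\<close>

definition bil :: "('n::finite \<Rightarrow> complex) \<Rightarrow> complex^'n \<Rightarrow> complex^'n \<Rightarrow> complex" where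
  "bil c x v = (\<Sum>l\<in>UNIV. c l * (x $ l * v $ l))"

lemma bil_linear: "bil c x (a *s v + b *s w) = a * bil c x v + b * bil c x w"
  by (simp add: bil_def sum.distrib sum_distrib_left algebra_simps)

lemma bil_add: "bil c x (v + w) = bil c x v + bil c x w"
  and bil_diff: "bil c x (v - w) = bil c x v - bil c x w"
  and bil_smult: "bil c x (a *s v) = a * bil c x v"
  and bil_zero: "bil c x 0 = 0"
  by (simp_all add: bil_def sum.distrib sum_subtractf sum_distrib_left algebra_simps)

lemma bil_axis: "bil c x (axis i 1) = c i * x $ i"
proof -
  have "bil c x (axis i 1) = (\<Sum>l\<in>UNIV. if l = i then c i * x $ i else 0)"
    unfolding bil_def by (rule sum.cong) (auto simp: axis_def)
  then show ?thesis by simp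
qed

lemma q0_bil: "q0 x = bil (\<lambda>_. 1) x x" and q1_bil: "q1 \<mu> x = bil \<mu> x x"
  by (simp_all add: q0_def q1_def bil_def power2_eq_square)

lemma bil_deriv: "((\<lambda>x. bil c x x) has_derivative (\<lambda>v. 2 * bil c x v)) (at x)"
proof -
  have "((\<lambda>x. bil c x x) has_derivative (\<lambda>v. \<Sum>l\<in>UNIV. c l * (x $ l * v $ l + v $ l * x $ l))) (at x)"
    unfolding bil_def by (intro has_derivative_sum has_derivative_mult_right has_derivative_mult has_derivative_nth)
  then show ?thesis
    by (rule has_derivative_eq_rhs) (simp add: bil_def sum_distrib_left fun_eq_iff algebra_simps)
qed

lemma tangent_cone_X_iff: "v \<in> tangent_cone_X \<mu> x \<longleftrightarrow> bil (\<lambda>_. 1) x v = 0 \<and> bil \<mu> x v = 0"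
proof -
  have "fd q0 x v = 2 * bil (\<lambda>_. 1) x v" "fd (q1 \<mu>) x v = 2 * bil \<mu> x v"
    using fd_eq[OF bil_deriv[of "\<lambda>_. 1" x]] fd_eq[OF bil_deriv[of \<mu> x]]
    by (simp_all flip: q0_bil q1_bil)
  then show ?thesis by (simp add: tangent_cone_X_def)
qed

lemma lin_closed_tangent: "lin_closed (tangent_cone_X \<mu> x)"
  by (simp add: lin_closed_def tangent_cone_X_iff bil_linear bil_zero)

lemma tangent_cone_X_smult: 
  assumes "c \<noteq> 0"
  shows "c *s v \<in> tangent_cone_X \<mu> (c *s x) \<longleftrightarrow> v \<in> tangent_cone_X \<mu> x"
proof -
  have "bil d (c *s x) (c *s v) = c * c * bil d x v" for d
    by (simp add: bil_def sum_distrib_left algebra_simps)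
  then show ?thesis using assms by (simp add: tangent_cone_X_iff)
qed

lemma cone_X_self_tangent: "x \<in> cone_X \<mu> \<Longrightarrow> x \<in> tangent_cone_X \<mu> x"
  by (simp add: tangent_cone_X_iff cone_X_iff flip: q0_bil q1_bil)

locale quadric_pencil =
  fixes \<mu> :: "'n::finite \<Rightarrow> complex"
  assumes inj: "inj \<mu>" and card: "CARD('n) \<ge> 4"
begin

abbreviation T :: "complex^'n \<Rightarrow> (complex^'n) set" where "T \<equiv> tangent_cone_X \<mu>"

text \<open>With only two nonzero coordinates the two equations would be a regular linear system for
  their squares. Later two of the three coordinates solve the tangency equations, and the third
  splits off the direction of \<open>x\<close>.\<close>

lemma three_nonzero:
  assumes x: "x \<in> cone_X \<mu>"
  obtains i j m where "i \<noteq> j" "m \<noteq> i" "m \<noteq> j" "x $ i \<noteq> 0" "x $ j \<noteq> 0" "x $ m \<noteq> 0"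
proof -
  obtain i j where ij: "i \<noteq> j" "x $ i \<noteq> 0" "x $ j \<noteq> 0" by (rule cone_X_two_nonzero[OF x])
  have "\<exists>m. m \<noteq> i \<and> m \<noteq> j \<and> x $ m \<noteq> 0"
  proof (rule ccontr)
    assume "\<not> ?thesis"
    then have "(\<Sum>l\<in>UNIV - {i, j}. c l * (x $ l)\<^sup>2) = 0" for c :: "'n \<Rightarrow> complex"
      by (intro sum.neutral) auto
    then have "q1 c x = c i * (x $ i)\<^sup>2 + c j * (x $ j)\<^sup>2" for c
      unfolding q1_def sum_UNIV_two[OF ij(1)] by simp
    from this[of \<mu>] this[of "\<lambda>_. 1"] have
      "\<mu> i * (x $ i)\<^sup>2 + \<mu> j * (x $ j)\<^sup>2 = 0" "(x $ i)\<^sup>2 + (x $ j)\<^sup>2 = 0"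
      using x by (auto simp: cone_X_iff q0_bil q1_bil)
    then have "(\<mu> i - \<mu> j) * (x $ i)\<^sup>2 = 0" by algebra
    then show False using ij inj by (auto simp: inj_eq)
  qed
  then show thesis using that ij by blast
qed

lemma diff_nonzero: "i \<noteq> j \<Longrightarrow> \<mu> i - \<mu> j \<noteq> 0"
  using inj by (auto simp: inj_eq)

text \<open>This is the smoothness of X: the gradients of \<open>q0\<close> and \<open>q1\<close>
  are linearly independent.\<close>

lemma gradients_independent:
  assumes ij: "i \<noteq> j" "x $ i \<noteq> 0" "x $ j \<noteq> 0" and z: "\<And>l. (a + b * \<mu> l) * x $ l = 0"
  shows "a = 0 \<and> b = 0"
proof -
  have "a + b * \<mu> i = 0" "a + b * \<mu> j = 0" using z[of i] z[of j] ij by auto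
  then have "b * (\<mu> i - \<mu> j) = 0" by algebra
  then show ?thesis using diff_nonzero[OF ij(1)] \<open>a + b * \<mu> i = 0\<close> by auto
qed

text \<open>\<open>axis l 1\<close>, corrected in the directions \<open>i\<close> and
  \<open>j\<close> so as to satisfy both tangency equations; the coefficients are Cramer's rule for
  that system.\<close>

definition frame_vec :: "'n \<Rightarrow> 'n \<Rightarrow> 'n \<Rightarrow> complex^'n \<Rightarrow> complex^'n" where
  "frame_vec i j l y = axis l 1 + ((\<mu> j - \<mu> l) * y $ l / ((\<mu> i - \<mu> j) * y $ i)) *s axis i 1
     + ((\<mu> i - \<mu> l) * y $ l / ((\<mu> j - \<mu> i) * y $ j)) *s axis j 1"

lemma frame_vec_nth:
  assumes "l \<notin> {i, j}" "a \<notin> {i, j}"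
  shows "frame_vec i j l y $ a = (if a = l then 1 else 0)"
  using assms by (auto simp: frame_vec_def axis_def)

lemma frame_vec_tangent:
  assumes ij: "i \<noteq> j" "y $ i \<noteq> 0" "y $ j \<noteq> 0"
  shows "frame_vec i j l y \<in> T y"
proof -
  have d: "\<mu> i - \<mu> j \<noteq> 0" "\<mu> j - \<mu> i \<noteq> 0" using diff_nonzero ij(1) by auto
  have e: "(\<mu> i - \<mu> l) * y $ l / ((\<mu> j - \<mu> i) * y $ j) = - ((\<mu> i - \<mu> l) * y $ l / ((\<mu> i - \<mu> j) * y $ j))"
    by (metis minus_diff_eq minus_divide_right mult_minus_left)
  show ?thesis
    unfolding tangent_cone_X_iff frame_vec_def bil_add bil_smult bil_axis e
    using d(1) ij by (simp add: divide_simps) (simp add: algebra_simps)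
qed

lemma holo_frame_vec:
  assumes "open V" "i \<noteq> j" "\<And>y. y \<in> V \<Longrightarrow> y $ i \<noteq> 0 \<and> y $ j \<noteq> 0"
  shows "holo V (\<lambda>y. frame_vec i j l y $ a)"
  unfolding frame_vec_def vector_add_component vector_smult_component
  by (intro holo_add holo_mult holo_divide holo_const holo_nth assms(1))
     (use assms(2,3) diff_nonzero in auto)

text \<open>A multiple of \<open>x\<close> removes coordinate \<open>m\<close>, frame vectors remove
  all others but \<open>i\<close> and \<open>j\<close>. The remainder is tangent and supported on
  \<open>{i, j}\<close>, where the two equations have only the zero solution.\<close>

lemma tangent_span:
  assumes ijm: "i \<noteq> j" "m \<noteq> i" "m \<noteq> j" "x $ i \<noteq> 0" "x $ j \<noteq> 0" "x $ m \<noteq> 0"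
    and x: "x \<in> cone_X \<mu>" and v: "v \<in> T x"
  shows "v = (v $ m / x $ m) *s x + (\<Sum>l\<in>UNIV - {i, j, m}. (v $ l - v $ m / x $ m * x $ l) *s frame_vec i j l x)"
proof -
  define u where "u = v - (v $ m / x $ m) *s x"
  define d where "d = u - (\<Sum>l\<in>UNIV - {i, j, m}. (u $ l) *s frame_vec i j l x)"
  note lc = lin_closed_tangent[of \<mu> x]
  have "1 *s v + (- (v $ m / x $ m)) *s x \<in> T x"
    using lc v cone_X_self_tangent[OF x] unfolding lin_closed_def by blast
  then have u: "u \<in> T x" by (simp add: u_def)
  have "(\<Sum>l\<in>UNIV - {i, j, m}. (u $ l) *s frame_vec i j l x) \<in> T x"
    by (rule lin_closed_sum[OF lc]) (rule frame_vec_tangent[OF ijm(1,4,5)])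
  then have "1 *s u + (-1) *s (\<Sum>l\<in>UNIV - {i, j, m}. (u $ l) *s frame_vec i j l x) \<in> T x"
    using lc u unfolding lin_closed_def by blast
  then have dT: "d \<in> T x" by (simp add: d_def)
  have um: "u $ m = 0" using ijm by (simp add: u_def)
  have d0: "d $ a = 0" if "a \<notin> {i, j}" for a
  proof -
    have "(\<Sum>l\<in>UNIV - {i, j, m}. u $ l * frame_vec i j l x $ a) = (\<Sum>l\<in>UNIV - {i, j, m}. if l = a then u $ a else 0)"
      by (rule sum.cong) (use that in \<open>auto simp: frame_vec_nth\<close>)
    then show ?thesis using that um by (auto simp: d_def)
  qed
  have "bil c x d = c i * (x $ i * d $ i) + c j * (x $ j * d $ j)" for c
    unfolding bil_def sum_UNIV_two[OF ijm(1)] using d0 by simp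
  then have "x $ i * d $ i + x $ j * d $ j = 0" "\<mu> i * (x $ i * d $ i) + \<mu> j * (x $ j * d $ j) = 0"
    using dT unfolding tangent_cone_X_iff by simp_all
  then have "(\<mu> i - \<mu> j) * (x $ i * d $ i) = 0" "(\<mu> i - \<mu> j) * (x $ j * d $ j) = 0" by algebra+
  then have "d $ i = 0" "d $ j = 0" using diff_nonzero[OF ijm(1)] ijm by auto
  then have "d = 0" using d0 by (metis insert_iff singletonD vec_eq_iff zero_index)
  then have "v = (v $ m / x $ m) *s x + (\<Sum>l\<in>UNIV - {i, j, m}. (u $ l) *s frame_vec i j l x)"
    unfolding d_def u_def by (simp add: algebra_simps)
  then show ?thesis by (simp add: u_def)
qed

subsection \<open>The residue form\<close>

text \<open>The residue of \<open>\<Omega> / (q\<^sub>0 q\<^sub>1)\<close>, where \<open>\<Omega>\<close> is the contraction of \<open>dx\<^sub>1 \<and> \<dots> \<and> dx\<^sub>N\<close> with the Euler field: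
  up to a constant factor it is \<open>det (x, v\<^sub>1, \<dots>, v\<^sub>p, e\<^sub>i, e\<^sub>j)\<close> divided by \<open>(dq\<^sub>0 \<and> dq\<^sub>1) (e\<^sub>i, e\<^sub>j)\<close>,
  for any \<open>i\<close> and \<open>j\<close>.\<close>

definition res_ij :: "'n \<Rightarrow> 'n \<Rightarrow> complex^'n \<Rightarrow> (complex^'n) list \<Rightarrow> complex" where
  "res_ij i j x vs = det_list ([x] @ vs @ [axis i 1, axis j 1]) / (x $ i * x $ j * (\<mu> j - \<mu> i))"

text \<open>The pair is chosen pointwise because its coordinates must not vanish at
  \<open>x\<close>; by \<open>res_form_eq\<close> the choice is immaterial on tangent
  vectors.\<close>

definition res_form :: "complex^'n \<Rightarrow> (complex^'n) list \<Rightarrow> complex" where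
  "res_form x = (let (i, j) = (SOME (i, j). i \<noteq> j \<and> x $ i \<noteq> 0 \<and> x $ j \<noteq> 0) in res_ij i j x)"

text \<open>All rows but possibly one vector \<open>c\<close> lie in \<open>T x\<close>. Some
  nontrivial combination of the two gradients annihilates \<open>c\<close> as well, hence every
  row.\<close>

lemma det_list_tangent_eq_0:
  assumes x: "x \<in> cone_X \<mu>" and vs: "length vs = CARD('n) - 3" "set vs \<subseteq> T x" and ab: "a \<in> T x \<or> b \<in> T x"
  shows "det_list ([x] @ vs @ [a, b]) = 0"
proof -
  obtain i j where ij: "i \<noteq> j" "x $ i \<noteq> 0" "x $ j \<noteq> 0" by (rule cone_X_two_nonzero[OF x])
  obtain c where c: "set ([x] @ vs @ [a, b]) \<subseteq> insert c (T x)"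
    using ab vs cone_X_self_tangent[OF x] by auto
  define s t where "s = bil (\<lambda>_. 1) x c" and "t = bil \<mu> x c"
  obtain \<alpha> \<beta> where ab': "\<alpha> * s + \<beta> * t = 0" "\<alpha> \<noteq> 0 \<or> \<beta> \<noteq> 0"
  proof (cases "s = 0 \<and> t = 0")
    case True
    then show thesis using that[of 1 0] by simp
  next
    case False
    then show thesis using that[of t "-s"] by (auto simp: algebra_simps)
  qed
  define z where "z = (\<chi> l. (\<alpha> + \<beta> * \<mu> l) * x $ l)"
  have "z \<noteq> 0"
    using gradients_independent[OF ij, of \<alpha> \<beta>] ab'(2) by (auto simp: z_def vec_eq_iff)
  moreover have "(\<Sum>l\<in>UNIV. v $ l * z $ l) = \<alpha> * bil (\<lambda>_. 1) x v + \<beta> * bil \<mu> x v" for v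
    by (simp add: z_def bil_def sum_distrib_left sum.distrib algebra_simps)
  then have "(\<Sum>l\<in>UNIV. v $ l * z $ l) = 0" if "v \<in> set ([x] @ vs @ [a, b])" for v
    using that c ab'(1) by (auto simp: tangent_cone_X_iff s_def t_def)
  moreover have len: "length ([x] @ vs @ [a, b]) = CARD('n)" using vs card by simp
  ultimately show ?thesis unfolding det_list_eq_0_iff[OF len] by blast
qed

lemma det_list_last_two_linear:
  fixes vs :: "(complex^'n) list"
  assumes vs: "length vs = CARD('n) - 3"
  shows "det_list ([x] @ vs @ [s *s a + t *s a', b]) = s * det_list ([x] @ vs @ [a, b]) + t * det_list ([x] @ vs @ [a', b])"
    and "det_list ([x] @ vs @ [b, s *s a + t *s a']) = s * det_list ([x] @ vs @ [b, a]) + t * det_list ([x] @ vs @ [b, a'])"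
proof -
  have len: "length ([x] @ vs @ [u, b]) = CARD('n)" "length ([x] @ vs @ [b, u]) = CARD('n)" for u using vs card by auto
  have up: "([x] @ vs @ [0, b])[CARD('n) - 2 := u] = [x] @ vs @ [u, b]"
    "([x] @ vs @ [b, 0])[CARD('n) - 1 := u] = [x] @ vs @ [b, u]" for u
    using vs card by (auto simp: list_update_append Suc_diff_Suc numeral_3_eq_3 numeral_2_eq_2 split: nat.splits)
  show "det_list ([x] @ vs @ [s *s a + t *s a', b]) = s * det_list ([x] @ vs @ [a, b]) + t * det_list ([x] @ vs @ [a', b])"
    using det_list_update_linear[OF len(1)[of 0], of "CARD('n) - 2" s a t a'] card unfolding up by simp
  show "det_list ([x] @ vs @ [b, s *s a + t *s a']) = s * det_list ([x] @ vs @ [b, a]) + t * det_list ([x] @ vs @ [b, a'])"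
    using det_list_update_linear[OF len(2)[of 0], of "CARD('n) - 1" s a t a'] card unfolding up by simp
qed

text \<open>In \<open>(a, b)\<close> the determinant is alternating and depends only on the classes
  modulo \<open>T x\<close>. That quotient is two-dimensional, so the determinant is a multiple of
  the wedge of the two differentials, and the pair of axes fixes the factor.\<close>

lemma det_list_wedge:
  assumes x: "x \<in> cone_X \<mu>" and vs: "length vs = CARD('n) - 3" "set vs \<subseteq> T x" and ij: "i \<noteq> j" "x $ i \<noteq> 0" "x $ j \<noteq> 0"
  shows "x $ i * x $ j * (\<mu> j - \<mu> i) * det_list ([x] @ vs @ [a, b]) =
    (bil (\<lambda>_. 1) x a * bil \<mu> x b - bil (\<lambda>_. 1) x b * bil \<mu> x a) * det_list ([x] @ vs @ [axis i 1, axis j 1])"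
proof -
  define B where "B = (\<lambda>a b. det_list ([x] @ vs @ [a, b]))"
  define D where "D = x $ i * x $ j * (\<mu> j - \<mu> i)"
  have D: "D \<noteq> 0" using ij diff_nonzero[of j i] by (simp add: D_def)
  \<comment> \<open>Coordinates modulo \<open>T x\<close> by Cramer's rule: \<open>D *s a\<close> is
    congruent to \<open>\<alpha> a *s axis i 1 + \<beta> a *s axis j 1\<close>. The factor
    \<open>D\<close> avoids division.\<close>
  define \<alpha> where "\<alpha> = (\<lambda>a. x $ j * (\<mu> j * bil (\<lambda>_. 1) x a - bil \<mu> x a))"
  define \<beta> where "\<beta> = (\<lambda>a. x $ i * (bil \<mu> x a - \<mu> i * bil (\<lambda>_. 1) x a))"
  have lin: "B (s *s a + t *s a') b = s * B a b + t * B a' b" "B b (s *s a + t *s a') = s * B b a + t * B b a'"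
    for s t a a' b
    unfolding B_def by (rule det_list_last_two_linear[OF vs(1)])+
  have B0: "B a b = 0" if "a \<in> T x \<or> b \<in> T x" for a b
    unfolding B_def by (rule det_list_tangent_eq_0[OF x vs that])
  define t where "t = (\<lambda>a. D *s a + (-1) *s (\<alpha> a *s axis i 1 + \<beta> a *s axis j 1))"
  have t: "t a \<in> T x" for a
    unfolding t_def tangent_cone_X_iff bil_linear bil_axis
    by (simp add: D_def \<alpha>_def \<beta>_def algebra_simps)
  have ta: "D *s a = 1 *s t a + 1 *s (\<alpha> a *s axis i 1 + \<beta> a *s axis j 1)" for a by (simp add: t_def)
  have eq: "B e e = 0" for e
    unfolding B_def
    by (rule det_list_equal_rows[of "CARD('n) - 2" "CARD('n) - 1"])
       (use vs card in \<open>auto simp: nth_append nth_Cons' Suc_diff_Suc numeral_3_eq_3 numeral_2_eq_2 split: nat.splits\<close>)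
  have anti: "B (axis j 1) (axis i 1) = - B (axis i 1) (axis j 1)"
  proof -
    have "0 = B (1 *s axis i 1 + 1 *s axis j 1) (1 *s axis i 1 + 1 *s axis j 1)" using eq by simp
    also have "\<dots> = B (axis i 1) (axis j 1) + B (axis j 1) (axis i 1)"
      unfolding lin by (simp add: eq)
    finally show ?thesis by algebra
  qed
  have l1: "D * B a b = B (\<alpha> a *s axis i 1 + \<beta> a *s axis j 1) b" for a b
  proof -
    have "D * B a b = B (D *s a + 0 *s a) b" unfolding lin by simp
    also have "D *s a + 0 *s a = D *s a" by simp
    also have "B \<dots> b = B (\<alpha> a *s axis i 1 + \<beta> a *s axis j 1) b"
      unfolding ta[of a] lin(1)[of 1 "t a" 1] using B0[of "t a"] t by simp
    finally show ?thesis .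
  qed
  have l2: "D * B a b = B a (\<alpha> b *s axis i 1 + \<beta> b *s axis j 1)" for a b
  proof -
    have "D * B a b = B a (D *s b + 0 *s b)" unfolding lin by simp
    also have "D *s b + 0 *s b = D *s b" by simp
    also have "B a \<dots> = B a (\<alpha> b *s axis i 1 + \<beta> b *s axis j 1)"
      unfolding ta[of b] lin(2)[of _ 1 "t b" 1] using B0[of _ "t b"] t by simp
    finally show ?thesis .
  qed
  have "D * (D * B a b) = D * B (\<alpha> a *s axis i 1 + \<beta> a *s axis j 1) b" by (simp add: l1)
  also have "\<dots> = (\<alpha> a * \<beta> b - \<beta> a * \<alpha> b) * B (axis i 1) (axis j 1)"
    unfolding l2 unfolding lin eq anti by (simp add: algebra_simps)
  also have "\<alpha> a * \<beta> b - \<beta> a * \<alpha> b = D * (bil (\<lambda>_. 1) x a * bil \<mu> x b - bil (\<lambda>_. 1) x b * bil \<mu> x a)"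
    by (simp add: D_def \<alpha>_def \<beta>_def algebra_simps)
  finally show ?thesis using D by (simp add: B_def D_def mult.assoc)
qed

lemma res_form_eq:
  assumes x: "x \<in> cone_X \<mu>" and vs: "length vs = CARD('n) - 3" "set vs \<subseteq> T x" and ij: "i \<noteq> j" "x $ i \<noteq> 0" "x $ j \<noteq> 0"
  shows "res_form x vs = res_ij i j x vs"
proof -
  obtain i' j' where e: "(SOME (i, j). i \<noteq> j \<and> x $ i \<noteq> 0 \<and> x $ j \<noteq> 0) = (i', j')" by fastforce
  have "case (SOME (i, j). i \<noteq> j \<and> x $ i \<noteq> 0 \<and> x $ j \<noteq> 0) of (i, j) \<Rightarrow> i \<noteq> j \<and> x $ i \<noteq> 0 \<and> x $ j \<noteq> 0"
    by (rule someI[of _ "(i, j)"]) (use ij in simp)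
  then have ij': "i' \<noteq> j'" "x $ i' \<noteq> 0" "x $ j' \<noteq> 0" unfolding e by auto
  have "\<mu> j - \<mu> i \<noteq> 0" "\<mu> j' - \<mu> i' \<noteq> 0" using diff_nonzero ij(1) ij'(1) by auto
  moreover have "x $ i * x $ j * (\<mu> j - \<mu> i) * det_list ([x] @ vs @ [axis i' 1, axis j' 1]) =
    (x $ i' * x $ j' * (\<mu> j' - \<mu> i')) * det_list ([x] @ vs @ [axis i 1, axis j 1])"
    using det_list_wedge[OF x vs ij, of "axis i' 1" "axis j' 1"] by (simp add: bil_axis algebra_simps)
  ultimately show ?thesis
    unfolding res_form_def e using ij ij'
    by (simp add: res_ij_def frac_eq_eq mult.commute mult.left_commute)
qed

lemma res_ij_alternating: "alternating_form UNIV (CARD('n) - 3) (res_ij i j x)"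
  unfolding alternating_form_def
proof (intro conjI allI impI)
  fix vs :: "(complex^'n) list" and m and v w :: "complex^'n" and a b
  assume h: "length vs = CARD('n) - 3 \<and> set vs \<subseteq> UNIV \<and> m < (CARD('n) - 3) \<and> v \<in> UNIV \<and> w \<in> UNIV"
  have up: "[x] @ vs[m := u] @ [axis i 1, axis j 1] = ([x] @ vs @ [axis i 1, axis j 1])[Suc m := u]" for u
    using h by (simp add: list_update_append)
  have "length ([x] @ vs @ [axis i 1, axis j 1]) = CARD('n)" "Suc m < CARD('n)" using h card by auto
  from det_list_update_linear[OF this, of a v b w]
  show "res_ij i j x (vs[m := a *s v + b *s w]) = a * res_ij i j x (vs[m := v]) + b * res_ij i j x (vs[m := w])"
    unfolding res_ij_def up by (simp add: add_divide_distrib)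
next
  fix vs :: "(complex^'n) list" and m m' 
  assume h: "length vs = CARD('n) - 3 \<and> set vs \<subseteq> UNIV \<and> m < m' \<and> m' < (CARD('n) - 3) \<and> vs ! m = vs ! m'"
  have "det_list ([x] @ vs @ [axis i 1, axis j 1]) = 0"
    by (rule det_list_equal_rows[of "Suc m" "Suc m'"]) (use h in \<open>auto simp: nth_append\<close>)
  then show "res_ij i j x vs = 0" by (simp add: res_ij_def)
qed

lemma res_ij_self:
  assumes "length vs = CARD('n) - 3" "x \<in> set vs"
  shows "res_ij i j x vs = 0"
proof -
  obtain m where m: "m < CARD('n) - 3" "vs ! m = x" using assms by (auto simp: in_set_conv_nth)
  have "det_list ([x] @ vs @ [axis i 1, axis j 1]) = 0"
    by (rule det_list_equal_rows[of 0 "Suc m"]) (use m assms in \<open>auto simp: nth_append\<close>)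
  then show ?thesis by (simp add: res_ij_def)
qed

text \<open>\<open>N - 2\<close> rows are scaled, and the denominator takes back two powers of
  \<open>c\<close>; this is the origin of the degree \<open>N - 4\<close>.\<close>

lemma res_ij_smult:
  assumes "length vs = CARD('n) - 3" "c \<noteq> 0"
  shows "res_ij i j (c *s x) (map ((*s) c) vs) = c ^ (CARD('n) - 4) * res_ij i j x vs"
proof -
  have "det_list (map ((*s) c) (x # vs) @ [axis i 1, axis j 1]) = c ^ length (x # vs) * det_list ((x # vs) @ [axis i 1, axis j 1])"
    by (rule det_list_scale) (use assms card in simp)
  moreover have "length (x # vs) = (CARD('n) - 4) + 2" using assms card by simp
  ultimately have "det_list ([c *s x] @ map ((*s) c) vs @ [axis i 1, axis j 1])
      = c ^ (CARD('n) - 4) * c\<^sup>2 * det_list ([x] @ vs @ [axis i 1, axis j 1])"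
    by (simp add: power_add power2_eq_square)
  then show ?thesis using assms(2) by (simp add: res_ij_def power2_eq_square)
qed

definition frame_list :: "'n \<Rightarrow> 'n \<Rightarrow> 'n list \<Rightarrow> complex^'n \<Rightarrow> (complex^'n) list" where
  "frame_list i j ls y = map (\<lambda>l. frame_vec i j l y) ls"

lemma remaining_indices:
  assumes "i \<noteq> j" "m \<noteq> i" "m \<noteq> j"
  obtains ls :: "'n list" where "set ls = UNIV - {i, j, m}" "length ls = CARD('n) - 3"
proof -
  obtain ls where ls: "set ls = UNIV - {i, j, m}" "distinct ls" using finite_distinct_list[of "UNIV - {i, j, m}"] by auto
  have "length ls = card (UNIV - {i, j, m})" using ls distinct_card by metis
  also have "\<dots> = CARD('n) - 3" using assms by (subst card_Diff_subset) auto
  finally show thesis using that ls by blast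
qed

text \<open>An annihilator \<open>z\<close> of all rows vanishes in \<open>i\<close> and
  \<open>j\<close> by the axes, then in \<open>ls\<close> by the frame vectors, and finally in
  \<open>m\<close> by \<open>y\<close>. The points \<open>y\<close> fill an open subset of the
  ambient space, so quotients by this value are holomorphic there.\<close>

lemma res_ij_frame_nonzero:
  assumes ijm: "i \<noteq> j" "m \<noteq> i" "m \<noteq> j" "y $ i \<noteq> 0" "y $ j \<noteq> 0" "y $ m \<noteq> 0"
    and ls: "set ls = UNIV - {i, j, m}" "length ls = CARD('n) - 3"
  shows "res_ij i j y (frame_list i j ls y) \<noteq> 0"
proof -
  define R where "R = [y] @ frame_list i j ls y @ [axis i 1, axis j 1]"
  have "det_list R \<noteq> 0"
  proof
    assume "det_list R = 0"
    moreover have "length R = CARD('n)" using ls card by (simp add: R_def frame_list_def)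
    ultimately obtain z where z: "z \<noteq> 0" "\<And>v. v \<in> set R \<Longrightarrow> (\<Sum>l\<in>UNIV. v $ l * z $ l) = 0"
      using det_list_eq_0_iff[of R] by blast
    have ax: "(\<Sum>l\<in>UNIV. axis a 1 $ l * z $ l) = z $ a" for a
      by (simp add: axis_def if_distrib[of "\<lambda>c. c * _"] cong: if_cong)
    have zij: "z $ i = 0" "z $ j = 0" using z(2)[of "axis i 1"] z(2)[of "axis j 1"] by (simp_all add: R_def ax)
    have zl: "z $ l = 0" if "l \<in> set ls" for l
    proof -
      have "(\<Sum>a\<in>UNIV. frame_vec i j l y $ a * z $ a) = (\<Sum>a\<in>UNIV. axis l 1 $ a * z $ a)"
        by (rule sum.cong) (use zij that ls frame_vec_nth[of l i j] in \<open>auto simp: frame_vec_def axis_def\<close>)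
      then show ?thesis using z(2)[of "frame_vec i j l y"] that by (simp add: R_def ax frame_list_def)
    qed
    have "(\<Sum>l\<in>UNIV. y $ l * z $ l) = (\<Sum>l\<in>UNIV. if l = m then y $ m * z $ m else 0)"
      by (rule sum.cong) (use zij zl ls in auto)
    then have "y $ m * z $ m = 0" using z(2)[of y] by (simp add: R_def)
    then have "z $ m = 0" using ijm by simp
    then have "z = 0" using zij zl ls by (auto simp: vec_eq_iff)
    with z(1) show False by simp
  qed
  then show ?thesis using ijm diff_nonzero[of j i] by (simp add: res_ij_def R_def)
qed

lemma frame_list_tangent:
  assumes "i \<noteq> j" "y $ i \<noteq> 0" "y $ j \<noteq> 0"
  shows "set (frame_list i j ls y) \<subseteq> T y"
  using frame_vec_tangent[OF assms] by (auto simp: frame_list_def)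

lemma tangent_in_span:
  assumes ijm: "i \<noteq> j" "m \<noteq> i" "m \<noteq> j" "x $ i \<noteq> 0" "x $ j \<noteq> 0" "x $ m \<noteq> 0"
    and ls: "set ls = UNIV - {i, j, m}" and x: "x \<in> cone_X \<mu>" and v: "v \<in> T x"
  shows "\<exists>a. v = (\<Sum>b\<in>insert x (set (frame_list i j ls x)). a b *s b)"
proof -
  define B where "B = set (frame_list i j ls x)"
  have inj_f: "inj_on (\<lambda>l. frame_vec i j l x) (UNIV - {i, j, m})"
  proof
    fix l l' assume l: "l \<in> UNIV - {i, j, m}" "l' \<in> UNIV - {i, j, m}" "frame_vec i j l x = frame_vec i j l' x"
    then have "frame_vec i j l x $ l = frame_vec i j l' x $ l" by simp
    then show "l = l'" using l frame_vec_nth[of l i j l x] frame_vec_nth[of l' i j l x] by (auto split: if_splits)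
  qed
  have B: "B = (\<lambda>l. frame_vec i j l x) ` (UNIV - {i, j, m})" by (simp add: B_def frame_list_def ls)
  have xB: "x \<notin> B"
  proof
    assume "x \<in> B"
    then obtain l where "l \<in> UNIV - {i, j, m}" "x = frame_vec i j l x" by (auto simp: B)
    then have "x $ m = frame_vec i j l x $ m" "l \<noteq> m" "l \<notin> {i, j}" by auto
    then show False using ijm frame_vec_nth[of l i j m x] by auto
  qed
  define c where "c = (\<lambda>l. v $ l - v $ m / x $ m * x $ l)"
  define g where "g = the_inv_into (UNIV - {i, j, m}) (\<lambda>l. frame_vec i j l x)"
  define a where "a = (\<lambda>b. if b = x then v $ m / x $ m else c (g b))"
  have "(\<Sum>b\<in>B. a b *s b) = (\<Sum>l\<in>UNIV - {i, j, m}. a (frame_vec i j l x) *s frame_vec i j l x)"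
    unfolding B by (rule sum.reindex_cong[OF inj_f refl]) simp
  also have "\<dots> = (\<Sum>l\<in>UNIV - {i, j, m}. c l *s frame_vec i j l x)"
  proof (rule sum.cong[OF refl])
    fix l assume l: "l \<in> UNIV - {i, j, m}"
    then have "frame_vec i j l x \<noteq> x" using xB B by force
    moreover have "g (frame_vec i j l x) = l" unfolding g_def by (rule the_inv_into_f_f[OF inj_f l])
    ultimately show "a (frame_vec i j l x) *s frame_vec i j l x = c l *s frame_vec i j l x" by (simp add: a_def)
  qed
  finally have "(\<Sum>b\<in>insert x B. a b *s b) = (v $ m / x $ m) *s x + (\<Sum>l\<in>UNIV - {i, j, m}. c l *s frame_vec i j l x)"
    using xB by (simp add: B_def a_def)
  also have "\<dots> = v" unfolding c_def by (rule tangent_span[OF ijm x v, symmetric])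
  finally show ?thesis unfolding B_def by metis
qed

text \<open>The combination of \<open>\<phi>\<close> and the residue form that vanishes on the frame
  vanishes on all tangent lists by \<open>alternating_form_eq_0\<close>.\<close>

lemma top_form_proportional:
  assumes ijm: "i \<noteq> j" "m \<noteq> i" "m \<noteq> j" "x $ i \<noteq> 0" "x $ j \<noteq> 0" "x $ m \<noteq> 0"
    and ls: "set ls = UNIV - {i, j, m}" "length ls = CARD('n) - 3" and x: "x \<in> cone_X \<mu>"
    and \<phi>: "alternating_form (T x) (CARD('n) - 3) \<phi>"
    and \<phi>x: "\<And>vs. length vs = CARD('n) - 3 \<Longrightarrow> set vs \<subseteq> T x \<Longrightarrow> x \<in> set vs \<Longrightarrow> \<phi> vs = 0"
    and vs: "length vs = CARD('n) - 3" "set vs \<subseteq> T x"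
  shows "\<phi> vs * res_ij i j x (frame_list i j ls x) = \<phi> (frame_list i j ls x) * res_ij i j x vs"
proof -
  define r where "r = res_ij i j x"
  define bs where "bs = frame_list i j ls x"
  have bs: "length bs = CARD('n) - 3" "set bs \<subseteq> T x"
    using ls frame_list_tangent[OF ijm(1,4,5)] by (auto simp: bs_def frame_list_def)
  have "r bs * \<phi> vs + (- \<phi> bs) * r vs = 0"
  proof (rule alternating_form_eq_0[where x=x and bs=bs and T="T x" and p="CARD('n) - 3"])
    show "alternating_form (T x) (CARD('n) - 3) (\<lambda>vs. r bs * \<phi> vs + (- \<phi> bs) * r vs)"
      unfolding r_def by (rule alternating_form_linear[OF \<phi> alternating_form_subset[OF res_ij_alternating]])
    show "x \<in> T x" by (rule cone_X_self_tangent[OF x])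
    show "r bs * \<phi> vs + (- \<phi> bs) * r vs = 0" if "length vs = CARD('n) - 3" "set vs \<subseteq> T x" "x \<in> set vs" for vs
      using \<phi>x[OF that] res_ij_self[OF that(1,3)] by (simp add: r_def)
    show "\<exists>a. v = (\<Sum>b\<in>insert x (set bs). a b *s b)" if "v \<in> T x" for v
      unfolding bs_def by (rule tangent_in_span[OF ijm ls(1) x that])
  qed (use lin_closed_tangent bs vs in auto)
  then show ?thesis by (simp add: r_def bs_def algebra_simps)
qed

end

section \<open>Nowhere vanishing sections and local frames\<close>

lemma O_sec_divide:
  assumes C: "conic C" "openin (top_of_set C) W" and f: "f \<in> O_sec a W" and s: "s \<in> O_sec b W"
    and s0: "\<And>x. x \<in> W \<Longrightarrow> s x \<noteq> 0"
  shows "(\<lambda>x. f x / s x) \<in> O_sec (a - b) W"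
proof -
  have fh: "f \<in> hol W" and Ef: "\<And>x. lie W (\<lambda>x. x) f x = a * f x"
    and sh: "s \<in> hol W" and Es: "\<And>x. lie W (\<lambda>x. x) s x = b * s x"
    using f s unfolding O_sec_conic[OF C] by auto
  have h: "(\<lambda>x. f x / s x) \<in> hol W"
    unfolding hol_def holo_cone_def mem_Collect_eq
  proof (intro conjI ballI allI impI)
    fix x assume x: "x \<in> W"
    obtain V F V' S where "local_ext W f x V F" "local_ext W s x V' S"
      using hol_ex[OF fh x] hol_ex[OF sh x] by blast
    note e = local_ext_two[OF this]
    then have hS: "holo (V \<inter> V') S" by (auto simp: local_ext_def)
    define V'' where "V'' = {y \<in> V \<inter> V'. S y \<noteq> 0}"
    have "continuous_on (V \<inter> V') S"
      using holo_has_derivative[OF hS] has_derivative_continuous by (metis continuous_at_imp_continuous_on)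
    then have "open (S -` (- {0}) \<inter> (V \<inter> V'))"
      using continuous_on_open_vimage[OF holo_open[OF hS]] by (metis open_Compl closed_singleton)
    moreover have "V'' = S -` (- {0}) \<inter> (V \<inter> V')" by (auto simp: V''_def)
    ultimately have oV: "open V''" by simp
    have "local_ext W (\<lambda>x. f x / s x) x V'' (\<lambda>x. F x / S x)"
      unfolding local_ext_def
    proof (intro conjI ballI)
      show "x \<in> V''" using e x s0[OF x] by (auto simp: V''_def local_ext_def)
      show "holo V'' (\<lambda>x. F x / S x)"
        by (rule holo_divide) (use e oV in \<open>auto simp: V''_def local_ext_def intro: holo_subset\<close>)
      show "F y / S y = f y / s y" if "y \<in> V'' \<inter> W" for y
        using e that by (auto simp: V''_def local_ext_def)
    qed
    then show "\<exists>V F. local_ext W (\<lambda>x. f x / s x) x V F" by blast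
  qed (use hol_outside[OF fh] in simp)
  have "lie W (\<lambda>x. x) (\<lambda>x. f x / s x) x = (a - b) * (f x / s x)" for x
  proof (cases "x \<in> W")
    case x: True
    \<comment> \<open>The degree of the quotient is read off from Leibniz' rule for this
      product.\<close>
    have "f y / s y * s y = f y" for y
      using s0[of y] hol_outside[OF fh, of y] by (cases "y \<in> W") auto
    then have e: "(\<lambda>x. f x / s x * s x) = f" by (rule ext)
    have "f x / s x * (b * s x) + lie W (\<lambda>x. x) (\<lambda>x. f x / s x) x * s x = a * f x"
      using fun_cong[OF lie_mult[OF lin_field_id_conic[OF C] h sh], of x] unfolding e Es Ef by simp
    then show ?thesis using s0[OF x] by (simp add: field_simps)
  qed (simp add: lie_outside hol_outside[OF fh])
  then show ?thesis using h unfolding O_sec_conic[OF C] by auto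
qed

text \<open>The section is a branch of the \<open>k\<close>-th power of
  \<open>y $ m / x $ m\<close>, near \<open>x\<close> where this ratio is close to 1.\<close>

lemma power_section_exists:
  assumes x: "x \<in> cone_X \<mu>"
  obtains W s where "openin (top_of_set (cone_X \<mu>)) W" "x \<in> W" "s \<in> O_sec k W" "\<forall>y\<in>W. s y \<noteq> 0"
proof -
  obtain m where m: "x $ m \<noteq> 0" using x by (auto simp: cone_X_iff vec_eq_iff)
  define V where "V = {y. norm (y $ m - x $ m) < norm (x $ m)}"
  have oV: "open V" unfolding V_def by (intro open_Collect_less continuous_intros)
  define \<phi> where "\<phi> = (\<lambda>y::complex^'a. y $ m / x $ m)"
  have nn: "\<phi> y \<notin> \<real>\<^sub>\<le>\<^sub>0" if "y \<in> V" for y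
  proof (rule not_nonpos_Reals_near_1)
    have "\<phi> y - 1 = (y $ m - x $ m) / x $ m" using m by (simp add: \<phi>_def field_simps)
    then show "norm (\<phi> y - 1) < 1" using that m by (simp add: V_def norm_divide divide_less_eq)
  qed
  define s where "s = (\<lambda>y. exp (k * Ln (\<phi> y)))"
  have h\<phi>: "holo V \<phi>" unfolding \<phi>_def by (intro holo_divide holo_const holo_nth oV m)
  have hL: "holo V (\<lambda>y. Ln (\<phi> y))"
    by (rule holo_compose_field[OF h\<phi>, where g'=inverse]) (auto intro!: has_field_derivative_Ln simp: nn)
  have hs: "holo V s"
    unfolding s_def
    by (rule holo_compose_field[OF holo_mult[OF holo_const[OF oV] hL], where g'=exp]) (auto intro!: DERIV_exp)
  have Es: "fd s y y = k * s y" if y: "y \<in> V" for y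
  proof -
    have 1: "((\<lambda>z. s (y + z *s y)) has_field_derivative fd s y y) (at 0)"
      using holo_line_deriv[OF hs, of y 0 y] y by simp
    have e: "s (y + z *s y) = exp (k * Ln (\<phi> y * (1 + z)))" for z
      by (simp add: s_def \<phi>_def algebra_simps)
    have "\<phi> y \<noteq> 0" using nn[OF y] by auto
    then have "((\<lambda>z. exp (k * Ln (\<phi> y * (1 + z)))) has_field_derivative k * s y) (at 0)"
      by (auto intro!: derivative_eq_intros simp: nn[OF y] s_def)
    then have "((\<lambda>z. s (y + z *s y)) has_field_derivative k * s y) (at 0)" unfolding e .
    with 1 show ?thesis by (rule DERIV_unique)
  qed
  define W where "W = cone_X \<mu> \<inter> V"
  have W: "openin (top_of_set (cone_X \<mu>)) W" unfolding W_def using oV by auto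
  have "lie W (\<lambda>x. x) (restr W s) y = k * restr W s y" for y
  proof (cases "y \<in> W")
    case True
    then have "y \<in> V" by (simp add: W_def)
    then show ?thesis
      using lie_restr_holo[OF lin_field_id_conic[OF conic_cone_X W] hs _ True] Es True by (simp add: restr_def)
  qed (simp add: lie_outside restr_def)
  then have "restr W s \<in> O_sec k W"
    unfolding O_sec_conic[OF conic_cone_X W] using hol_restr_holo[OF hs, of W] by (auto simp: W_def)
  moreover have "x \<in> W" using x m by (simp add: W_def V_def)
  moreover have "restr W s y \<noteq> 0" if "y \<in> W" for y using that by (simp add: restr_def s_def)
  ultimately show thesis using that W by blast
qed

text \<open>Near any point some section has no zeros; it is a multiple of the frame, which therefore
  has none either. Conversely one divides by \<open>s\<close>.\<close>

lemma O_frame_iff: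
  assumes W: "openin (top_of_set (cone_X \<mu>)) W"
  shows "O_frame \<mu> k W s \<longleftrightarrow> s \<in> O_sec k W \<and> (\<forall>x\<in>W. s x \<noteq> 0)"
proof
  assume s: "O_frame \<mu> k W s"
  have "s x \<noteq> 0" if x: "x \<in> W" for x
  proof -
    have xX: "x \<in> cone_X \<mu>" using W x openin_imp_subset by blast
    obtain W0 s0 where W0: "openin (top_of_set (cone_X \<mu>)) W0" "x \<in> W0" "s0 \<in> O_sec k W0" "\<forall>y\<in>W0. s0 y \<noteq> 0"
      by (rule power_section_exists[OF xX, where k=k])
    define W' where "W' = W \<inter> W0"
    have W': "openin (top_of_set (cone_X \<mu>)) W'" "W' \<subseteq> W" "W' \<subseteq> W0" "x \<in> W'"
      using W W0 x by (auto simp: W'_def)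
    have "restr W' s0 \<in> O_sec k W'" by (rule O_sec_restr[OF conic_cone_X W0(1) W'(1,3) W0(3)])
    then obtain g where "restr W' s0 = (\<lambda>x. g x * s x)" using s W' unfolding O_frame_def by blast
    then have "s0 x = g x * s x" using W'(4) by (metis restr_def)
    then show ?thesis using W0(2,4) by auto
  qed
  then show "s \<in> O_sec k W \<and> (\<forall>x\<in>W. s x \<noteq> 0)" using s by (auto simp: O_frame_def)
next
  assume s: "s \<in> O_sec k W \<and> (\<forall>x\<in>W. s x \<noteq> 0)"
  show "O_frame \<mu> k W s"
    unfolding O_frame_def
  proof (intro conjI allI impI ballI)
    fix W' f assume W': "openin (top_of_set (cone_X \<mu>)) W' \<and> W' \<subseteq> W" and f: "f \<in> O_sec k W'"
    have f0: "f x = 0" if "x \<notin> W'" for x using f that by (simp add: O_sec_def)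
    have s': "restr W' s \<in> O_sec k W'" using O_sec_restr[OF conic_cone_X W] W' s by blast
    have "(\<lambda>x. f x / restr W' s x) \<in> O_sec (k - k) W'"
      by (rule O_sec_divide[OF conic_cone_X _ f s']) (use W' s in \<open>auto simp: restr_def\<close>)
    moreover have "(\<lambda>x. f x / restr W' s x) = (\<lambda>x. f x / s x)" by (auto simp: restr_def f0)
    ultimately have g: "(\<lambda>x. f x / s x) \<in> O_sec 0 W'" by simp
    show "\<exists>!g. g \<in> O_sec 0 W' \<and> f = (\<lambda>x. g x * s x)"
    proof (rule ex1I[of _ "\<lambda>x. f x / s x"])
      have "f x = f x / s x * s x" for x using s W' f0[of x] by (cases "x \<in> W'") auto
      then show "(\<lambda>x. f x / s x) \<in> O_sec 0 W' \<and> f = (\<lambda>x. f x / s x * s x)" using g by auto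
      fix g assume g: "g \<in> O_sec 0 W' \<and> f = (\<lambda>x. g x * s x)"
      have "g x = f x / s x" for x
      proof (cases "x \<in> W'")
        case True
        then have "s x \<noteq> 0" using s W' by auto
        then show ?thesis using g by auto
      next
        case False
        then show ?thesis using g f0[of x] by (simp add: O_sec_def)
      qed
      then show "g = (\<lambda>x. f x / s x)" by auto
    qed
  qed (use s in blast)
qed

lemma cone_ray_open:
  assumes W: "openin (top_of_set (cone_X \<mu>)) W" and x: "x \<in> cone_X \<mu>"
  shows "open {c. c *s x \<in> W}"
proof -
  obtain U where U: "open U" "W = cone_X \<mu> \<inter> U" using W by (auto simp: openin_open)
  have "{c. c *s x \<in> W} = (\<lambda>c. c *s x) -` U \<inter> {c. c \<noteq> 0}"
    using U x cone_X_smult[OF _ x] by (auto simp: cone_X_iff)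
  then show ?thesis
    by (simp add: open_Int open_vimage U continuous_intros open_Collect_neq)
qed

text \<open>For integral degree the product has derivative zero without any choice of logarithm, so
  it is constant on the component of 1, as the invariance clause of \<open>K_sec\<close>
  demands.\<close>

lemma O_sec_ray_power:
  assumes W: "openin (top_of_set (cone_X \<mu>)) W" and x: "x \<in> cone_X \<mu>" and f: "f \<in> O_sec (- of_nat n) W"
    and c: "connected_component {c. c *s x \<in> W} 1 c"
  shows "f (c *s x) * c ^ n = f x"
proof -
  define S where "S = connected_component_set {c. c *s x \<in> W} 1"
  have S: "open S" "connected S" "1 \<in> S" "c \<in> S"
    using c cone_ray_open[OF W x] connected_component_in[OF c]
    by (auto simp: S_def open_connected_component connected_component_refl)
  have S5: "S \<subseteq> {c. c *s x \<in> W}" unfolding S_def by (rule connected_component_subset)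
  have d: "((\<lambda>z. f (z *s x) * z ^ n) has_field_derivative 0) (at z)" if "z \<in> S" for z
  proof -
    have z: "z *s x \<in> W" using S5 that by auto
    then have z0: "z \<noteq> 0" using W openin_imp_subset by (fastforce simp: cone_X_iff)
    have zn: "z * (of_nat n * z ^ (n - Suc 0)) = of_nat n * z ^ n" by (cases n) auto
    have "((\<lambda>z. f (z *s x) * z ^ n) has_field_derivative
        (- of_nat n * f (z *s x) / z) * z ^ n + (of_nat n * z ^ (n - Suc 0)) * f (z *s x)) (at z)"
      by (rule derivative_eq_intros refl ray_deriv[OF conic_cone_X W f z z0] | simp)+
    moreover have "(- of_nat n * f (z *s x) / z) * z ^ n + (of_nat n * z ^ (n - Suc 0)) * f (z *s x) = 0"
      using z0 zn by (auto simp: field_simps)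
    ultimately show ?thesis by simp
  qed
  have "continuous_on S (\<lambda>z. f (z *s x) * z ^ n)"
    using d DERIV_isCont continuous_at_imp_continuous_on by blast
  then obtain a where "\<And>z. z \<in> S \<Longrightarrow> f (z *s x) * z ^ n = a"
    using DERIV_zero_connected_constant[OF S(2,1), of "{}" "\<lambda>z. f (z *s x) * z ^ n"] d by auto
  from this[OF S(3)] this[OF S(4)] show ?thesis by simp
qed

lemma holo_form_cone_local:
  assumes \<omega>: "holo_form_cone \<mu> p W \<omega>" and x: "x \<in> W"
  obtains V \<Omega> where "open V" "x \<in> V" "\<forall>vs. length vs = p \<longrightarrow> holo V (\<lambda>y. \<Omega> y vs)"
    "\<forall>y\<in>V. alternating_form UNIV p (\<Omega> y)"
    "\<forall>y\<in>V \<inter> W. \<forall>vs. length vs = p \<and> set vs \<subseteq> tangent_cone_X \<mu> y \<longrightarrow> \<omega> y vs = \<Omega> y vs"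
proof -
  note loc = \<omega>[unfolded holo_form_cone_def, THEN conjunct2, THEN conjunct1, THEN bspec, OF x]
  then obtain V where "\<exists>\<Omega>. open V \<and> x \<in> V \<and> (\<forall>vs. length vs = p \<longrightarrow> holo V (\<lambda>y. \<Omega> y vs)) \<and>
      (\<forall>y\<in>V. alternating_form UNIV p (\<Omega> y)) \<and>
      (\<forall>y\<in>V \<inter> W. \<forall>vs. length vs = p \<and> set vs \<subseteq> tangent_cone_X \<mu> y \<longrightarrow> \<omega> y vs = \<Omega> y vs)"
    by (rule exE)
  then show thesis by (elim exE conjE) (rule that)
qed

section \<open>Canonical forms as multiples of the residue form\<close>

context quadric_pencil
begin

lemma res_form_nonzero_exists:
  assumes x: "x \<in> cone_X \<mu>"
  shows "\<exists>vs. length vs = CARD('n) - 3 \<and> set vs \<subseteq> T x \<and> res_form x vs \<noteq> 0"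
proof -
  obtain i j m where ijm: "i \<noteq> j" "m \<noteq> i" "m \<noteq> j" "x $ i \<noteq> 0" "x $ j \<noteq> 0" "x $ m \<noteq> 0" by (rule three_nonzero[OF x])
  obtain ls where ls: "set ls = UNIV - {i, j, m}" "length ls = CARD('n) - 3" by (rule remaining_indices[OF ijm(1-3)])
  have bs: "length (frame_list i j ls x) = CARD('n) - 3" "set (frame_list i j ls x) \<subseteq> T x"
    using ls frame_list_tangent[OF ijm(1,4,5)] by (auto simp: frame_list_def)
  then show ?thesis using res_ij_frame_nonzero[OF ijm ls] res_form_eq[OF x bs ijm(1,4,5)] by metis
qed

definition ref_vecs :: "complex^'n \<Rightarrow> (complex^'n) list" where
  "ref_vecs x = (SOME vs. length vs = CARD('n) - 3 \<and> set vs \<subseteq> T x \<and> res_form x vs \<noteq> 0)"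

text \<open>The ratio to the residue form on one test list; by \<open>form_eq_coef\<close> it serves
  for all. Being pointwise, it is compatible with restriction and linear over functions.\<close>

definition coef :: "'n form \<Rightarrow> complex^'n \<Rightarrow> complex" where
  "coef \<omega> x = \<omega> x (ref_vecs x) / res_form x (ref_vecs x)"

definition form_of :: "(complex^'n \<Rightarrow> complex) \<Rightarrow> 'n form" where
  "form_of f = (\<lambda>x vs. if length vs = CARD('n) - 3 \<and> set vs \<subseteq> T x then f x * res_form x vs else 0)"

lemma ref_vecs:
  assumes "x \<in> cone_X \<mu>"
  shows "length (ref_vecs x) = CARD('n) - 3" "set (ref_vecs x) \<subseteq> T x" "res_form x (ref_vecs x) \<noteq> 0"
  using someI_ex[OF res_form_nonzero_exists[OF assms]] unfolding ref_vecs_def by auto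

lemma form_eq_coef:
  assumes x: "x \<in> cone_X \<mu>" and alt: "alternating_form (T x) (CARD('n) - 3) (\<omega> x)"
    and self: "\<And>vs. x \<in> set vs \<Longrightarrow> \<omega> x vs = 0" and vs: "length vs = CARD('n) - 3" "set vs \<subseteq> T x"
  shows "\<omega> x vs = coef \<omega> x * res_form x vs"
proof -
  obtain i j m where ijm: "i \<noteq> j" "m \<noteq> i" "m \<noteq> j" "x $ i \<noteq> 0" "x $ j \<noteq> 0" "x $ m \<noteq> 0" by (rule three_nonzero[OF x])
  obtain ls where ls: "set ls = UNIV - {i, j, m}" "length ls = CARD('n) - 3" by (rule remaining_indices[OF ijm(1-3)])
  define r where "r = res_ij i j x (frame_list i j ls x)"
  have r: "r \<noteq> 0" unfolding r_def by (rule res_ij_frame_nonzero[OF ijm ls])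
  have e: "\<omega> x us * r = \<omega> x (frame_list i j ls x) * res_form x us"
    if "length us = CARD('n) - 3" "set us \<subseteq> T x" for us
    unfolding r_def res_form_eq[OF x that ijm(1,4,5)]
    by (rule top_form_proportional[OF ijm ls x alt self that])
  note rv = ref_vecs[OF x]
  have "\<omega> x vs * res_form x (ref_vecs x) * r = \<omega> x (ref_vecs x) * res_form x vs * r"
    using e[OF vs] e[OF rv(1,2)] by algebra
  then show ?thesis using rv(3) r by (simp add: coef_def field_simps)
qed

lemma res_form_self:
  assumes x: "x \<in> cone_X \<mu>" and vs: "length vs = CARD('n) - 3" "set vs \<subseteq> T x" "x \<in> set vs"
  shows "res_form x vs = 0"
proof -
  obtain i j where ij: "i \<noteq> j" "x $ i \<noteq> 0" "x $ j \<noteq> 0" by (rule cone_X_two_nonzero[OF x])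
  show ?thesis using res_form_eq[OF x vs(1,2) ij] res_ij_self[OF vs(1,3)] by simp
qed

lemma tangent_map_smult: "c \<noteq> 0 \<Longrightarrow> set (map ((*s) c) vs) \<subseteq> T (c *s x) \<longleftrightarrow> set vs \<subseteq> T x"
  unfolding set_map image_subset_iff by (auto simp: tangent_cone_X_smult)

lemma res_form_smult:
  assumes x: "x \<in> cone_X \<mu>" and vs: "length vs = CARD('n) - 3" "set vs \<subseteq> T x" and c: "c \<noteq> 0"
  shows "res_form (c *s x) (map ((*s) c) vs) = c ^ (CARD('n) - 4) * res_form x vs"
proof -
  obtain i j where ij: "i \<noteq> j" "x $ i \<noteq> 0" "x $ j \<noteq> 0" by (rule cone_X_two_nonzero[OF x])
  have "res_form (c *s x) (map ((*s) c) vs) = res_ij i j (c *s x) (map ((*s) c) vs)"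
    by (rule res_form_eq[OF cone_X_smult[OF c x]])
       (use vs ij c tangent_map_smult[OF c, of vs x] in simp_all)
  then show ?thesis using res_form_eq[OF x vs ij] res_ij_smult[OF vs(1) c] by simp
qed

lemma K_secD:
  assumes "\<omega> \<in> K_sec \<mu> W" "x \<in> W"
  shows "alternating_form (T x) (CARD('n) - 3) (\<omega> x)" "x \<in> set vs \<Longrightarrow> \<omega> x vs = 0"
    "connected_component {c. c *s x \<in> W} 1 c \<Longrightarrow> \<omega> (c *s x) (map ((*s) c) vs) = \<omega> x vs"
  using assms unfolding K_sec_def holo_form_cone_def by blast+

lemma K_sec_coef:
  assumes W: "openin (top_of_set (cone_X \<mu>)) W" and \<omega>: "\<omega> \<in> K_sec \<mu> W" and x: "x \<in> W"
    and vs: "length vs = CARD('n) - 3" "set vs \<subseteq> T x"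
  shows "\<omega> x vs = coef \<omega> x * res_form x vs"
proof -
  have "x \<in> cone_X \<mu>" using W x openin_imp_subset by blast
  then show ?thesis using form_eq_coef K_secD[OF \<omega> x] vs by blast
qed

lemma K_sec_outside:
  assumes "\<omega> \<in> K_sec \<mu> W" "\<not> (x \<in> W \<and> length vs = CARD('n) - 3 \<and> set vs \<subseteq> T x)"
  shows "\<omega> x vs = 0"
  using assms unfolding K_sec_def holo_form_cone_def by blast

lemma coef_outside: "\<omega> \<in> K_sec \<mu> W \<Longrightarrow> x \<notin> W \<Longrightarrow> coef \<omega> x = 0"
  using K_sec_outside by (simp add: coef_def)

text \<open>The form is invariant under scaling and the residue form has degree
  \<open>N - 4\<close>, so the ratio has the opposite degree.\<close>

lemma coef_ray:
  assumes W: "openin (top_of_set (cone_X \<mu>)) W" and \<omega>: "\<omega> \<in> K_sec \<mu> W" and x: "x \<in> W"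
    and c: "connected_component {c. c *s x \<in> W} 1 c"
  shows "coef \<omega> (c *s x) * c ^ (CARD('n) - 4) = coef \<omega> x"
proof -
  have sub: "W \<subseteq> cone_X \<mu>" using W openin_imp_subset by blast
  then have xX: "x \<in> cone_X \<mu>" using x by blast
  have cW: "c *s x \<in> W" using connected_component_in[OF c] by simp
  then have c0: "c \<noteq> 0" using sub by (auto simp: cone_X_iff)
  note rv = ref_vecs[OF xX]
  have "coef \<omega> x * res_form x (ref_vecs x) = \<omega> x (ref_vecs x)"
    using K_sec_coef[OF W \<omega> x rv(1,2)] by simp
  also have "\<dots> = \<omega> (c *s x) (map ((*s) c) (ref_vecs x))"
    using K_secD(3)[OF \<omega> x c] by simp
  also have "\<dots> = coef \<omega> (c *s x) * res_form (c *s x) (map ((*s) c) (ref_vecs x))"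
    by (rule K_sec_coef[OF W \<omega> cW]) (use rv tangent_map_smult[OF c0, of "ref_vecs x" x] in simp_all)
  also have "\<dots> = coef \<omega> (c *s x) * c ^ (CARD('n) - 4) * res_form x (ref_vecs x)"
    using res_form_smult[OF xX rv(1,2) c0] by simp
  finally show ?thesis using rv(3) by simp
qed

text \<open>On the moving frame, numerator and denominator are holomorphic in an open set of the
  ambient space, which yields an extension off the cone.\<close>

lemma coef_hol:
  assumes W: "openin (top_of_set (cone_X \<mu>)) W" and \<omega>: "\<omega> \<in> K_sec \<mu> W"
  shows "coef \<omega> \<in> hol W"
proof -
  have "\<exists>V F. local_ext W (coef \<omega>) x V F" if x: "x \<in> W" for x
  proof -
    have sub: "W \<subseteq> cone_X \<mu>" using W openin_imp_subset by blast
    then have xX: "x \<in> cone_X \<mu>" using x by blast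
    obtain i j m where ijm: "i \<noteq> j" "m \<noteq> i" "m \<noteq> j" "x $ i \<noteq> 0" "x $ j \<noteq> 0" "x $ m \<noteq> 0" by (rule three_nonzero[OF xX])
    obtain ls where ls: "set ls = UNIV - {i, j, m}" "length ls = CARD('n) - 3" by (rule remaining_indices[OF ijm(1-3)])
    obtain V \<Omega> where V: "open V" "x \<in> V" and h\<Omega>: "\<And>vs. length vs = CARD('n) - 3 \<Longrightarrow> holo V (\<lambda>y. \<Omega> y vs)"
      and alt: "\<And>y. y \<in> V \<Longrightarrow> alternating_form UNIV (CARD('n) - 3) (\<Omega> y)"
      and eq: "\<And>y vs. y \<in> V \<inter> W \<Longrightarrow> length vs = CARD('n) - 3 \<Longrightarrow> set vs \<subseteq> T y \<Longrightarrow> \<omega> y vs = \<Omega> y vs"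
    proof -
      have "holo_form_cone \<mu> (CARD('n) - 3) W \<omega>" using \<omega> by (simp add: K_sec_def)
      from holo_form_cone_local[OF this x] that show thesis by metis
    qed
    define V' where "V' = V \<inter> {y. y $ i \<noteq> 0} \<inter> {y. y $ j \<noteq> 0} \<inter> {y. y $ m \<noteq> 0}"
    have V': "open V'" unfolding V'_def by (intro open_Int V open_Collect_neq continuous_intros)
    have nz: "y $ i \<noteq> 0" "y $ j \<noteq> 0" "y $ m \<noteq> 0" "y \<in> V" if "y \<in> V'" for y using that by (auto simp: V'_def)
    have fv: "holo V' (\<lambda>y. frame_vec i j l y $ a)" for l a
      by (rule holo_frame_vec[OF V' ijm(1)]) (use nz in blast)
    have h1: "holo V' (\<lambda>y. \<Omega> y (frame_list i j ls y))"
      unfolding frame_list_def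
    proof (rule holo_form_varying[OF V' _ _ fv ls(2)])
      show "holo V' (\<lambda>y. \<Omega> y vs)" if "length vs = CARD('n) - 3" for vs
        using holo_subset[OF h\<Omega>[OF that] V'] nz(4) by blast
      show "alternating_form UNIV (CARD('n) - 3) (\<Omega> y)" if "y \<in> V'" for y using alt nz(4)[OF that] by blast
    qed
    have h2: "holo V' (\<lambda>y. res_ij i j y (frame_list i j ls y))"
      unfolding res_ij_def
    proof (intro holo_divide holo_det_list holo_mult holo_nth holo_const V')
      fix r l assume r: "r < CARD('n)"
      consider "r = 0" | "0 < r" "r - 1 < length ls" | "r - 1 = length ls" "0 < r" | "r - 1 = length ls + 1" "0 < r"
        using r ls(2) card by linarith
      then show "holo V' (\<lambda>y. (([y] @ frame_list i j ls y @ [axis i 1, axis j 1]) ! r) $ l)"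
        by cases (auto simp: nth_append nth_Cons' frame_list_def intro: holo_nth holo_const V' fv)
    next
      show "y $ i * y $ j * (\<mu> j - \<mu> i) \<noteq> 0" if "y \<in> V'" for y
        using nz[OF that] diff_nonzero[of j i] ijm by simp
    qed
    have "local_ext W (coef \<omega>) x V' (\<lambda>y. \<Omega> y (frame_list i j ls y) / res_ij i j y (frame_list i j ls y))"
      unfolding local_ext_def
    proof (intro conjI ballI)
      show "x \<in> V'" using V ijm by (simp add: V'_def)
      show "holo V' (\<lambda>y. \<Omega> y (frame_list i j ls y) / res_ij i j y (frame_list i j ls y))"
        by (rule holo_divide[OF h1 h2]) (use nz ijm ls res_ij_frame_nonzero in blast)
      fix y assume y: "y \<in> V' \<inter> W"
      then have yX: "y \<in> cone_X \<mu>" using sub by blast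
      note n = nz[of y]
      have bs: "length (frame_list i j ls y) = CARD('n) - 3" "set (frame_list i j ls y) \<subseteq> T y"
        using ls frame_list_tangent[OF ijm(1), of y ls] n y by (simp_all add: frame_list_def)
      have "\<Omega> y (frame_list i j ls y) = coef \<omega> y * res_form y (frame_list i j ls y)"
        using eq[OF _ bs] K_sec_coef[OF W \<omega> _ bs] n(4) y by simp
      moreover have "res_form y (frame_list i j ls y) = res_ij i j y (frame_list i j ls y)"
        by (rule res_form_eq[OF yX bs ijm(1)]) (use n y in auto)
      moreover have "res_ij i j y (frame_list i j ls y) \<noteq> 0"
        by (rule res_ij_frame_nonzero[OF ijm(1-3) _ _ _ ls]) (use n y in auto)
      ultimately show "\<Omega> y (frame_list i j ls y) / res_ij i j y (frame_list i j ls y) = coef \<omega> y" by simp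
    qed
    then show ?thesis by blast
  qed
  then show ?thesis using coef_outside[OF \<omega>] by (auto simp: hol_def holo_cone_def)
qed

text \<open>Differentiate \<open>coef_ray\<close> at \<open>c = 1\<close>; a small disc about 1 is
  connected, so it lies in the component covered by the invariance clause.\<close>

lemma coef_O_sec:
  assumes W: "openin (top_of_set (cone_X \<mu>)) W" and \<omega>: "\<omega> \<in> K_sec \<mu> W"
  shows "coef \<omega> \<in> O_sec (- of_nat (CARD('n) - 4)) W"
proof -
  define n where "n = CARD('n) - 4"
  have h: "coef \<omega> \<in> hol W" by (rule coef_hol[OF W \<omega>])
  have "lie W (\<lambda>x. x) (coef \<omega>) x = - of_nat n * coef \<omega> x" for x
  proof (cases "x \<in> W")
    case x: True
    have xX: "x \<in> cone_X \<mu>" using W x openin_imp_subset by blast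
    obtain V F where F: "local_ext W (coef \<omega>) x V F" using hol_ex[OF h x] by blast
    then have hF: "holo V F" "x \<in> V" and Ff: "\<And>y. y \<in> V \<inter> W \<Longrightarrow> F y = coef \<omega> y" by (auto simp: local_ext_def)
    have "open {c. c *s x \<in> W}" by (rule cone_ray_open[OF W xX])
    moreover have "1 \<in> {c. c *s x \<in> W}" using x by simp
    ultimately obtain e where e: "e > 0" "ball 1 e \<subseteq> {c. c *s x \<in> W}" using open_contains_ball by blast
    define S where "S = (\<lambda>z. x + z *s x) -` V \<inter> ball 0 e"
    have oS: "open S" unfolding S_def by (intro open_Int open_vimage holo_open[OF hF(1)] continuous_intros open_ball)
    have 1: "((\<lambda>z. F (x + z *s x)) has_field_derivative fd F x x) (at 0)"
      using holo_line_deriv[OF hF(1), of x 0 x] hF(2) by simp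
    have ev: "coef \<omega> x / (1 + z) ^ n = F (x + z *s x)" if "z \<in> S" for z
    proof -
      have z: "1 + z \<in> ball 1 e" "x + z *s x \<in> V" using that by (auto simp: S_def dist_norm)
      have s: "x + z *s x = (1 + z) *s x" by (simp add: vec_eq_iff algebra_simps)
      have w: "(1 + z) *s x \<in> W" using z e by blast
      have "connected_component {c. c *s x \<in> W} 1 (1 + z)"
        by (rule connected_componentI[of "ball 1 e"]) (use e z in auto)
      from coef_ray[OF W \<omega> x this] have "coef \<omega> ((1 + z) *s x) * (1 + z) ^ n = coef \<omega> x" by (simp add: n_def)
      moreover have "1 + z \<noteq> 0"
        using w W openin_imp_subset by (fastforce simp: cone_X_iff)
      ultimately have "coef \<omega> ((1 + z) *s x) = coef \<omega> x / (1 + z) ^ n"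
        by (intro eq_divide_imp) auto
      moreover have "F (x + z *s x) = coef \<omega> ((1 + z) *s x)"
        using z(2) w unfolding s by (intro Ff) auto
      ultimately show ?thesis by simp
    qed
    have "((\<lambda>z. coef \<omega> x / (1 + z) ^ n) has_field_derivative - of_nat n * coef \<omega> x) (at 0)"
      by (auto intro!: derivative_eq_intros)
    then have "((\<lambda>z. F (x + z *s x)) has_field_derivative - of_nat n * coef \<omega> x) (at 0)"
      by (rule has_field_derivative_transform_within_open[OF _ oS]) (use hF e ev in \<open>auto simp: S_def\<close>)
    with 1 have "fd F x x = - of_nat n * coef \<omega> x" by (rule DERIV_unique)
    then show ?thesis using lie_eq[OF lin_field_id_conic[OF conic_cone_X W] F x] by simp
  qed (simp add: lie_outside coef_outside[OF \<omega>])
  then show ?thesis unfolding O_sec_conic[OF conic_cone_X W] n_def using h by auto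
qed

lemma form_of_alternating:
  assumes x: "x \<in> cone_X \<mu>"
  shows "alternating_form (T x) (CARD('n) - 3) (form_of f x)"
proof -
  obtain i j where ij: "i \<noteq> j" "x $ i \<noteq> 0" "x $ j \<noteq> 0" by (rule cone_X_two_nonzero[OF x])
  \<comment> \<open>The summand with factor 0 only fits the shape of
    \<open>alternating_form_linear\<close>.\<close>
  have alt: "alternating_form (T x) (CARD('n) - 3) (\<lambda>vs. f x * res_ij i j x vs + 0 * res_ij i j x vs)"
    by (intro alternating_form_linear alternating_form_subset[OF res_ij_alternating])
  have e: "form_of f x vs = f x * res_ij i j x vs + 0 * res_ij i j x vs"
    if "length vs = CARD('n) - 3" "set vs \<subseteq> T x" for vs
    using res_form_eq[OF x that ij] that by (simp add: form_of_def)
  show ?thesis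
    unfolding alternating_form_def
  proof (intro conjI allI impI)
    fix vs m v w a b
    assume h: "length vs = CARD('n) - 3 \<and> set vs \<subseteq> T x \<and> m < CARD('n) - 3 \<and> v \<in> T x \<and> w \<in> T x"
    have "a *s v + b *s w \<in> T x" using lin_closed_tangent h unfolding lin_closed_def by blast
    then show "form_of f x (vs[m := a *s v + b *s w]) = a * form_of f x (vs[m := v]) + b * form_of f x (vs[m := w])"
      using h alternating_formD(1)[OF alt, of vs m v w a b] by (simp add: e set_update_subset)
  next
    fix vs m m'
    assume h: "length vs = CARD('n) - 3 \<and> set vs \<subseteq> T x \<and> m < m' \<and> m' < CARD('n) - 3 \<and> vs ! m = vs ! m'"
    then show "form_of f x vs = 0"
      using alternating_formD(2)[OF alt, of vs m m'] by (simp add: e)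
  qed
qed

text \<open>An extension is the product of one of \<open>f\<close> with \<open>res_ij i j\<close>
  for a pair fixed near the point; scaling invariance holds because the two degrees cancel.\<close>

lemma form_of_K_sec:
  assumes W: "openin (top_of_set (cone_X \<mu>)) W" and f: "f \<in> O_sec (- of_nat (CARD('n) - 4)) W"
  shows "form_of f \<in> K_sec \<mu> W"
proof -
  have sub: "W \<subseteq> cone_X \<mu>" using W openin_imp_subset by blast
  have fh: "f \<in> hol W" using f unfolding O_sec_conic[OF conic_cone_X W] by blast
  have loc: "\<exists>V \<Omega>. open V \<and> x \<in> V \<and> (\<forall>vs. length vs = CARD('n) - 3 \<longrightarrow> holo V (\<lambda>y. \<Omega> y vs)) \<and>
      (\<forall>y\<in>V. alternating_form UNIV (CARD('n) - 3) (\<Omega> y)) \<and>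
      (\<forall>y\<in>V \<inter> W. \<forall>vs. length vs = CARD('n) - 3 \<and> set vs \<subseteq> T y \<longrightarrow> form_of f y vs = \<Omega> y vs)" if x: "x \<in> W" for x
  proof -
    have xX: "x \<in> cone_X \<mu>" using x sub by blast
    obtain i j where ij: "i \<noteq> j" "x $ i \<noteq> 0" "x $ j \<noteq> 0" by (rule cone_X_two_nonzero[OF xX])
    obtain V F where "local_ext W f x V F" using hol_ex[OF fh x] by blast
    then have hF: "holo V F" "x \<in> V" and Ff: "\<And>y. y \<in> V \<inter> W \<Longrightarrow> F y = f y" by (auto simp: local_ext_def)
    define V' where "V' = V \<inter> {y. y $ i \<noteq> 0} \<inter> {y. y $ j \<noteq> 0}"
    have V': "open V'" unfolding V'_def by (intro open_Int holo_open[OF hF(1)] open_Collect_neq continuous_intros)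
    have nz: "y $ i \<noteq> 0" "y $ j \<noteq> 0" "y \<in> V" if "y \<in> V'" for y using that by (auto simp: V'_def)
    define \<Omega> where "\<Omega> = (\<lambda>y vs. F y * res_ij i j y vs + 0 * res_ij i j y vs)"
    have "holo V' (\<lambda>y. \<Omega> y vs)" if vs: "length vs = CARD('n) - 3" for vs
    proof -
      have "holo V' (\<lambda>y. res_ij i j y vs)"
        unfolding res_ij_def
      proof (intro holo_divide holo_det_list holo_mult holo_nth holo_const V')
        fix r l assume r: "r < CARD('n)"
        show "holo V' (\<lambda>y. (([y] @ vs @ [axis i 1, axis j 1]) ! r) $ l)"
          by (cases r) (auto intro: holo_nth holo_const V')
        next
        show "y $ i * y $ j * (\<mu> j - \<mu> i) \<noteq> 0" if "y \<in> V'" for y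
          using nz[OF that] diff_nonzero[of j i] ij by simp
      qed
      moreover have "holo V' F" by (rule holo_subset[OF hF(1) V']) (auto simp: V'_def)
      ultimately show ?thesis unfolding \<Omega>_def by (intro holo_add holo_mult holo_const V')
    qed
    moreover have "alternating_form UNIV (CARD('n) - 3) (\<Omega> y)" for y
      unfolding \<Omega>_def by (intro alternating_form_linear res_ij_alternating)
    moreover have "form_of f y vs = \<Omega> y vs"
      if "y \<in> V' \<inter> W" "length vs = CARD('n) - 3" "set vs \<subseteq> T y" for y vs
      using res_form_eq[of y vs i j] that sub nz[of y] ij Ff[of y] by (auto simp: form_of_def \<Omega>_def)
    moreover have "x \<in> V'" using hF ij by (simp add: V'_def)
    ultimately show ?thesis using V' by blast
  qed
  have f0: "f x = 0" if "x \<notin> W" for x using hol_outside[OF fh that] .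
  have ray: "form_of f (c *s x) (map ((*s) c) vs) = form_of f x vs"
    if x: "x \<in> W" and c: "connected_component {c. c *s x \<in> W} 1 c" for x c vs
  proof -
    have xX: "x \<in> cone_X \<mu>" using x sub by blast
    have "c *s x \<in> W" using connected_component_in[OF c] by simp
    then have c0: "c \<noteq> 0" using sub by (auto simp: cone_X_iff)
    show ?thesis
    proof (cases "length vs = CARD('n) - 3 \<and> set vs \<subseteq> T x")
      case True
      then have "form_of f (c *s x) (map ((*s) c) vs) = f (c *s x) * (c ^ (CARD('n) - 4) * res_form x vs)"
        using tangent_map_smult[OF c0, of vs x] res_form_smult[OF xX _ _ c0, of vs] by (simp add: form_of_def)
      also have "\<dots> = f x * res_form x vs"
        using O_sec_ray_power[OF W xX f c] by (simp add: mult.assoc[symmetric])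
      finally show ?thesis using True by (simp add: form_of_def)
    next
      case False
      then show ?thesis using tangent_map_smult[OF c0, of vs x] by (auto simp: form_of_def)
    qed
  qed
  show ?thesis
    unfolding K_sec_def holo_form_cone_def mem_Collect_eq
  proof (intro conjI ballI allI impI)
    show "alternating_form (T x) (CARD('n) - 3) (form_of f x)" if "x \<in> W" for x
      using form_of_alternating that sub by blast
    show "form_of f x vs = 0" if "\<not> (x \<in> W \<and> length vs = CARD('n) - 3 \<and> set vs \<subseteq> T x)" for x vs
      using that f0 by (auto simp: form_of_def)
    show "form_of f x vs = 0" if "x \<in> W" "x \<in> set vs" for x vs
      using res_form_self[of x vs] that sub by (auto simp: form_of_def)
  qed (use loc ray in blast)+
qed

lemma coef_form_of:
  assumes W: "openin (top_of_set (cone_X \<mu>)) W" and f: "\<And>x. x \<notin> W \<Longrightarrow> f x = 0"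
  shows "coef (form_of f) = f"
proof
  fix x show "coef (form_of f) x = f x"
  proof (cases "x \<in> W")
    case True
    then have "x \<in> cone_X \<mu>" using W openin_imp_subset by blast
    then show ?thesis using ref_vecs[of x] by (simp add: coef_def form_of_def)
  qed (simp add: coef_def form_of_def f)
qed

lemma form_of_coef:
  assumes W: "openin (top_of_set (cone_X \<mu>)) W" and \<omega>: "\<omega> \<in> K_sec \<mu> W"
  shows "form_of (coef \<omega>) = \<omega>"
proof (intro ext)
  fix x vs show "form_of (coef \<omega>) x vs = \<omega> x vs"
  proof (cases "x \<in> W \<and> length vs = CARD('n) - 3 \<and> set vs \<subseteq> T x")
    case True
    then show ?thesis using K_sec_coef[OF W \<omega>, of x vs] by (simp add: form_of_def)
  next
    case False
    then show ?thesis using K_sec_outside[OF \<omega> False] coef_outside[OF \<omega>, of x] by (auto simp: form_of_def)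
  qed
qed

lemma degree_eq: "- (of_nat CARD('n) - 4) = (- of_nat (CARD('n) - 4) :: complex)"
  using card by (simp add: of_nat_diff)

lemma K_iso_O: "K_iso_O \<mu> (- (of_nat CARD('n) - 4))"
  unfolding K_iso_O_def degree_eq
proof (intro exI[of _ "\<lambda>W. coef"] allI impI conjI ballI)
  fix W :: "(complex^'n) set" assume W: "openin (top_of_set (cone_X \<mu>)) W"
  show "bij_betw coef (K_sec \<mu> W) (O_sec (- of_nat (CARD('n) - 4)) W)"
  proof (rule bij_betw_byWitness[where f'=form_of])
    show "\<forall>\<omega>\<in>K_sec \<mu> W. form_of (coef \<omega>) = \<omega>" using form_of_coef[OF W] by blast
    show "\<forall>f\<in>O_sec (- of_nat (CARD('n) - 4)) W. coef (form_of f) = f"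
      using coef_form_of[OF W] by (auto simp: O_sec_def)
    show "coef ` K_sec \<mu> W \<subseteq> O_sec (- of_nat (CARD('n) - 4)) W" using coef_O_sec[OF W] by blast
    show "form_of ` O_sec (- of_nat (CARD('n) - 4)) W \<subseteq> K_sec \<mu> W" using form_of_K_sec[OF W] by blast
  qed
qed (auto simp: coef_def add_divide_distrib restr_def restr_form_def)

text \<open>\<open>coef\<close> and \<open>form_of\<close> are linear over functions, so the frame
  property carries over from \<open>O_frame\<close>.\<close>

lemma K_frame_form_of:
  assumes W: "openin (top_of_set (cone_X \<mu>)) W" and s: "s \<in> O_sec (- of_nat (CARD('n) - 4)) W"
    and s0: "\<And>x. x \<in> W \<Longrightarrow> s x \<noteq> 0"
  shows "K_frame \<mu> W (form_of s)"
  unfolding K_frame_def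
proof (intro conjI allI impI ballI)
  show "form_of s \<in> K_sec \<mu> W" by (rule form_of_K_sec[OF W s])
  fix W' \<omega> assume W'W: "openin (top_of_set (cone_X \<mu>)) W' \<and> W' \<subseteq> W" and \<omega>: "\<omega> \<in> K_sec \<mu> W'"
  then have W': "openin (top_of_set (cone_X \<mu>)) W'" by blast
  have "O_frame \<mu> (- of_nat (CARD('n) - 4)) W s" using O_frame_iff[OF W] s s0 by blast
  then have ex1: "\<exists>!g. g \<in> O_sec 0 W' \<and> coef \<omega> = (\<lambda>x. g x * s x)"
    using coef_O_sec[OF W' \<omega>] W'W unfolding O_frame_def by blast
  have "\<omega> = (\<lambda>x vs. g x * form_of s x vs) \<longleftrightarrow> coef \<omega> = (\<lambda>x. g x * s x)" if g: "g \<in> O_sec 0 W'" for g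
  proof -
    have g0: "g x = 0" if "x \<notin> W'" for x using g that by (simp add: O_sec_def)
    have e: "(\<lambda>x vs. g x * form_of s x vs) = form_of (\<lambda>x. g x * s x)" by (auto simp: form_of_def fun_eq_iff)
    have "coef (form_of (\<lambda>x. g x * s x)) = (\<lambda>x. g x * s x)" by (rule coef_form_of[OF W']) (simp add: g0)
    then show ?thesis unfolding e using form_of_coef[OF W' \<omega>] by auto
  qed
  then have iff: "g \<in> O_sec 0 W' \<and> \<omega> = (\<lambda>x vs. g x * form_of s x vs) \<longleftrightarrow>
      g \<in> O_sec 0 W' \<and> coef \<omega> = (\<lambda>x. g x * s x)" for g
    by (intro conj_cong refl)
  show "\<exists>!g. g \<in> O_sec 0 W' \<and> \<omega> = (\<lambda>x vs. g x * form_of s x vs)" unfolding iff by (rule ex1)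
qed

text \<open>The pairing is the product of two sections, of degree \<open>2 * k\<close>, followed by
  \<open>form_of\<close>. The square of a section without zeros has none, so frames go to
  frames.\<close>

lemma sqrt_of_K:
  assumes k: "k = - (of_nat CARD('n) - 4) / 2"
  shows "sqrt_of_K \<mu> k"
proof -
  have kk: "k + k = - of_nat (CARD('n) - 4)" unfolding k degree_eq[symmetric] by (simp add: field_simps)
  show ?thesis
    unfolding sqrt_of_K_def
  proof (intro conjI ballI exI[of _ "\<lambda>W f g. form_of (\<lambda>x. f x * g x)"] allI impI)
    fix x assume "x \<in> cone_X \<mu>"
    then obtain W s where "openin (top_of_set (cone_X \<mu>)) W" "x \<in> W" "s \<in> O_sec k W" "\<forall>y\<in>W. s y \<noteq> 0"
      by (rule power_section_exists[where k=k])
    then show "\<exists>W s. openin (top_of_set (cone_X \<mu>)) W \<and> x \<in> W \<and> O_frame \<mu> k W s" using O_frame_iff by blast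
  next
    fix W :: "(complex^'n) set" assume W: "openin (top_of_set (cone_X \<mu>)) W"
    show "form_of (\<lambda>x. f x * g x) \<in> K_sec \<mu> W" if "f \<in> O_sec k W" "g \<in> O_sec k W" for f g
      using form_of_K_sec[OF W] O_sec_mult[OF conic_cone_X W that] kk by simp
    show "K_frame \<mu> W (form_of (\<lambda>x. s x * s x))" if "O_frame \<mu> k W s" for s
      using that K_frame_form_of[OF W] O_sec_mult[OF conic_cone_X W, of s k s k] kk unfolding O_frame_iff[OF W] by simp
  qed (auto simp: form_of_def restr_def restr_form_def fun_eq_iff algebra_simps)
qed

end

theorem mainTheorem3:
  fixes \<mu> :: "'n::finite \<Rightarrow> complex" and k :: complex
  assumes "CARD('n) \<ge> 4"
    and "inj \<mu>"
    and "k = - (of_nat CARD('n) - 4) / 2"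
  shows "(\<forall>i. diff_op 2 cone_Q k (Delta \<mu> i)) \<and>
    (\<forall>i W f. openin (top_of_set cone_Q) W \<and> f \<in> O_sec k W \<and> divisible_q1 \<mu> k W f
        \<longrightarrow> divisible_q1 \<mu> k W (Delta \<mu> i W f)) \<and>
    (\<forall>i j. ops_commute cone_Q k (Delta \<mu> i) (Delta \<mu> j)) \<and>
    (\<exists>D. (\<forall>i. diff_op 2 (cone_X \<mu>) k (D i) \<and> induces_on_X \<mu> k (Delta \<mu> i) (D i) \<and>
            (\<forall>E. sheaf_op (cone_X \<mu>) k E \<and> induces_on_X \<mu> k (Delta \<mu> i) E
                 \<longrightarrow> ops_agree (cone_X \<mu>) k E (D i))) \<and>
         (\<forall>i j. ops_commute (cone_X \<mu>) k (D i) (D j))) \<and>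
    K_iso_O \<mu> (- (of_nat CARD('n) - 4)) \<and>
    - (of_nat CARD('n) - 4) = 2 * k \<and>
    sqrt_of_K \<mu> k"
proof -
  interpret critical_degree \<mu> k by unfold_locales (rule assms)+
  interpret quadric_pencil \<mu> by unfold_locales (rule assms)+
  have "\<exists>D. (\<forall>i. diff_op 2 (cone_X \<mu>) k (D i) \<and> induces_on_X \<mu> k (Delta \<mu> i) (D i) \<and>
            (\<forall>E. sheaf_op (cone_X \<mu>) k E \<and> induces_on_X \<mu> k (Delta \<mu> i) E
                 \<longrightarrow> ops_agree (cone_X \<mu>) k E (D i))) \<and>
         (\<forall>i j. ops_commute (cone_X \<mu>) k (D i) (D j))"
    using diff_op_Delta_X induces_Delta_X Delta_X_unique ops_commute_Delta_X
    by (intro exI[of _ "Delta_X \<mu> k"]) blast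
  moreover have "- (of_nat CARD('n) - 4) = 2 * k" by (simp add: assms(3))
  ultimately show ?thesis
    using diff_op_Delta divisible_q1_Delta ops_commute_Delta K_iso_O sqrt_of_K[OF assms(3)] by blast
qed

end
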